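(* Let $q,z,a,b,h$ be non-zero complex numbers with $|q|<1$, $|z|<1$, and assume there are no vanishing denominator factors. Then $$\left({}_2\phi_1\!\left(a,b;\tfrac{qa}b;q,z\right)\right)^2=\frac1{\vartheta(h,h\frac{qa}{b^2z};q)}\Big(S_1+S_2+S_3+S_4+S_5\Big),$$ where $$S_1=\frac{\vartheta(ha,h\frac q{b^2z};q)(\frac qb,\frac qb,\frac{qa}{b^2},\frac{qa}{b^2};q)_\infty}{(\frac{qa}b,\frac{qa}b,\frac q{b^2},\frac q{b^2};q)_\infty}\,{}_5\phi_4\!\left(a,b,\tfrac{b^2}a,\tfrac{b^2z}q,\tfrac qz;b^2,\pm b\sqrt q,-b;q,q\right),$$ $$S_2=\frac{\vartheta(h\frac{qa}{b^2},\frac hz;q)(a,a,b,b,\frac{b^2z}q,\frac{b^2z}q;q)_\infty}{(z,z,\frac{b^2}q,\frac{b^2}q,\frac{qa}b,\frac{qa}b;q)_\infty}\,{}_5\phi_4\!\left(\tfrac qa,\tfrac qb,\tfrac{qa}{b^2},z,\tfrac{q^2}{b^2z};\tfrac{q^2}{b^2},\pm\tfrac{q^{3/2}}b,-\tfrac qb;q,q\right),$$ $$S_3=\frac{\vartheta(h\frac{a\sqrt q}b,h\frac{\sqrt q}{bz};q)(\sqrt q,a,\frac{qa}{b^2},\frac{b^2z}q;q)_\infty}{(-1,-\sqrt q,z,\frac{qa}b,\frac{qa}b,\frac b{\sqrt q},\frac{\sqrt q}b;q)_\infty}\,{}_5\phi_4\!\left(\sqrt q,\tfrac{a\sqrt q}b,\tfrac{b\sqrt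 q}a,\tfrac{bz}{\sqrt q},\tfrac{q^{3/2}}{bz};-q,-\sqrt q,b\sqrt q,\tfrac{q^{3/2}}b;q,q\right),$$ $$S_4=\frac{\vartheta(-h\frac{a\sqrt q}b,-h\frac{\sqrt q}{bz};q)(-\sqrt q,a,\frac{qa}{b^2},\frac{b^2z}q;q)_\infty}{(-1,\sqrt q,z,\frac{qa}b,\frac{qa}b,-\frac b{\sqrt q},-\frac{\sqrt q}b;q)_\infty}\,{}_5\phi_4\!\left(-\sqrt q,-\tfrac{a\sqrt q}b,-\tfrac{b\sqrt q}a,-\tfrac{bz}{\sqrt q},-\tfrac{q^{3/2}}{bz};-q,\sqrt q,-b\sqrt q,-\tfrac{q^{3/2}}b;q,q\right),$$ $$S_5=\frac{\vartheta(-h\frac{qa}b,-\frac h{bz};q)(-1,a,-\frac ab,\frac{qa}{b^2},-\frac{bz}q,\frac{b^2z}q;q)_\infty}{(z,-bz,\pm\frac1{\sqrt q},\frac{qa}b,\frac{qa}b,-\frac{qa}b,-\frac1b,-\frac bq;q)_\infty}\,{}_5\phi_4\!\left(-q,-bz,-\tfrac{qa}b,-\tfrac{qb}a,-\tfrac{q^2}{bz};-qb,\pm q^{3/2},-\tfrac{q^2}b;q,q\right).$$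
   Context: Notation. $(a;q)_k=\prod_{j=0}^{k-1}(1-aq^j)$, $(a;q)_\infty=\prod_{j\ge0}(1-aq^j)$, $(a_1,\dots,a_r;q)_k=\prod_j(a_j;q)_k$ for $k\in\mathbb N_0\cup\{\infty\}$. In a list, $\pm x$ stands for the two entries $x,-x$. $\vartheta(x;q)=(x,q/x;q)_\infty$ for $x\ne0$, $\vartheta(x_1,\dots,x_k;q)=\prod_j\vartheta(x_j;q)$. ${}_{r+1}\phi_r(a_1,\dots,a_{r+1};b_1,\dots,b_r;q,z)=\sum_{k\ge0}\frac{(a_1,\dots,a_{r+1};q)_k}{(q,b_1,\dots,b_r;q)_k}z^k$ for $|z|<1$. A square root $\sqrt q$ is fixed and $q^{3/2}=(\sqrt q)^3$. Convention "no vanishing denominator factors": every infinite $q$-shifted factorial and every theta function appearing in a denominator is non-zero, and no denominator parameter of any series lies in $\{q^{-k}:k\in\mathbb N_0\}$. *)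

theory Defs
  imports "HOL-Analysis.Analysis"
begin

definition qpoch :: "complex list \<Rightarrow> complex \<Rightarrow> nat \<Rightarrow> complex" where
  "qpoch as q k = (\<Prod>a\<leftarrow>as. \<Prod>j<k. 1 - a * q ^ j)"

definition qpoch_inf :: "complex list \<Rightarrow> complex \<Rightarrow> complex" where
  "qpoch_inf as q = (\<Prod>a\<leftarrow>as. prodinf (\<lambda>j. 1 - a * q ^ j))"

definition qtheta :: "complex list \<Rightarrow> complex \<Rightarrow> complex" where
  "qtheta xs q = (\<Prod>x\<leftarrow>xs. qpoch_inf [x, q / x] q)"

(* The series with r + 1 upper and r lower parameters; as is meant to be one longer than bs.
   (For other lengths the usual definition carries an additional factor that is omitted here.) *)
definition qphi :: "complex list \<Rightarrow> complex list \<Rightarrow> complex \<Rightarrow> complex \<Rightarrow> complex" where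
  "qphi as bs q z = (\<Sum>k. qpoch as q k / qpoch (q # bs) q k * z ^ k)"

definition admissible_lower :: "complex list \<Rightarrow> complex \<Rightarrow> bool" where
  "admissible_lower bs q \<longleftrightarrow> (\<forall>b\<in>set bs. b \<notin> {q powi (- int k) | k :: nat. True})"

end

(* Put s = sqrt q, A = a s / b, Z = b z / s, B = b / s and write (x) for (x; q)_oo. Up to the factor
   (s A)(Z / B) the series 2phi1(a, b; q a / b; q, z) is a function g(A, Z, B), entire in A and Z, symmetric in
   A and Z and invariant under B -> 1 / B. The residues of

     theta(h A / w) theta(h w / Z) (s w)^2 (A w)(Z w) / ((B w)(w / B)(w^2)(A / w)(Z / w)) dw / w

   sum to zero over all poles. The poles w = c q^(-n) with c = 1 / B, B, 1, -1, -1 / s give the five series of the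
   theorem, the poles w = A q^n and w = Z q^n give the right-hand side of the nonterminating q-Clausen formula of
   Gasper and Rahman, which is g^2.

   The q-Clausen formula is proved by continuation in B: in the terminating cases A B = q^(-n) and Z B = q^(-n) it
   follows from the expression of the Taylor coefficients of a product of two 2phi1 series as Askey-Wilson polynomials
   (two applications of the q-Saalschuetz sum), and the difference of its two sides, divided by
   (A B)(A / B)(Z B)(Z / B), then has no poles and tends to zero on suitable circles.

   The contours require |s| < |A|, |Z| < 1 and A, Z in general position; both sides being holomorphic in A and in
   Z on the punctured plane, the identity extends to all admissible parameters. *)

theory Submission
  imports Defs "HOL-Complex_Analysis.Complex_Analysis"
begin

text \<open>The theta factors of the kernel are chosen for two reasons. At w = A and at w = Z their
  product has the same value theta(h) theta(h A / Z), so the two inner series combine into the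
  q-Clausen sum. Under w -> w / q it is multiplied by w^2 / (q A Z), which is free of h, so h enters
  none of the series. Since (w^2) = (w)(-w)(s w)(-s w), the square (s w)^2 removes the poles at
  q^(-n) / s and leaves five outer families. The monomials that all factors contribute under a shift
  by q reduce to a single q: it is the argument of the series, and it makes the kernel decay
  geometrically along circles.

  The obstacle in the q-Clausen formula is the growth of both sides in B. Writing g(A, Z, B)^2 as
  g(A, Z, B) g(Z, A, B) allows one factor to be measured against (A w), the other against (Z w). On
  circles that avoid the zeros, |(x)| is at least a multiple of |x|^(1/2); this weak bound suffices
  for all estimates.\<close>

section \<open>Holomorphic series and triangular exponents\<close>

lemma holomorphic_suminf:
  fixes t :: "nat \<Rightarrow> complex \<Rightarrow> complex"
  assumes S: "open S"
    and hol: "\<And>k. t k holomorphic_on S"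
    and bnd: "\<And>K. compact K \<Longrightarrow> K \<subseteq> S \<Longrightarrow> \<exists>M. summable M \<and> (\<forall>k. \<forall>x\<in>K. norm (t k x) \<le> M k)"
  shows "(\<lambda>x. \<Sum>k. t k x) holomorphic_on S"
proof (rule holomorphic_uniform_sequence[OF S])
  show "(\<lambda>x. \<Sum>k<n. t k x) holomorphic_on S" for n
    by (intro holomorphic_intros hol)
  fix x assume "x \<in> S"
  then obtain d where d: "d > 0" "cball x d \<subseteq> S"
    using S open_contains_cball by blast
  obtain M where M: "summable M" "\<And>k y. y \<in> cball x d \<Longrightarrow> norm (t k y) \<le> M k"
    using bnd[OF compact_cball d(2)] by blast
  have "uniform_limit (cball x d) (\<lambda>n y. \<Sum>k<n. t k y) (\<lambda>y. \<Sum>k. t k y) sequentially"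
    by (rule Weierstrass_m_test[OF M(2) M(1)])
  with d show "\<exists>d>0. cball x d \<subseteq> S \<and> uniform_limit (cball x d) (\<lambda>n y. \<Sum>k<n. t k y) (\<lambda>y. \<Sum>k. t k y) sequentially"
    by blast
qed

text \<open>The exponent n (n - 1) / 2 of the Gaussian factors, written as a sum so that its
  recursion needs neither subtraction nor division of natural numbers.\<close>

definition tri :: "nat \<Rightarrow> nat" where "tri n = (\<Sum>j<n. j)"

lemma tri_0 [simp]: "tri 0 = 0" and tri_Suc [simp]: "tri (Suc n) = tri n + n"
  by (auto simp: tri_def)

section \<open>Shifted factorials\<close>

locale qdisc =
  fixes q :: complex
  assumes q_nz: "q \<noteq> 0" and q_lt1: "norm q < 1"
begin

definition qfin :: "complex \<Rightarrow> nat \<Rightarrow> complex" where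
  "qfin a k = (\<Prod>j<k. 1 - a * q ^ j)"

definition qinf :: "complex \<Rightarrow> complex" where
  "qinf a = (\<Prod>j. 1 - a * q ^ j)"

definition theta :: "complex \<Rightarrow> complex" where
  "theta x = qinf x * qinf (q / x)"

lemma qfin_0 [simp]: "qfin a 0 = 1"
  and qfin_zero [simp]: "qfin 0 k = 1"
  by (auto simp: qfin_def)

lemma qfin_Suc: "qfin a (Suc k) = qfin a k * (1 - a * q ^ k)"
  by (simp add: qfin_def)

lemma qfin_add: "qfin a (m + n) = qfin a m * qfin (a * q ^ m) n"
  by (induction n) (auto simp: qfin_Suc power_add algebra_simps)

lemma qfin_Suc': "qfin a (Suc k) = (1 - a) * qfin (a * q) k"
  using qfin_add[of a 1 k] by (simp add: qfin_Suc)

lemma qfin_eq_0_iff: "qfin a k = 0 \<longleftrightarrow> (\<exists>j<k. a * q ^ j = 1)"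
  by (auto simp: qfin_def)

lemma q_power_neq_1: "q ^ Suc k \<noteq> 1"
proof
  assume "q ^ Suc k = 1"
  then have "norm q ^ Suc k = 1" by (metis norm_one norm_power)
  then show False using q_lt1 power_Suc_less_one[of "norm q" k] q_nz by auto
qed

lemma qfin_q_nz [simp]: "qfin q k \<noteq> 0"
  using q_power_neq_1 by (auto simp: qfin_eq_0_iff)

lemma summable_q: "summable (\<lambda>j. norm (a * q ^ j))"
  using q_lt1 by (auto simp: norm_mult norm_power intro!: summable_mult summable_geometric)

lemma convergent_prod_q: "convergent_prod (\<lambda>j. 1 - a * q ^ j)"
proof -
  have "abs_convergent_prod (\<lambda>j. 1 - a * q ^ j)"
    using summable_q[of a] by (intro summable_imp_abs_convergent_prod) (simp add: norm_mult norm_power)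
  then show ?thesis by (rule abs_convergent_prod_imp_convergent_prod)
qed

lemma qfin_LIMSEQ: "qfin a \<longlonglongrightarrow> qinf a"
  using convergent_prod_LIMSEQ[OF convergent_prod_q[of a]]
  unfolding qfin_def qinf_def by (simp add: LIMSEQ_lessThan_iff_atMost)

lemma qinf_split: "qinf a = qfin a n * qinf (a * q ^ n)"
proof -
  have "(\<lambda>m. qfin a (n + m)) \<longlonglongrightarrow> qinf a"
    using LIMSEQ_ignore_initial_segment[OF qfin_LIMSEQ[of a], of n] by (simp add: add.commute)
  moreover have "(\<lambda>m. qfin a (n + m)) \<longlonglongrightarrow> qfin a n * qinf (a * q ^ n)"
    unfolding qfin_add by (intro tendsto_intros qfin_LIMSEQ)
  ultimately show ?thesis by (rule LIMSEQ_unique)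
qed

lemma qinf_split1: "qinf a = (1 - a) * qinf (a * q)"
  using qinf_split[of a 1] by (simp add: qfin_Suc)

lemma qinf_zero [simp]: "qinf 0 = 1"
  by (simp add: qinf_def)

lemma qinf_eq_0_iff: "qinf a = 0 \<longleftrightarrow> (\<exists>j. a * q ^ j = 1)"
proof
  assume "qinf a = 0"
  then show "\<exists>j. a * q ^ j = 1"
    using prodinf_nonzero[OF convergent_prod_q[of a]] unfolding qinf_def
    by (metis eq_iff_diff_eq_0)
next
  assume "\<exists>j. a * q ^ j = 1"
  then obtain j where "a * q ^ j = 1" by auto
  then show "qinf a = 0"
    using qinf_split[of a "Suc j"] by (simp add: qfin_Suc)
qed

lemma qinf_neq_0: "norm a < 1 \<Longrightarrow> qinf a \<noteq> 0"
proof -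
  assume a: "norm a < 1"
  have "a * q ^ j \<noteq> 1" for j
  proof -
    have "norm (a * q ^ j) \<le> norm a"
      using q_lt1 by (simp add: norm_mult norm_power mult_left_le power_le_one)
    then show ?thesis using a by auto
  qed
  then show ?thesis by (simp add: qinf_eq_0_iff)
qed

lemma qfin_nz_if_qinf_nz: "qinf a \<noteq> 0 \<Longrightarrow> qfin a k \<noteq> 0"
  using qinf_split[of a k] by auto

lemma qfin_quot: "qinf (a * q ^ n) \<noteq> 0 \<Longrightarrow> qfin a n = qinf a / qinf (a * q ^ n)"
  using qinf_split[of a n] by (simp add: field_simps)

text \<open>By 1 + t <= exp t, a product of factors 1 + r |q|^j is at most exp of r times the
  geometric series. The bound does not depend on the number of factors, so it serves the finite and
  the infinite factorials alike.\<close>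

definition emaj :: "real \<Rightarrow> real" where "emaj r = exp (r / (1 - norm q))"

lemma emaj_mono: "r \<le> r' \<Longrightarrow> emaj r \<le> emaj r'"
  and emaj_pos [simp]: "emaj r > 0"
  using q_lt1 by (auto simp: emaj_def divide_right_mono)

lemma norm_qfin_le: "norm (qfin a k) \<le> emaj (norm a)"
proof -
  have "norm (qfin a k) \<le> (\<Prod>j<k. 1 + norm a * norm q ^ j)"
    unfolding qfin_def prod_norm[symmetric]
    by (intro prod_mono) (auto simp: norm_mult norm_power intro: order_trans[OF norm_triangle_ineq4])
  also have "\<dots> \<le> (\<Prod>j<k. exp (norm a * norm q ^ j))"
    by (intro prod_mono) (auto intro!: add_nonneg_nonneg)
  also have "\<dots> = exp (norm a * (\<Sum>j<k. norm q ^ j))"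
    by (simp add: exp_sum sum_distrib_left)
  also have "\<dots> \<le> emaj (norm a)"
  proof -
    have "(\<Sum>j<k. norm q ^ j) \<le> (\<Sum>j. norm q ^ j)"
      using q_lt1 by (intro sum_le_suminf summable_geometric) auto
    then have "(\<Sum>j<k. norm q ^ j) \<le> 1 / (1 - norm q)"
      using q_lt1 by (simp add: suminf_geometric)
    from mult_left_mono[OF this, of "norm a"] show ?thesis by (simp add: emaj_def)
  qed
  finally show ?thesis .
qed

lemma norm_qinf_le: "norm (qinf a) \<le> emaj (norm a)"
  by (rule Lim_bounded[OF tendsto_norm[OF qfin_LIMSEQ]]) (auto intro: norm_qfin_le)

lemma qfin_holomorphic [holomorphic_intros]:
  "f holomorphic_on S \<Longrightarrow> (\<lambda>x. qfin (f x) k) holomorphic_on S"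
  unfolding qfin_def by (intro holomorphic_intros)

text \<open>The differences (a)_n - (a)_(n+1) = a q^n (a)_n telescope. This turns the infinite
  product into a series, to which the M-test applies.\<close>

lemma qinf_holomorphic_UNIV: "qinf holomorphic_on UNIV"
proof -
  have hol: "(\<lambda>a. \<Sum>n. a * q ^ n * qfin a n) holomorphic_on UNIV"
  proof (rule holomorphic_suminf)
    fix K :: "complex set" assume "compact K"
    then obtain R where R: "\<And>x. x \<in> K \<Longrightarrow> norm x \<le> R"
      by (meson bounded_iff compact_imp_bounded)
    show "\<exists>M. summable M \<and> (\<forall>k. \<forall>x\<in>K. norm (x * q ^ k * qfin x k) \<le> M k)"
    proof (intro exI conjI allI ballI)
      show "summable (\<lambda>k. R * norm q ^ k * emaj R)"
        using q_lt1 by (intro summable_mult summable_mult2 summable_geometric) auto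
      fix k x assume x: "x \<in> K"
      have "norm (qfin x k) \<le> emaj R"
        using norm_qfin_le[of x k] emaj_mono[OF R[OF x]] by linarith
      with R[OF x] show "norm (x * q ^ k * qfin x k) \<le> R * norm q ^ k * emaj R"
        unfolding norm_mult norm_power by (intro mult_mono mult_nonneg_nonneg order_refl) (auto intro: order_trans[OF norm_ge_zero])
    qed
  qed (auto intro!: holomorphic_intros)
  have "qinf a = 1 - (\<Sum>n. a * q ^ n * qfin a n)" for a
  proof -
    have "(\<Sum>j<n. a * q ^ j * qfin a j) = 1 - qfin a n" for n
      by (induction n) (auto simp: qfin_Suc algebra_simps)
    then have "(\<lambda>n. a * q ^ n * qfin a n) sums (1 - qinf a)"
      unfolding sums_def by (simp add: tendsto_diff qfin_LIMSEQ)
    then show ?thesis by (simp add: sums_iff)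
  qed
  then have "qinf = (\<lambda>a. 1 - (\<Sum>n. a * q ^ n * qfin a n))" by (rule ext)
  with hol show ?thesis
    by (simp add: holomorphic_on_diff)
qed

lemma qinf_holomorphic [holomorphic_intros]:
  assumes "f holomorphic_on S" shows "(\<lambda>x. qinf (f x)) holomorphic_on S"
  using holomorphic_on_compose_gen[OF assms qinf_holomorphic_UNIV] by (simp add: o_def)

lemma qinf_isCont: "isCont qinf a"
  using qinf_holomorphic_UNIV holomorphic_on_imp_continuous_on continuous_on_eq_continuous_at open_UNIV by blast

lemma qinf_continuous [continuous_intros]:
  assumes "continuous_on S f" shows "continuous_on S (\<lambda>x. qinf (f x))"
  using continuous_on_compose2[OF holomorphic_on_imp_continuous_on[OF qinf_holomorphic_UNIV] assms] by simp

lemma qinf_tendsto [tendsto_intros]: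
  "(f \<longlongrightarrow> l) F \<Longrightarrow> ((\<lambda>x. qinf (f x)) \<longlongrightarrow> qinf l) F"
  using isCont_tendsto_compose[OF qinf_isCont] .

lemma theta_holomorphic [holomorphic_intros]:
  "f holomorphic_on S \<Longrightarrow> (\<And>x. x \<in> S \<Longrightarrow> f x \<noteq> 0) \<Longrightarrow> (\<lambda>x. theta (f x)) holomorphic_on S"
  unfolding theta_def by (intro holomorphic_intros) auto

text \<open>The reciprocals converge because the limit is non-zero, and convergent sequences are
  bounded. All bounds on denominators that are uniform in k come from here.\<close>

lemma qinf_inverse_bounded:
  assumes "qinf a \<noteq> 0"
  shows "\<exists>C>0. \<forall>k. norm (inverse (qfin a k)) \<le> C"
proof -
  have "(\<lambda>k. inverse (qfin a k)) \<longlonglongrightarrow> inverse (qinf a)"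
    by (intro tendsto_intros qfin_LIMSEQ assms)
  then have "Bseq (\<lambda>k. inverse (qfin a k))"
    using Bseq_def convergentI convergent_imp_Bseq by blast
  then show ?thesis by (auto simp: Bseq_def)
qed

text \<open>Each factor 1 - a q^(-j) equals - a q^(-j) (1 - q^j / a). The powers of q are collected
  on the left, with exponent 1 + ... + n, to keep all exponents natural.\<close>

lemma qfin_reverse:
  assumes "a \<noteq> 0"
  shows "qfin (a / q ^ n) n * q ^ tri (Suc n) = qfin (q / a) n * (- a) ^ n"
proof (induction n)
  case (Suc n)
  have "qfin (a / q ^ Suc n) (Suc n) = (1 - a / q ^ Suc n) * qfin (a / q ^ n) n"
    unfolding qfin_Suc' using q_nz by simp
  then have "qfin (a / q ^ Suc n) (Suc n) * q ^ tri (Suc (Suc n))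
     = (1 - a / q ^ Suc n) * q ^ Suc n * (qfin (a / q ^ n) n * q ^ tri (Suc n))"
    by (simp add: power_add)
  also have "\<dots> = (q ^ Suc n - a) * (qfin (q / a) n * (- a) ^ n)"
    unfolding Suc using q_nz by (simp add: field_simps)
  also have "\<dots> = qfin (q / a) (Suc n) * (- a) ^ Suc n"
    unfolding qfin_Suc using assms by (simp add: field_simps)
  finally show ?case .
qed simp

lemma qinf_reverse:
  assumes "a \<noteq> 0"
  shows "qinf (a / q ^ n) * q ^ tri (Suc n) = qfin (q / a) n * (- a) ^ n * qinf a"
  using qinf_split[of "a / q ^ n" n] qfin_reverse[OF assms, of n] q_nz by (simp add: mult_ac)

text \<open>Replacing x by q x removes 1 - x from the first product and adds 1 - 1 / x to the
  second; the quotient of the two is - 1 / x.\<close>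

lemma theta_shift: "x \<noteq> 0 \<Longrightarrow> theta (q * x) * x = - theta x"
proof -
  assume x: "x \<noteq> 0"
  have "qinf (1 / x) * x = (x - 1) * qinf (q / x)"
    using qinf_split1[of "1 / x"] x by (simp add: field_simps)
  then have "theta (q * x) * x = (x - 1) * qinf (q / x) * qinf (q * x)"
    using q_nz by (simp add: theta_def mult_ac)
  also have "\<dots> = - theta x"
    unfolding theta_def qinf_split1[of x] by (simp add: algebra_simps)
  finally show ?thesis .
qed

lemma theta_shift': "x \<noteq> 0 \<Longrightarrow> theta (x / q) * q = - theta x * x"
  using theta_shift[of "x / q"] q_nz by (auto simp: field_simps)

end

section \<open>Interchange of double series\<close>

lemma infsum_eq_suminf:
  fixes f :: "nat \<Rightarrow> complex"
  assumes "summable (\<lambda>n. norm (f n))"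
  shows "infsum f UNIV = suminf f"
  using norm_summable_imp_has_sum[OF assms] assms
  by (metis infsumI summable_norm_cancel summable_sums)

text \<open>A majorant of product form makes the family summable over all pairs, after which the
  unordered sums may be exchanged and read as ordinary series again.\<close>

lemma suminf_swap:
  fixes f :: "nat \<Rightarrow> nat \<Rightarrow> complex" and X Y :: "nat \<Rightarrow> real"
  assumes X: "summable X" and Y: "summable Y"
    and bnd: "\<And>n m. norm (f n m) \<le> X n * Y m"
    and X0: "\<And>n. X n \<ge> 0" and Y0: "\<And>n. Y n \<ge> 0"
  shows "(\<Sum>n. \<Sum>m. f n m) = (\<Sum>m. \<Sum>n. f n m)"
proof -
  have sX: "(X has_sum suminf X) UNIV" and sY: "(Y has_sum suminf Y) UNIV"
    using X Y X0 Y0 by (auto intro!: sums_nonneg_imp_has_sum summable_sums)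
  have "(\<lambda>(n, m). X n * Y m) summable_on UNIV \<times> UNIV"
  proof (rule summable_on_SigmaI)
    show "((\<lambda>m. case (n, m) of (n, m) \<Rightarrow> X n * Y m) has_sum X n * suminf Y) UNIV" for n
      using has_sum_cmult_right[OF sY] by simp
    show "(\<lambda>n. X n * suminf Y) summable_on UNIV"
      using has_sum_cmult_left[OF sX] by (auto simp: summable_on_def)
  qed (auto simp: X0 Y0)
  note XY = this[THEN iffD1[OF summable_on_iff_abs_summable_on_real]]
  have s: "(\<lambda>(n, m). f n m) summable_on UNIV \<times> UNIV"
    unfolding summable_on_iff_abs_summable_on_complex
    using XY by (rule Infinite_Sum.abs_summable_on_comparison_test) (use bnd X0 Y0 in auto)
  have s1: "summable (\<lambda>m. norm (f n m))" for n
    by (rule summable_comparison_test'[where g = "\<lambda>m. X n * Y m" and N = 0])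
       (use bnd Y in \<open>auto intro: summable_mult\<close>)
  have s2: "summable (\<lambda>n. norm (f n m))" for m
    by (rule summable_comparison_test'[where g = "\<lambda>n. X n * Y m" and N = 0])
       (use bnd X in \<open>auto intro: summable_mult2\<close>)
  have i1: "norm (\<Sum>m. f n m) \<le> X n * suminf Y" for n
  proof -
    have "norm (\<Sum>m. f n m) \<le> (\<Sum>m. norm (f n m))" using s1 by (rule summable_norm)
    also have "\<dots> \<le> (\<Sum>m. X n * Y m)"
      using bnd Y s1 by (intro suminf_le) (auto intro: summable_mult)
    also have "\<dots> = X n * suminf Y" using Y by (rule suminf_mult)
    finally show ?thesis .
  qed
  have i2: "norm (\<Sum>n. f n m) \<le> suminf X * Y m" for m
  proof -
    have "norm (\<Sum>n. f n m) \<le> (\<Sum>n. norm (f n m))" using s2 by (rule summable_norm)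
    also have "\<dots> \<le> (\<Sum>n. X n * Y m)"
      using bnd X s2 by (intro suminf_le) (auto intro: summable_mult2)
    also have "\<dots> = suminf X * Y m" using X by (rule suminf_mult2[symmetric])
    finally show ?thesis .
  qed
  have "(\<Sum>n. \<Sum>m. f n m) = infsum (\<lambda>n. \<Sum>m. f n m) UNIV"
  proof (rule infsum_eq_suminf[symmetric])
    show "summable (\<lambda>n. norm (\<Sum>m. f n m))"
      by (rule summable_comparison_test'[where g = "\<lambda>n. X n * suminf Y" and N = 0])
         (use i1 X in \<open>auto intro: summable_mult2\<close>)
  qed
  also have "\<dots> = infsum (\<lambda>n. infsum (\<lambda>m. f n m) UNIV) UNIV"
    by (simp add: infsum_eq_suminf s1)
  also have "\<dots> = infsum (\<lambda>m. infsum (\<lambda>n. f n m) UNIV) UNIV"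
    using s by (intro infsum_swap_banach) simp
  also have "\<dots> = infsum (\<lambda>m. \<Sum>n. f n m) UNIV"
    by (simp add: infsum_eq_suminf s2)
  also have "\<dots> = (\<Sum>m. \<Sum>n. f n m)"
  proof (rule infsum_eq_suminf)
    show "summable (\<lambda>m. norm (\<Sum>n. f n m))"
      by (rule summable_comparison_test'[where g = "\<lambda>m. suminf X * Y m" and N = 0])
         (use i2 Y in \<open>auto intro: summable_mult\<close>)
  qed
  finally show ?thesis .
qed

context qdisc
begin

section \<open>Terminating summations\<close>

text \<open>The induction step of the telescoping in \<open>q_saalschuetz\<close>, with J = q^i, M =
  q^m and q^n = q J M treated as independent variables, so that it is an identity of rational
  functions.\<close>

lemma saal_step:
  fixes J M u x y X :: complex
  assumes "1 - q * M \<noteq> 0" "1 - q * J \<noteq> 0" "1 - X * J \<noteq> 0" and X: "X = u * x * y"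
  shows "- (q * M * u * (1 - x * J) * (1 - y * J)) * ((1 - u * M) / (1 - q * M))
    + ((1 - q * (q * J * M)) * (1 - X * (q * J * M)) * ((1 - u * M) / (1 - q * M))
       - (1 - u * x * (q * J * M)) * (1 - u * y * (q * J * M)))
      * ((1 - x * J) * (1 - y * J) * u / ((1 - q * J) * (1 - X * J)))
    = - (M * u * (1 - x * (q * J)) * (1 - y * (q * J)))
      * ((1 - x * J) * (1 - y * J) * u / ((1 - q * J) * (1 - X * J)))"
  using assms(1-3) unfolding X by (simp add: divide_simps) algebra

text \<open>This convolution form compares the coefficients of z^n in Heine's analogue of Euler's
  transformation, (u z) / (z) times 2phi1(x, y; X; q, u z) equals 2phi1(u x, u y; X; q, z). The
  proof is creative telescoping in n.\<close>

lemma q_saalschuetz: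
  assumes X: "X = u * x * y" and nz: "\<And>k. qfin X k \<noteq> 0"
  shows "(\<Sum>j\<le>n. qfin u (n - j) / qfin q (n - j) * (qfin x j * qfin y j / (qfin q j * qfin X j)) * u ^ j)
    = qfin (u * x) n * qfin (u * y) n / (qfin q n * qfin X n)"
proof -
  define t where "t n j = qfin u (n - j) / qfin q (n - j) * (qfin x j * qfin y j / (qfin q j * qfin X j)) * u ^ j" for n j
  have X1: "1 - X * q ^ j \<noteq> 0" for j using nz[of "Suc j"] by (auto simp: qfin_Suc)
  have q1: "1 - q * q ^ j \<noteq> 0" for j using qfin_q_nz[of "Suc j"] by (auto simp: qfin_Suc)
  \<comment> \<open>The right side is the telescoping certificate: the first-order recurrence
    operator in n, applied to the summand, has partial sums that are multiples of the last
    term.\<close>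
  have partial: "(\<Sum>i\<le>j. (1 - q ^ Suc n) * (1 - X * q ^ n) * t (Suc n) i
       - (1 - u * x * q ^ n) * (1 - u * y * q ^ n) * t n i)
     = - (q ^ (n - j) * u * (1 - x * q ^ j) * (1 - y * q ^ j)) * t n j" if "j \<le> n" for n j
    using that
  proof (induction j)
    case 0
    have base: "(1 - q * N) * t1 = t0 * (1 - u * N) \<Longrightarrow>
        (1 - q * N) * (1 - u * x * y * N) * t1 - (1 - u * x * N) * (1 - u * y * N) * t0
        = - (N * u * (1 - x) * (1 - y)) * t0" for N t0 t1 :: complex
      by algebra
    have "(1 - q * q ^ n) * t (Suc n) 0 = t n 0 * (1 - u * q ^ n)"
      using q1[of n] by (simp add: t_def qfin_Suc)
    then have "(1 - q * q ^ n) * (1 - X * q ^ n) * t (Suc n) 0 - (1 - u * x * q ^ n) * (1 - u * y * q ^ n) * t n 0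
        = - (q ^ n * u * (1 - x) * (1 - y)) * t n 0"
      unfolding X using base by blast
    then show ?case by simp
  next
    case (Suc i)
    then obtain m where m: "n = Suc (i + m)" by (metis add_Suc le_Suc_ex)
    define T where "T = qfin u m / qfin q m * (qfin x i * qfin y i / (qfin q i * qfin X i)) * u ^ i"
    define r where "r = (1 - x * q ^ i) * (1 - y * q ^ i) * u / ((1 - q * q ^ i) * (1 - X * q ^ i))"
    define S where "S = (1 - u * q ^ m) / (1 - q * q ^ m)"
    have t1: "t n i = T * S"
      and t2: "t n (Suc i) = T * r"
      and t3: "t (Suc n) (Suc i) = T * (r * S)"
      unfolding m t_def T_def r_def S_def by (simp_all add: qfin_Suc Suc_diff_le mult_ac)
    have qn: "q ^ n = q * q ^ i * q ^ m" and e: "n - i = Suc m" "n - Suc i = m"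
      by (auto simp: m power_add)
    have "(\<Sum>i'\<le>Suc i. (1 - q ^ Suc n) * (1 - X * q ^ n) * t (Suc n) i'
       - (1 - u * x * q ^ n) * (1 - u * y * q ^ n) * t n i')
       = - (q ^ (n - i) * u * (1 - x * q ^ i) * (1 - y * q ^ i)) * t n i
        + ((1 - q ^ Suc n) * (1 - X * q ^ n) * t (Suc n) (Suc i)
       - (1 - u * x * q ^ n) * (1 - u * y * q ^ n) * t n (Suc i))"
      using Suc by simp
    also have "\<dots> = T * (- (q * q ^ m * u * (1 - x * q ^ i) * (1 - y * q ^ i)) * S
    + ((1 - q * (q * q ^ i * q ^ m)) * (1 - X * (q * q ^ i * q ^ m)) * S
       - (1 - u * x * (q * q ^ i * q ^ m)) * (1 - u * y * (q * q ^ i * q ^ m))) * r)"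
      unfolding t1 t2 t3 power_Suc qn e by (simp add: algebra_simps)
    also have "\<dots> = T * (- (q ^ m * u * (1 - x * (q * q ^ i)) * (1 - y * (q * q ^ i))) * r)"
      unfolding r_def S_def by (subst saal_step[OF q1 q1 X1 X]) simp
    finally show ?case unfolding t2 e by (simp add: mult_ac)
  qed
  \<comment> \<open>At j = n the certificate is cancelled by the one term
    \<open>t (Suc n) (Suc n)\<close> outside the range of the partial sums, so the full sums satisfy
    a homogeneous recurrence.\<close>
  have rec: "(1 - q ^ Suc n) * (1 - X * q ^ n) * (\<Sum>i\<le>Suc n. t (Suc n) i)
      = (1 - u * x * q ^ n) * (1 - u * y * q ^ n) * (\<Sum>i\<le>n. t n i)" for n
  proof -
    have "(1 - q ^ Suc n) * (1 - X * q ^ n) * t (Suc n) (Suc n) = u * (1 - x * q ^ n) * (1 - y * q ^ n) * t n n"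
      using q1[of n] X1[of n] nz[of n] unfolding t_def by (simp add: qfin_Suc divide_simps)
    moreover have "(1 - q ^ Suc n) * (1 - X * q ^ n) * (\<Sum>i\<le>n. t (Suc n) i)
       - (1 - u * x * q ^ n) * (1 - u * y * q ^ n) * (\<Sum>i\<le>n. t n i)
       = - (u * (1 - x * q ^ n) * (1 - y * q ^ n)) * t n n"
      using partial[of n n] unfolding sum_subtractf sum_distrib_left by simp
    ultimately show ?thesis
      unfolding sum.atMost_Suc distrib_left by (simp add: diff_eq_eq)
  qed
  have "(\<Sum>j\<le>n. t n j) = qfin (u * x) n * qfin (u * y) n / (qfin q n * qfin X n)"
  proof (induction n)
    case 0 show ?case by (simp add: t_def)
  next
    case (Suc n)
    then show ?case using rec[of n] q1[of n] X1[of n] nz[of n] nz[of "Suc n"]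
      by (simp add: qfin_Suc divide_simps del: sum.atMost_Suc) (simp add: mult_ac)
  qed
  then show ?thesis by (simp add: t_def)
qed

lemma vand_step:
  fixes J M b x c :: complex
  assumes "1 - q * M \<noteq> 0" "1 - q * J \<noteq> 0" "1 - c * J \<noteq> 0" and c: "c = x * b"
  shows "(q * M * J * b * (1 - x * J)) * (1 / (1 - q * M))
    + ((1 - q * (q * J * M)) * (1 - c * (q * J * M)) * (1 / (1 - q * M)) - (1 - b * (q * J * M)))
      * (- J * (1 - x * J) * b / ((1 - q * J) * (1 - c * J)))
    = (M * (q * J) * b * (1 - x * (q * J)))
      * (- J * (1 - x * J) * b / ((1 - q * J) * (1 - c * J)))"
  using assms(1-3) unfolding c by (simp add: divide_simps) algebra

text \<open>Proved by the same telescoping. With (q)_(n-l) in the denominator the sum is a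
  convolution, which is the shape that \<open>jackson\<close> needs to carry out the outer summation
  by the q-binomial theorem.\<close>

lemma q_vandermonde:
  assumes c: "c = x * b" and nz: "\<And>k. qfin c k \<noteq> 0"
  shows "(\<Sum>l\<le>n. (- b) ^ l * q ^ tri l * qfin x l / (qfin q l * qfin c l * qfin q (n - l)))
    = qfin b n / (qfin q n * qfin c n)"
proof -
  define t where "t n l = (- b) ^ l * q ^ tri l * qfin x l / (qfin q l * qfin c l * qfin q (n - l))" for n l
  have c1: "1 - c * q ^ j \<noteq> 0" for j using nz[of "Suc j"] by (auto simp: qfin_Suc)
  have q1: "1 - q * q ^ j \<noteq> 0" for j using qfin_q_nz[of "Suc j"] by (auto simp: qfin_Suc)
  have partial: "(\<Sum>i\<le>j. (1 - q ^ Suc n) * (1 - c * q ^ n) * t (Suc n) i - (1 - b * q ^ n) * t n i)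
     = q ^ (n - j) * q ^ j * b * (1 - x * q ^ j) * t n j" if "j \<le> n" for n j
    using that
  proof (induction j)
    case 0
    have base: "(1 - q * N) * (1 - x * b * N) * t1 - (1 - b * N) * ((1 - q * N) * t1)
        = N * b * (1 - x) * ((1 - q * N) * t1)" for N t1 :: complex
      by (simp add: algebra_simps)
    have "t n 0 = (1 - q * q ^ n) * t (Suc n) 0"
      using q1[of n] by (simp add: t_def qfin_Suc)
    then have "(1 - q * q ^ n) * (1 - c * q ^ n) * t (Suc n) 0 - (1 - b * q ^ n) * t n 0
       = q ^ n * b * (1 - x) * t n 0"
      unfolding c by (simp only: base)
    then show ?case by simp
  next
    case (Suc i)
    then obtain m where m: "n = Suc (i + m)" by (metis add_Suc le_Suc_ex)
    define T where "T = (- b) ^ i * q ^ tri i * qfin x i / (qfin q i * qfin c i * qfin q m)"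
    define r where "r = - (q ^ i) * (1 - x * q ^ i) * b / ((1 - q * q ^ i) * (1 - c * q ^ i))"
    define S where "S = 1 / (1 - q * q ^ m)"
    have t1: "t n i = T * S"
      and t2: "t n (Suc i) = T * r"
      and t3: "t (Suc n) (Suc i) = T * (r * S)"
      unfolding m t_def T_def r_def S_def by (simp_all add: qfin_Suc Suc_diff_le power_add mult_ac)
    have qn: "q ^ n = q * q ^ i * q ^ m" and e: "n - i = Suc m" "n - Suc i = m"
      by (auto simp: m power_add)
    have "(\<Sum>i'\<le>Suc i. (1 - q ^ Suc n) * (1 - c * q ^ n) * t (Suc n) i' - (1 - b * q ^ n) * t n i')
       = q ^ (n - i) * q ^ i * b * (1 - x * q ^ i) * t n i
        + ((1 - q ^ Suc n) * (1 - c * q ^ n) * t (Suc n) (Suc i) - (1 - b * q ^ n) * t n (Suc i))"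
      using Suc by simp
    also have "\<dots> = T * ((q * q ^ m * q ^ i * b * (1 - x * q ^ i)) * S
    + ((1 - q * (q * q ^ i * q ^ m)) * (1 - c * (q * q ^ i * q ^ m)) * S
       - (1 - b * (q * q ^ i * q ^ m))) * r)"
      unfolding t1 t2 t3 power_Suc qn e by (simp add: algebra_simps)
    also have "\<dots> = T * ((q ^ m * (q * q ^ i) * b * (1 - x * (q * q ^ i))) * r)"
      unfolding r_def S_def by (subst vand_step[OF q1 q1 c1 c]) simp
    finally show ?case unfolding t2 e by (simp add: mult_ac)
  qed
  have rec: "(1 - q ^ Suc n) * (1 - c * q ^ n) * (\<Sum>i\<le>Suc n. t (Suc n) i)
      = (1 - b * q ^ n) * (\<Sum>i\<le>n. t n i)" for n
  proof -
    have "(1 - q ^ Suc n) * (1 - c * q ^ n) * t (Suc n) (Suc n) = - (q ^ n * b * (1 - x * q ^ n) * t n n)"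
      using q1[of n] c1[of n] nz[of n] unfolding t_def by (simp add: qfin_Suc divide_simps power_add)
    moreover have "(1 - q ^ Suc n) * (1 - c * q ^ n) * (\<Sum>i\<le>n. t (Suc n) i)
       - (1 - b * q ^ n) * (\<Sum>i\<le>n. t n i) = q ^ n * b * (1 - x * q ^ n) * t n n"
      using partial[of n n] unfolding sum_subtractf sum_distrib_left by simp
    ultimately show ?thesis
      unfolding sum.atMost_Suc distrib_left by (simp add: diff_eq_eq)
  qed
  have "(\<Sum>j\<le>n. t n j) = qfin b n / (qfin q n * qfin c n)"
  proof (induction n)
    case 0 show ?case by (simp add: t_def)
  next
    case (Suc n)
    then show ?case using rec[of n] q1[of n] c1[of n] nz[of n] nz[of "Suc n"]
      by (simp add: qfin_Suc divide_simps del: sum.atMost_Suc) (simp add: mult_ac)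
  qed
  then show ?thesis by (simp add: t_def)
qed

section \<open>The q-binomial theorem and Heine's transformation\<close>

lemma qfin_quot_bounded:
  assumes "qinf c \<noteq> 0"
  shows "\<exists>C>0. \<forall>k. norm (qfin a k / qfin c k) \<le> C"
proof -
  obtain C where C: "C > 0" "\<And>k. norm (inverse (qfin c k)) \<le> C"
    using qinf_inverse_bounded[OF assms] by blast
  have "norm (qfin a k / qfin c k) \<le> emaj (norm a) * C" for k
    unfolding divide_inverse norm_mult by (intro mult_mono norm_qfin_le C) (auto simp: less_imp_le)
  then show ?thesis using C(1) by (intro exI[of _ "emaj (norm a) * C"]) auto
qed

lemma qinf_q_nz [simp]: "qinf q \<noteq> 0"
  using q_lt1 by (rule qinf_neq_0)

lemma q_binomial_summable:
  assumes "norm z < 1"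
  shows "summable (\<lambda>n. norm (qfin a n / qfin q n * z ^ n))"
proof -
  obtain C where C: "\<And>k. norm (qfin a k / qfin q k) \<le> C"
    using qfin_quot_bounded[OF qinf_q_nz] by blast
  show ?thesis
  proof (rule summable_comparison_test'[where g = "\<lambda>n. C * norm z ^ n" and N = 0])
    show "summable (\<lambda>n. C * norm z ^ n)" using assms by (intro summable_mult summable_geometric) auto
    show "norm (norm (qfin a n / qfin q n * z ^ n)) \<le> C * norm z ^ n" for n
      using mult_right_mono[OF C[of n], of "norm z ^ n"] by (simp add: norm_mult norm_power norm_divide)
  qed
qed

text \<open>Comparing coefficients gives (1 - z) f(z) = (1 - a z) f(q z). Iterating this and letting
  z q^m tend to 0, where f is continuous with value 1, produces the two infinite products.\<close>

theorem q_binomial: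
  assumes z: "norm z < 1"
  shows "(\<lambda>n. qfin a n / qfin q n * z ^ n) sums (qinf (a * z) / qinf z)"
proof -
  define c where "c n = qfin a n / qfin q n" for n
  define f where "f z = (\<Sum>n. c n * z ^ n)" for z
  have sm: "summable (\<lambda>n. c n * z ^ n)" if "norm z < 1" for z
    using q_binomial_summable[OF that, of a] unfolding c_def by (rule summable_norm_cancel)
  have f: "(\<lambda>n. c n * z ^ n) sums f z" if "norm z < 1" for z
    using sm[OF that] by (simp add: f_def summable_sums)
  have nqz: "norm (z * q ^ m) < 1" if "norm z < 1" for z m
  proof -
    have "norm (z * q ^ m) \<le> norm z"
      using q_lt1 by (simp add: norm_mult norm_power mult_left_le power_le_one)
    then show ?thesis using that by simp
  qed
  have fe: "(1 - z) * f z = (1 - a * z) * f (z * q)" if z: "norm z < 1" for z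
  proof -
    have nq: "norm (z * q) < 1" using nqz[OF z, of 1] by simp
    have cS: "c (Suc n) * (1 - q ^ Suc n) = c n * (1 - a * q ^ n)" for n
      using qfin_q_nz[of "Suc n"] unfolding c_def by (simp add: qfin_Suc divide_simps)
    have "(\<lambda>n. c n * z ^ n - c n * (z * q) ^ n) sums (f z - f (z * q))"
      by (intro sums_diff f z nq)
    then have "(\<lambda>n. c (Suc n) * z ^ Suc n - c (Suc n) * (z * q) ^ Suc n) sums (f z - f (z * q))"
      using sums_Suc_iff[of "\<lambda>n. c n * z ^ n - c n * (z * q) ^ n" "f z - f (z * q)"] by simp
    also have "(\<lambda>n. c (Suc n) * z ^ Suc n - c (Suc n) * (z * q) ^ Suc n)
       = (\<lambda>n. z * (c n * z ^ n) - a * z * (c n * (z * q) ^ n))"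
    proof
      fix n
      have "c (Suc n) * z ^ Suc n - c (Suc n) * (z * q) ^ Suc n = c (Suc n) * (1 - q ^ Suc n) * z ^ Suc n"
        by (simp add: algebra_simps power_mult_distrib)
      then show "c (Suc n) * z ^ Suc n - c (Suc n) * (z * q) ^ Suc n = z * (c n * z ^ n) - a * z * (c n * (z * q) ^ n)"
        unfolding cS by (simp add: algebra_simps power_mult_distrib)
    qed
    finally have "(\<lambda>n. z * (c n * z ^ n) - a * z * (c n * (z * q) ^ n)) sums (f z - f (z * q))" .
    moreover have "(\<lambda>n. z * (c n * z ^ n) - a * z * (c n * (z * q) ^ n)) sums (z * f z - a * z * f (z * q))"
      by (intro sums_diff sums_mult f z nq)
    ultimately have "f z - f (z * q) = z * f z - a * z * f (z * q)"
      by (rule sums_unique2)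
    then show ?thesis by (simp add: algebra_simps)
  qed
  have z1: "1 - w \<noteq> 0" if "norm w < 1" for w :: complex using that by auto
  have it: "f z * qfin z m = qfin (a * z) m * f (z * q ^ m)" for m
  proof (induction m)
    case (Suc m)
    have "f z * qfin z (Suc m) = qfin (a * z) m * ((1 - z * q ^ m) * f (z * q ^ m))"
      using Suc by (simp add: qfin_Suc algebra_simps)
    also have "\<dots> = qfin (a * z) (Suc m) * f (z * q ^ Suc m)"
      unfolding fe[OF nqz[OF z]] by (simp add: qfin_Suc mult_ac)
    finally show ?case .
  qed simp
  have "isCont f 0"
    unfolding f_def using sm[of "1/2"] by (intro isCont_powser[of c "1/2"]) auto
  moreover have "(\<lambda>m. z * q ^ m) \<longlonglongrightarrow> z * 0"
    using q_lt1 by (intro tendsto_intros LIMSEQ_power_zero)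
  ultimately have "(\<lambda>m. f (z * q ^ m)) \<longlonglongrightarrow> f 0"
    using isCont_tendsto_compose[of 0 f "\<lambda>m. z * q ^ m"] by simp
  also have "f 0 = 1" unfolding f_def powser_zero by (simp add: c_def)
  finally have "(\<lambda>m. qfin (a * z) m * f (z * q ^ m)) \<longlonglongrightarrow> qinf (a * z) * 1"
    by (intro tendsto_intros qfin_LIMSEQ)
  moreover have "(\<lambda>m. f z * qfin z m) \<longlonglongrightarrow> f z * qinf z"
    by (intro tendsto_intros qfin_LIMSEQ)
  ultimately have "f z * qinf z = qinf (a * z)"
    unfolding it using LIMSEQ_unique by auto
  then have "f z = qinf (a * z) / qinf z" using qinf_neq_0[OF z] by (simp add: field_simps)
  then show ?thesis using f[OF z] by (simp add: c_def)
qed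

lemma norm_mult_qpow_lt1: "norm z < 1 \<Longrightarrow> norm (z * q ^ m) < 1"
proof -
  assume z: "norm z < 1"
  have "norm (z * q ^ m) \<le> norm z"
    using q_lt1 by (simp add: norm_mult norm_power mult_left_le power_le_one)
  then show ?thesis using z by simp
qed

text \<open>Both sides are the double series
  \<open>\<Sum>\<^sub>n \<Sum>\<^sub>m (a)\<^sub>n (d)\<^sub>m z\<^sup>n b\<^sup>m q\<^sup>n\<^sup>m / ((q)\<^sub>n (q)\<^sub>m)\<close>.\<close>

lemma heine_symmetric:
  assumes z: "norm z < 1" and b: "norm b < 1"
  shows "(\<Sum>n. qfin a n / qfin q n * z ^ n * (qinf (d * (b * q ^ n)) / qinf (b * q ^ n)))
    = (\<Sum>m. qfin d m / qfin q m * b ^ m * (qinf (a * (z * q ^ m)) / qinf (z * q ^ m)))"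
proof -
  define f where "f n m = (qfin a n / qfin q n * z ^ n) * (qfin d m / qfin q m * (b * q ^ n) ^ m)" for n m
  have f': "f n m = (qfin d m / qfin q m * b ^ m) * (qfin a n / qfin q n * (z * q ^ m) ^ n)" for n m
    unfolding f_def by (simp add: power_mult_distrib power_mult[symmetric] mult_ac del: mult_eq_0_iff)
  have "(\<Sum>n. \<Sum>m. f n m) = (\<Sum>m. \<Sum>n. f n m)"
  proof (rule suminf_swap[OF q_binomial_summable[OF z, of a] q_binomial_summable[OF b, of d]])
    fix n m
    \<comment> \<open>The coupling factor q^(n m) has modulus at most 1; dropping it leaves a
      majorant of product form.\<close>
    have "norm (q ^ (n * m)) \<le> 1" using q_lt1 by (simp add: norm_power power_le_one)
    then have "norm ((qfin a n / qfin q n * z ^ n) * (qfin d m / qfin q m * b ^ m)) * norm (q ^ (n * m))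
       \<le> norm ((qfin a n / qfin q n * z ^ n) * (qfin d m / qfin q m * b ^ m))"
      by (rule mult_left_le) auto
    moreover have "f n m = (qfin a n / qfin q n * z ^ n) * (qfin d m / qfin q m * b ^ m) * q ^ (n * m)"
      unfolding f_def by (simp add: power_mult_distrib power_mult[symmetric] mult_ac del: mult_eq_0_iff)
    ultimately show "norm (f n m) \<le> norm (qfin a n / qfin q n * z ^ n) * norm (qfin d m / qfin q m * b ^ m)"
      by (simp add: norm_mult norm_divide mult_ac)
  qed auto
  moreover have "(\<Sum>m. f n m) = qfin a n / qfin q n * z ^ n * (qinf (d * (b * q ^ n)) / qinf (b * q ^ n))" for n
    using sums_mult[OF q_binomial[OF norm_mult_qpow_lt1[OF b], of d n], of "qfin a n / qfin q n * z ^ n"]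
    unfolding f_def by (simp add: sums_iff)
  moreover have "(\<Sum>n. f n m) = qfin d m / qfin q m * b ^ m * (qinf (a * (z * q ^ m)) / qinf (z * q ^ m))" for m
    using sums_mult[OF q_binomial[OF norm_mult_qpow_lt1[OF z], of a m], of "qfin d m / qfin q m * b ^ m"]
    unfolding f' by (simp add: sums_iff)
  ultimately show ?thesis by simp
qed

lemma qpow_tri_summable:
  "summable (\<lambda>l. norm q ^ tri l * r ^ l)" if "r \<ge> 0" for r :: real
proof (cases "r = 0")
  case False
  have "(\<lambda>l. norm q ^ l * r) \<longlonglongrightarrow> 0 * r"
    using q_lt1 by (intro tendsto_intros LIMSEQ_power_zero) auto
  then have "eventually (\<lambda>l. norm q ^ l * r < 1/2) sequentially"
    by (intro order_tendstoD) auto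
  then obtain N where N: "\<And>l. l \<ge> N \<Longrightarrow> norm q ^ l * r < 1/2"
    by (auto simp: eventually_sequentially)
  show ?thesis
  proof (rule summable_ratio_test[where c = "1/2" and N = N])
    fix l assume "N \<le> l"
    from mult_right_mono[OF less_imp_le[OF N[OF this]], of "norm q ^ tri l * r ^ l"]
    show "norm (norm q ^ tri (Suc l) * r ^ Suc l) \<le> 1/2 * norm (norm q ^ tri l * r ^ l)"
      using that by (simp add: power_add mult_ac)
  qed simp
next
  case True
  show ?thesis unfolding True
    by (rule summable_finite[of "{0}"]) auto
qed

text \<open>Jackson's transformation of a \<open>\<^sub>2\<phi>\<^sub>1\<close> into a \<open>\<^sub>2\<phi>\<^sub>2\<close>; writing \<open>x\<close> for \<open>c / b\<close> avoids the division.\<close>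

lemma jackson:
  assumes c: "c = x * b" and nz: "qinf c \<noteq> 0" and z: "norm z < 1"
  shows "qinf z * (\<Sum>j. qfin a j * qfin b j / (qfin q j * qfin c j) * z ^ j)
    = (\<Sum>l. qfin a l * qfin x l * (- (b * z)) ^ l * q ^ tri l / (qfin q l * qfin c l) * qinf (a * z * q ^ l))"
proof -
  define g where "g l = (- b) ^ l * q ^ tri l * qfin x l / (qfin q l * qfin c l)" for l
  \<comment> \<open>The triangular range l <= j is encoded by zero terms, so that the interchange
    runs over all pairs.\<close>
  define f where "f j l = (if l \<le> j then qfin a j * z ^ j * (g l / qfin q (j - l)) else 0)" for j l
  have nzf: "qfin c k \<noteq> 0" for k using nz by (rule qfin_nz_if_qinf_nz)
  obtain C1 where C1: "C1 > 0" "\<And>k. norm (qfin x k / qfin c k) \<le> C1"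
    using qfin_quot_bounded[OF nz] by blast
  obtain C2 where C2: "C2 > 0" "\<And>k. norm (inverse (qfin q k)) \<le> C2"
    using qinf_inverse_bounded[OF qinf_q_nz] by blast
  have gb: "norm (g l) \<le> C1 * C2 * (norm q ^ tri l * norm b ^ l)" for l
  proof -
    have "norm (g l) = norm (qfin x l / qfin c l) * norm (inverse (qfin q l)) * (norm q ^ tri l * norm b ^ l)"
      by (simp add: g_def norm_mult norm_divide norm_power norm_inverse divide_simps)
    also have "\<dots> \<le> C1 * C2 * (norm q ^ tri l * norm b ^ l)"
      by (intro mult_right_mono mult_mono C1 C2) (auto intro: less_imp_le[OF C1(1)])
    finally show ?thesis .
  qed
  have "(\<Sum>j. \<Sum>l. f j l) = (\<Sum>l. \<Sum>j. f j l)"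
  proof (rule suminf_swap[where X = "\<lambda>j. emaj (norm a) * norm z ^ j"
        and Y = "\<lambda>l. C2 * (C1 * C2 * (norm q ^ tri l * norm b ^ l))"])
    show "summable (\<lambda>j. emaj (norm a) * norm z ^ j)"
      using z by (intro summable_mult summable_geometric) auto
    \<comment> \<open>The Gaussian factor makes this majorant summable for every b; only |z| < 1 has
      to be assumed.\<close>
    show "summable (\<lambda>l. C2 * (C1 * C2 * (norm q ^ tri l * norm b ^ l)))"
      by (intro summable_mult qpow_tri_summable) auto
    show "emaj (norm a) * norm z ^ n \<ge> 0" for n by (simp add: less_imp_le)
    show Y0: "C2 * (C1 * C2 * (norm q ^ tri l * norm b ^ l)) \<ge> 0" for l
      using C1(1) C2(1) by simp
    fix j l
    have "norm (qfin a j * z ^ j * (g l / qfin q (j - l)))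
      = norm (qfin a j) * norm z ^ j * (norm (inverse (qfin q (j - l))) * norm (g l))"
      by (simp add: norm_mult norm_divide norm_power norm_inverse divide_simps)
    also have "\<dots> \<le> emaj (norm a) * norm z ^ j * (C2 * (C1 * C2 * (norm q ^ tri l * norm b ^ l)))"
      by (intro mult_mono norm_qfin_le C2 gb order_refl mult_nonneg_nonneg) (auto simp: less_imp_le[OF C2(1)] less_imp_le)
    finally show "norm (f j l) \<le> emaj (norm a) * norm z ^ j * (C2 * (C1 * C2 * (norm q ^ tri l * norm b ^ l)))"
      using Y0[of l] by (auto simp: f_def less_imp_le)
  qed
  moreover have "(\<Sum>l. f j l) = qfin a j * qfin b j / (qfin q j * qfin c j) * z ^ j" for j
  proof -
    have "(\<Sum>l. f j l) = (\<Sum>l\<le>j. f j l)"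
      by (rule suminf_finite) (auto simp: f_def)
    also have "\<dots> = qfin a j * z ^ j * (\<Sum>l\<le>j. g l / qfin q (j - l))"
      by (simp add: f_def sum_distrib_left)
    also have "(\<Sum>l\<le>j. g l / qfin q (j - l)) = qfin b j / (qfin q j * qfin c j)"
      using q_vandermonde[OF c nzf, of j] by (simp add: g_def)
    finally show ?thesis by (simp add: mult_ac)
  qed
  moreover have "(\<Sum>j. f j l) = qfin a l * qfin x l * (- (b * z)) ^ l * q ^ tri l / (qfin q l * qfin c l)
      * (qinf (a * z * q ^ l) / qinf z)" for l
  proof -
    have "(\<lambda>m. qfin a l * z ^ l * g l * (qfin (a * q ^ l) m / qfin q m * z ^ m))
       sums (qfin a l * z ^ l * g l * (qinf (a * q ^ l * z) / qinf z))"
      by (intro sums_mult q_binomial z)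
    also have "(\<lambda>m. qfin a l * z ^ l * g l * (qfin (a * q ^ l) m / qfin q m * z ^ m)) = (\<lambda>m. f (m + l) l)"
      by (auto simp: f_def qfin_add[of a l] add.commute[of _ l] power_add mult_ac)
    finally have "(\<lambda>j. f j l) sums (qfin a l * z ^ l * g l * (qinf (a * q ^ l * z) / qinf z) + (\<Sum>j<l. f j l))"
      using sums_iff_shift[of "\<lambda>j. f j l" l] by simp
    also have "(\<Sum>j<l. f j l) = 0" by (simp add: f_def)
    also have "qfin a l * z ^ l * g l * (qinf (a * q ^ l * z) / qinf z) + 0 = qfin a l * qfin x l * (- (b * z)) ^ l * q ^ tri l / (qfin q l * qfin c l)
      * (qinf (a * z * q ^ l) / qinf z)"
      unfolding g_def by (simp add: power_mult_distrib[of "-b" z, simplified] mult_ac)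
    finally show ?thesis by (simp add: sums_iff)
  qed
  ultimately have eq: "(\<Sum>j. qfin a j * qfin b j / (qfin q j * qfin c j) * z ^ j)
     = (\<Sum>l. qfin a l * qfin x l * (- (b * z)) ^ l * q ^ tri l / (qfin q l * qfin c l) * qinf (a * z * q ^ l) * inverse (qinf z))"
    by (simp add: field_simps)
  have sm: "summable (\<lambda>l. qfin a l * qfin x l * (- (b * z)) ^ l * q ^ tri l / (qfin q l * qfin c l) * qinf (a * z * q ^ l))"
  proof (rule summable_norm_cancel, rule summable_comparison_test'[where N = 0 and
      g = "\<lambda>l. emaj (norm a) * C1 * C2 * emaj (norm (a * z)) * (norm q ^ tri l * norm (b * z) ^ l)"])
    show "summable (\<lambda>l. emaj (norm a) * C1 * C2 * emaj (norm (a * z)) * (norm q ^ tri l * norm (b * z) ^ l))"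
      by (intro summable_mult qpow_tri_summable) auto
    fix l :: nat
    have "norm (a * z * q ^ l) \<le> norm (a * z)"
      using q_lt1 by (simp add: norm_mult norm_power mult_left_le power_le_one)
    then have "norm (qinf (a * z * q ^ l)) \<le> emaj (norm (a * z))"
      using norm_qinf_le[of "a * z * q ^ l"] emaj_mono by (meson order_trans)
    then have "norm (qfin a l) * norm (qfin x l / qfin c l) * norm (inverse (qfin q l)) * norm (qinf (a * z * q ^ l)) * (norm q ^ tri l * norm (b * z) ^ l)
       \<le> emaj (norm a) * C1 * C2 * emaj (norm (a * z)) * (norm q ^ tri l * norm (b * z) ^ l)"
      by (intro mult_right_mono mult_mono norm_qfin_le C1 C2) (auto intro!: mult_nonneg_nonneg less_imp_le[OF C1(1)] less_imp_le[OF C2(1)] less_imp_le[OF emaj_pos])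
    then show "norm (norm (qfin a l * qfin x l * (- (b * z)) ^ l * q ^ tri l / (qfin q l * qfin c l) * qinf (a * z * q ^ l)))
      \<le> emaj (norm a) * C1 * C2 * emaj (norm (a * z)) * (norm q ^ tri l * norm (b * z) ^ l)"
      by (simp add: norm_mult norm_divide norm_power norm_inverse divide_simps mult_ac)
  qed
  show ?thesis unfolding eq suminf_mult2[OF sm, symmetric] using qinf_neq_0[OF z] by (simp add: field_simps)
qed

end

section \<open>Products of two series and the terminating q-Clausen formula\<close>

lemma tri_add: "tri (i + m) = tri i + tri m + i * m"
  by (induction m) auto

lemma square_eq_tri: "m * m = 2 * tri m + m"
  by (induction m) auto

locale qsqrt = qdisc +
  fixes s :: complex
  assumes s2: "s ^ 2 = q"
begin

lemma s_nz: "s \<noteq> 0" using s2 q_nz by auto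

lemma ss: "s * s = q" using s2 by (simp add: power2_eq_square)

lemma ssx: "s * (s * x) = q * x" by (simp add: ss[symmetric] mult.assoc)

text \<open>The last j factors of (c)_N, read backwards, form a factorial with base q / (c q^N).
  This converts indices N - j into j.\<close>

lemma qfin_rev:
  assumes "c \<noteq> 0" "j \<le> N"
  shows "qfin c N * q ^ tri (Suc j) = qfin c (N - j) * (qfin (q / (c * q ^ N)) j * (- c) ^ j * q ^ (N * j))"
proof -
  have "c * q ^ (N - j) = c * q ^ N / q ^ j"
    using assms q_nz by (simp add: power_diff)
  then have "qfin (c * q ^ (N - j)) j * q ^ tri (Suc j) = qfin (q / (c * q ^ N)) j * (- (c * q ^ N)) ^ j"
    using qfin_reverse[of "c * q ^ N" j] assms q_nz by simp
  also have "(- (c * q ^ N)) ^ j = (- c) ^ j * q ^ (N * j)"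
    by (simp add: power_mult_distrib[of "- c", simplified] power_mult)
  finally show ?thesis
    using qfin_add[of c "N - j" j] assms by (simp add: mult_ac)
qed

lemma qfin_nz_powi:
  assumes "\<And>k::int. c \<noteq> q powi k"
  shows "qfin c n \<noteq> 0" "qfin (q / (c * q ^ N)) n \<noteq> 0" "qinf c \<noteq> 0"
proof -
  have *: "c * q ^ j \<noteq> 1" for j
    using assms[of "- int j"] q_nz by (auto simp: power_int_minus field_simps)
  then show "qfin c n \<noteq> 0" "qinf c \<noteq> 0" by (auto simp: qfin_eq_0_iff qinf_eq_0_iff)
  have "q / (c * q ^ N) * q ^ j \<noteq> 1" for j
    using assms[of "int (Suc j) - int N"] assms[of 0] q_nz
    by (auto simp: power_int_diff power_int_add field_simps)
  then show "qfin (q / (c * q ^ N)) n \<noteq> 0" by (auto simp: qfin_eq_0_iff)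
qed

text \<open>The moduli of the powers of q are spaced by the factor |q|, so the zeroth power is the
  only one in the open annulus between |q| and 1 / |q|.\<close>

lemma qpowi_near_1:
  assumes e: "w = q powi k" and w: "norm q < norm w" "norm w < 1 / norm q"
  shows "w = 1"
proof -
  have le: "norm q ^ Suc m \<le> norm q" for m
    using q_lt1 by (simp add: mult_left_le power_le_one)
  consider m where "k = int (Suc m)" | "k = 0" | m where "k = - int (Suc m)"
    by (cases k rule: int_cases3) (metis Suc_pred')+
  then show ?thesis
  proof cases
    case (1 m)
    then have "norm w = norm q ^ Suc m" unfolding e 1 power_int_of_nat by (simp add: norm_power norm_mult)
    with w(1) le[of m] show ?thesis by simp
  next
    case (3 m)
    then have "norm w = 1 / norm q ^ Suc m"
      unfolding e 3 power_int_minus power_int_of_nat by (simp add: norm_inverse norm_divide norm_mult norm_power field_simps)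
    moreover have "1 / norm q \<le> 1 / norm q ^ Suc m"
      using q_nz le[of m] by (intro divide_left_mono) auto
    ultimately show ?thesis using w(2) by simp
  qed (simp add: e)
qed

text \<open>The coefficients of the product of two \<open>\<^sub>2\<phi>\<^sub>1\<close> series as Askey-Wilson polynomials in \<open>B\<close>
  (Ismail and Wilson). This is an instance of Sears' transformation, obtained by two applications
  of the q-Saalschuetz sum with common parameter \<open>\<beta>\<close>.\<close>

lemma product_coefficient_generic:
  assumes nz: "A \<noteq> 0" "B \<noteq> 0" and sA: "\<And>k. qfin (s * A) k \<noteq> 0" and A2: "\<And>k. qfin (A\<^sup>2) k \<noteq> 0"
    and gen: "\<And>k::int. A * B \<noteq> q powi k"
  shows "(\<Sum>j\<le>N. qfin (A * B) j * qfin (s * B) j / (qfin q j * qfin (s * A) j)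
      * (qfin (A / B) (N - j) * qfin (s / B) (N - j) / (qfin q (N - j) * qfin (s * A) (N - j)))
      * (B ^ (N - j) / B ^ j))
    = (\<Sum>l\<le>N. qfin (A\<^sup>2) (N + l) * qfin (A * B) l * qfin (A / B) l
         / (qfin q l * qfin (s * A) l ^ 2 * qfin (A\<^sup>2) l * qfin q (N - l))
         * ((- 1) ^ l * q ^ tri l * q ^ l / q ^ (N * l))) / A ^ N"
    (is "?lhs = ?rhs")
proof -
  \<comment> \<open>Both Saalschuetz sums must be balanced with the same first parameter \<beta>:
    the first one with A / B and A^2 q^N, the second one with A / B and s / B. Reversal turns s A,
    A^2 and A B into \<gamma>, \<gamma>2 and X.\<close>
  define \<beta> where "\<beta> = s * B / (A\<^sup>2 * q ^ N)"
  define \<gamma> where "\<gamma> = s / (A * q ^ N)"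
  define \<gamma>2 where "\<gamma>2 = q / (A\<^sup>2 * q ^ N)"
  define X where "X = q / (A * B * q ^ N)"
  define K where "K = qfin (A * B) N / qfin (s * A) N * ((- (s * A)) ^ N / B ^ N * q ^ tri N)"
  have b_nz: "\<beta> \<noteq> 0" using nz s_nz q_nz by (simp add: \<beta>_def)
  have ABf: "qfin (A * B) k \<noteq> 0" "qfin X k \<noteq> 0" for k
    using qfin_nz_powi[OF gen] by (auto simp: X_def)
  have e1: "s * A = \<beta> * (A / B) * (A\<^sup>2 * q ^ N)" "\<beta> * (A / B) = \<gamma>" "\<beta> * (A\<^sup>2 * q ^ N) = s * B"
    using nz q_nz by (simp_all add: \<beta>_def \<gamma>_def power2_eq_square)
  have e2: "X = \<beta> * (A / B) * (s / B)" "\<beta> * (s / B) = \<gamma>2"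
    using nz q_nz by (simp_all add: \<beta>_def X_def \<gamma>2_def power2_eq_square ss ssx field_simps)
  have g: "\<gamma> = q / (s * A * q ^ N)"
    using nz q_nz s_nz by (simp add: \<gamma>_def ss ssx field_simps)
  define G where "G l = qfin (A / B) l * qfin (A\<^sup>2 * q ^ N) l / (qfin q l * qfin (s * A) l) * \<beta> ^ l" for l
  define H where "H i = qfin (A / B) i * qfin (s / B) i / (qfin q i * qfin X i)" for i
  define P where "P k = qfin \<beta> k / qfin q k" for k
  have S1: "qfin \<gamma> j * qfin (s * B) j / (qfin q j * qfin (s * A) j) = (\<Sum>l\<le>j. P (j - l) * G l)" for j
    using q_saalschuetz[OF e1(1) sA, of j] unfolding e1(2,3) by (simp add: G_def P_def mult_ac)
  have S2: "(\<Sum>i\<le>M. P (M - i) * (H i * \<beta> ^ i)) = qfin \<gamma> M * qfin \<gamma>2 M / (qfin q M * qfin X M)" for M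
    using q_saalschuetz[OF e2(1) ABf(2), of M] unfolding e1(2) e2(2) by (simp add: H_def P_def mult_ac)
  \<comment> \<open>Reversing (s A)_i and (A B)_j, whose indices add up to N, moves the first to
    index j and the second to index i. The factors with index j then have the closed form of the
    first Saalschuetz sum, and those with index i make up \<open>H i\<close>.\<close>
  have term1: "qfin (A * B) j * qfin (s * B) j / (qfin q j * qfin (s * A) j)
      * (qfin (A / B) i * qfin (s / B) i / (qfin q i * qfin (s * A) i)) * (B ^ i / B ^ j)
      = K * (H i * \<beta> ^ i * (\<Sum>l\<le>j. P (j - l) * G l))" if N: "N = i + j" for i j
  proof -
    have r1: "qfin (s * A) i = qfin (s * A) N * q ^ tri (Suc j) / (qfin \<gamma> j * (- (s * A)) ^ j * q ^ (N * j))"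
      if "qfin \<gamma> j \<noteq> 0"
      using qfin_rev[of "s * A" j N] that nz s_nz q_nz N by (simp add: g field_simps)
    have g0: "qfin \<gamma> j \<noteq> 0"
      using qfin_rev[of "s * A" j N] nz s_nz q_nz N sA by (auto simp: g)
    have r2: "qfin (A * B) j = qfin (A * B) N * q ^ tri (Suc i) / (qfin X i * (- (A * B)) ^ i * q ^ (N * i))"
      using qfin_rev[of "A * B" i N] nz q_nz N ABf(2)[of i] by (simp add: X_def field_simps)
    have pw: "q ^ tri (Suc i) / ((- (A * B)) ^ i * q ^ (N * i)) * ((- (s * A)) ^ j * q ^ (N * j) / q ^ tri (Suc j)) * (B ^ i / B ^ j)
       = (- (s * A)) ^ N / B ^ N * q ^ tri N * \<beta> ^ i"
    proof -
      have mm: "q ^ (j * j) = (q ^ tri j)\<^sup>2 * q ^ j" by (simp add: square_eq_tri power_add power_mult mult.commute)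
      define x y where "x = (- (A * B)) ^ i" and "y = (- (s * A)) ^ i"
      have xy: "x \<noteq> 0" "y \<noteq> 0" using nz s_nz by (auto simp: x_def y_def)
      have "\<beta> * (- (s * A)) * q ^ N * (- (A * B)) = B * B * q"
        using nz q_nz by (simp add: \<beta>_def power2_eq_square ss ssx field_simps)
      then have "(\<beta> * (- (s * A)) * q ^ N * (- (A * B))) ^ i = (B * B * q) ^ i" by (rule arg_cong)
      then have "\<beta> ^ i * y * q ^ (N * i) * x = B ^ i * B ^ i * q ^ i"
        by (simp only: power_mult_distrib power_mult x_def y_def)
      then have bi: "\<beta> ^ i = B ^ i * B ^ i * q ^ i / (y * q ^ (N * i) * x)"
        using xy q_nz by (simp add: field_simps)
      have yN: "(- (s * A)) ^ N = y * (- (s * A)) ^ j" by (simp add: N y_def power_add)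
      have qN: "q ^ (N * j) = q ^ (i * j) * ((q ^ tri j)\<^sup>2 * q ^ j)"
        by (simp add: N add_mult_distrib power_add mm)
      show ?thesis
        unfolding bi yN qN x_def[symmetric] using xy nz q_nz
        by (simp add: N tri_add power_add power2_eq_square) (simp add: mult_ac)
    qed
    have "qfin (A * B) j * qfin (s * B) j / (qfin q j * qfin (s * A) j)
      * (qfin (A / B) i * qfin (s / B) i / (qfin q i * qfin (s * A) i)) * (B ^ i / B ^ j)
      = (qfin (A * B) N / qfin (s * A) N) * (qfin \<gamma> j * qfin (s * B) j / (qfin q j * qfin (s * A) j)) * H i
        * (q ^ tri (Suc i) / ((- (A * B)) ^ i * q ^ (N * i)) * ((- (s * A)) ^ j * q ^ (N * j) / q ^ tri (Suc j)) * (B ^ i / B ^ j))"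
      unfolding r1[OF g0] r2 H_def by (simp add: mult_ac)
    then show ?thesis unfolding pw S1 K_def by (simp add: mult_ac)
  qed
  have "?lhs = (\<Sum>j\<le>N. K * (H (N - j) * \<beta> ^ (N - j) * (\<Sum>l\<le>j. P (j - l) * G l)))"
    by (intro sum.cong refl, rule term1) auto
  also have "\<dots> = K * (\<Sum>j\<le>N. \<Sum>l\<le>j. G l * (P (j - l) * (H (N - j) * \<beta> ^ (N - j))))"
    by (simp add: sum_distrib_left mult_ac)
  \<comment> \<open>For fixed l the exchanged triangular sum is a convolution of length N - l, which
    the second Saalschuetz sum evaluates.\<close>
  also have "(\<Sum>j\<le>N. \<Sum>l\<le>j. G l * (P (j - l) * (H (N - j) * \<beta> ^ (N - j))))
     = (\<Sum>l\<le>N. \<Sum>j\<in>{l..N}. G l * (P (j - l) * (H (N - j) * \<beta> ^ (N - j))))"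
    unfolding sum.Sigma[OF finite_atMost ballI, OF finite_atMost] sum.Sigma[OF finite_atMost ballI, OF finite_atLeastAtMost]
    by (rule sum.reindex_bij_witness[of _ prod.swap prod.swap]) auto
  also have "\<dots> = (\<Sum>l\<le>N. G l * (\<Sum>i\<le>N-l. P (N - l - i) * (H i * \<beta> ^ i)))"
  proof (intro sum.cong refl)
    fix l assume "l \<in> {..N}"
    then show "(\<Sum>j\<in>{l..N}. G l * (P (j - l) * (H (N - j) * \<beta> ^ (N - j)))) = G l * (\<Sum>i\<le>N-l. P (N - l - i) * (H i * \<beta> ^ i))"
      unfolding sum_distrib_left
      by (intro sum.reindex_bij_witness[of _ "\<lambda>i. N - i" "\<lambda>j. N - j"]) auto
  qed
  also have "K * \<dots> = ?rhs"
    unfolding sum_distrib_left S2 sum_divide_distrib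
  proof (intro sum.cong refl)
    fix l assume "l \<in> {..N}"
    then obtain M where N: "N = l + M" using le_Suc_ex by auto
    have r1: "qfin \<gamma> M = qfin (s * A) N * q ^ tri (Suc M) / (qfin (s * A) l * (- (s * A)) ^ M * q ^ (N * M))"
      using qfin_rev[of "s * A" M N] nz s_nz q_nz N sA[of l] by (simp add: g field_simps)
    have r2: "qfin \<gamma>2 M = qfin (A\<^sup>2) N * q ^ tri (Suc M) / (qfin (A\<^sup>2) l * (- (A\<^sup>2)) ^ M * q ^ (N * M))"
      using qfin_rev[of "A\<^sup>2" M N] nz q_nz N A2[of l] by (simp add: \<gamma>2_def field_simps)
    have r3: "qfin X M = qfin (A * B) N * q ^ tri (Suc M) / (qfin (A * B) l * (- (A * B)) ^ M * q ^ (N * M))"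
      using qfin_rev[of "A * B" M N] nz q_nz N ABf(1)[of l] by (simp add: X_def field_simps)
    have pw: "(- (s * A)) ^ N / B ^ N * q ^ tri N * \<beta> ^ l *
        (q ^ tri (Suc M) * (- (A * B)) ^ M / ((- (s * A)) ^ M * (- (A\<^sup>2)) ^ M * q ^ (N * M)))
       = (- 1) ^ l * q ^ tri l * q ^ l / q ^ (N * l) / A ^ N"
    proof -
      have mm: "q ^ (M * M) = (q ^ tri M)\<^sup>2 * q ^ M" by (simp add: square_eq_tri power_add power_mult mult.commute)
      have "(- (s * A)) / B * (- (A * B)) / ((- (s * A)) * (- (A\<^sup>2))) = 1 / A"
        using nz s_nz by (simp add: power2_eq_square)
      then have "((- (s * A)) / B * (- (A * B)) / ((- (s * A)) * (- (A\<^sup>2)))) ^ M = (1 / A) ^ M" by (rule arg_cong)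
      then have b1: "(- (s * A)) ^ M / B ^ M * (- (A * B)) ^ M / ((- (s * A)) ^ M * (- (A\<^sup>2)) ^ M) = 1 / A ^ M"
        by (simp only: power_mult_distrib power_divide power_one)
      have "(- (s * A)) / B * \<beta> = (- 1) * q / (A * q ^ N)"
        using nz q_nz by (simp add: \<beta>_def power2_eq_square ss ssx field_simps)
      then have "((- (s * A)) / B * \<beta>) ^ l = ((- 1) * q / (A * q ^ N)) ^ l" by (rule arg_cong)
      then have b2: "(- (s * A)) ^ l / B ^ l * \<beta> ^ l = (- 1) ^ l * q ^ l / (A ^ l * q ^ (N * l))"
        by (simp only: power_mult_distrib power_divide power_mult)
      have b3: "q ^ tri N * q ^ tri (Suc M) / q ^ (N * M) = q ^ tri l"
        using q_nz by (simp add: N tri_add power_add add_mult_distrib mm power2_eq_square)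
      have "(- (s * A)) ^ N / B ^ N * q ^ tri N * \<beta> ^ l *
        (q ^ tri (Suc M) * (- (A * B)) ^ M / ((- (s * A)) ^ M * (- (A\<^sup>2)) ^ M * q ^ (N * M)))
        = ((- (s * A)) ^ M / B ^ M * (- (A * B)) ^ M / ((- (s * A)) ^ M * (- (A\<^sup>2)) ^ M))
          * ((- (s * A)) ^ l / B ^ l * \<beta> ^ l) * (q ^ tri N * q ^ tri (Suc M) / q ^ (N * M))"
        by (simp add: N power_add mult_ac)
      also have "\<dots> = (- 1) ^ l * q ^ tri l * q ^ l / q ^ (N * l) / A ^ N"
        unfolding b1 b2 b3 by (simp add: N power_add mult_ac)
      finally show ?thesis .
    qed
    have a: "qfin (A\<^sup>2) (N + l) = qfin (A\<^sup>2) N * qfin (A\<^sup>2 * q ^ N) l" by (rule qfin_add)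
    have "K * (G l * (qfin \<gamma> (N - l) * qfin \<gamma>2 (N - l) / (qfin q (N - l) * qfin X (N - l))))
       = qfin (A\<^sup>2) (N + l) * qfin (A * B) l * qfin (A / B) l
         / (qfin q l * qfin (s * A) l ^ 2 * qfin (A\<^sup>2) l * qfin q (N - l))
         * ((- (s * A)) ^ N / B ^ N * q ^ tri N * \<beta> ^ l *
        (q ^ tri (Suc M) * (- (A * B)) ^ M / ((- (s * A)) ^ M * (- (A\<^sup>2)) ^ M * q ^ (N * M))))"
      using sA[of N] ABf(1)[of N] q_nz nz s_nz
      unfolding a K_def G_def using N r1 r2 r3 by (simp add: power2_eq_square mult_ac)
    then show "K * (G l * (qfin \<gamma> (N - l) * qfin \<gamma>2 (N - l) / (qfin q (N - l) * qfin X (N - l)))) =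
         qfin (A\<^sup>2) (N + l) * qfin (A * B) l * qfin (A / B) l
         / (qfin q l * qfin (s * A) l ^ 2 * qfin (A\<^sup>2) l * qfin q (N - l))
         * ((- 1) ^ l * q ^ tri l * q ^ l / q ^ (N * l)) / A ^ N"
      unfolding pw by simp
  qed
  finally show ?thesis .
qed

text \<open>These values of B are excluded from the generic version, where reversed factors would
  vanish. Both sides are continuous in B, and all B' close to but different from B are generic,
  since powers of q are isolated.\<close>

lemma product_coefficient:
  assumes nz: "A \<noteq> 0" "B \<noteq> 0" and sA: "\<And>k. qfin (s * A) k \<noteq> 0" and A2: "\<And>k. qfin (A\<^sup>2) k \<noteq> 0"
    and AB: "A * B * q ^ n = 1"
  shows "(\<Sum>j\<le>N. qfin (A * B) j * qfin (s * B) j / (qfin q j * qfin (s * A) j)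
      * (qfin (A / B) (N - j) * qfin (s / B) (N - j) / (qfin q (N - j) * qfin (s * A) (N - j)))
      * (B ^ (N - j) / B ^ j))
    = (\<Sum>l\<le>N. qfin (A\<^sup>2) (N + l) * qfin (A * B) l * qfin (A / B) l
         / (qfin q l * qfin (s * A) l ^ 2 * qfin (A\<^sup>2) l * qfin q (N - l))
         * ((- 1) ^ l * q ^ tri l * q ^ l / q ^ (N * l))) / A ^ N"
    (is "?L B = ?R B")
proof -
  have cont: "continuous_on (- {0}) (\<lambda>B. qfin (f B) k)" if "continuous_on (- {0}) f" for f k
    unfolding qfin_def using that by (intro continuous_intros)
  have co: "continuous_on (- {0}) ?L" "continuous_on (- {0}) ?R"
    using nz sA A2 qfin_q_nz q_nz by (auto intro!: continuous_intros cont)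
  have "B \<in> interior (- {0})" using nz by (simp add: interior_open open_Compl)
  then have c: "isCont ?L B" "isCont ?R B"
    by (rule continuous_on_interior[OF co(1)], rule continuous_on_interior[OF co(2)])
  have "((\<lambda>B'. norm (A * B' * q ^ n)) \<longlongrightarrow> norm (A * B * q ^ n)) (at B)"
    by (intro tendsto_intros)
  then have "((\<lambda>B'. norm (A * B' * q ^ n)) \<longlongrightarrow> 1) (at B)" by (simp only: AB norm_one)
  then have "eventually (\<lambda>B'. norm (A * B' * q ^ n) > norm q) (at B)" "eventually (\<lambda>B'. norm (A * B' * q ^ n) < 1 / norm q) (at B)"
    using q_lt1 q_nz by (auto intro!: order_tendstoD)
  moreover have "eventually (\<lambda>B'. B' \<noteq> B) (at B)" by (auto simp: eventually_at_filter)
  ultimately have ev: "eventually (\<lambda>B'. ?L B' = ?R B') (at B)"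
  proof eventually_elim
    case (elim B')
    have "B' \<noteq> 0" using elim(1) q_nz by auto
    moreover have "A * B' \<noteq> q powi k" for k
    proof
      assume "A * B' = q powi k"
      then have e: "A * B' * q ^ n = q powi (k + int n)" using q_nz by (simp add: power_int_add)
      then have "A * B' * q ^ n = 1" using qpowi_near_1 elim(1,2) by blast
      then have "A * q ^ n * B' = A * q ^ n * B" using AB by (simp add: mult_ac)
      then show False using elim(3) nz q_nz by simp
    qed
    ultimately show ?case
      by (intro product_coefficient_generic nz sA A2)
  qed
  have "(?R \<longlongrightarrow> ?R B) (at B)" using c(2) by (simp only: isCont_def)
  then have r: "(?L \<longlongrightarrow> ?R B) (at B)"
    by (rule Lim_transform_eventually) (use ev in eventually_elim, simp)
  have l: "(?L \<longlongrightarrow> ?L B) (at B)" using c(1) by (simp only: isCont_def)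
  show ?thesis by (rule LIM_unique[OF l r])
qed

text \<open>The product of \<open>(s A, Z / B)\<^sub>\<infinity>\<close> and \<open>\<^sub>2\<phi>\<^sub>1(A B, s B; s A; q, Z / B)\<close>, in the form given by Jackson's
  transformation, which is defined for all \<open>Z\<close> and visibly invariant under \<open>B \<mapsto> 1 / B\<close>.\<close>

definition ghat :: "complex \<Rightarrow> complex \<Rightarrow> complex \<Rightarrow> complex" where
  "ghat A Z B = (\<Sum>k. qfin (A * B) k * qfin (A / B) k * (- (s * Z)) ^ k * q ^ tri k / qfin q k
     * qinf (s * A * q ^ k) * qinf (A * Z * q ^ k))"

lemma norm_mult_qpow_le: "norm (x * q ^ k) \<le> norm x"
  using q_lt1 by (simp add: norm_mult norm_power mult_left_le power_le_one)

text \<open>A single C serves for all A, Z, B and k, so the holomorphy of \<open>ghat\<close> in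
  each of its arguments follows from the same estimate.\<close>

lemma ghat_term_bound:
  "\<exists>C. \<forall>A Z B k. norm (qfin (A * B) k * qfin (A / B) k * (- (s * Z)) ^ k * q ^ tri k / qfin q k
     * qinf (s * A * q ^ k) * qinf (A * Z * q ^ k))
    \<le> C * (emaj (norm (A * B)) * emaj (norm (A / B)) * emaj (norm (s * A)) * emaj (norm (A * Z)) * (norm q ^ tri k * norm (s * Z) ^ k))"
proof -
  obtain C where C: "C > 0" "\<And>k. norm (inverse (qfin q k)) \<le> C"
    using qinf_inverse_bounded[OF qinf_q_nz] by blast
  have "norm (qfin (A * B) k * qfin (A / B) k * (- (s * Z)) ^ k * q ^ tri k / qfin q k
     * qinf (s * A * q ^ k) * qinf (A * Z * q ^ k))
    \<le> C * (emaj (norm (A * B)) * emaj (norm (A / B)) * emaj (norm (s * A)) * emaj (norm (A * Z)) * (norm q ^ tri k * norm (s * Z) ^ k))" for A Z B k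
  proof -
    have i: "norm (qinf (x * q ^ k)) \<le> emaj (norm x)" for x
      using norm_qinf_le[of "x * q ^ k"] emaj_mono[OF norm_mult_qpow_le[of x k]] by linarith
    have "norm (qfin (A * B) k * qfin (A / B) k * (- (s * Z)) ^ k * q ^ tri k / qfin q k
     * qinf (s * A * q ^ k) * qinf (A * Z * q ^ k))
     = norm (inverse (qfin q k)) * (norm (qfin (A * B) k) * norm (qfin (A / B) k) * norm (qinf (s * A * q ^ k))
        * norm (qinf (A * Z * q ^ k)) * (norm q ^ tri k * norm (s * Z) ^ k))"
      by (simp add: norm_mult norm_divide norm_power norm_inverse divide_simps)
    also have "\<dots> \<le> C * (emaj (norm (A * B)) * emaj (norm (A / B)) * emaj (norm (s * A)) * emaj (norm (A * Z)) * (norm q ^ tri k * norm (s * Z) ^ k))"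
      by (intro mult_mono C norm_qfin_le i order_refl mult_nonneg_nonneg) (auto intro: less_imp_le C(1))
    finally show ?thesis .
  qed
  then show ?thesis by blast
qed

lemma ghat_holomorphic_B: "ghat A Z holomorphic_on - {0}"
  unfolding ghat_def
proof (rule holomorphic_suminf)
  obtain C where C: "\<And>A Z B k. norm (qfin (A * B) k * qfin (A / B) k * (- (s * Z)) ^ k * q ^ tri k / qfin q k
     * qinf (s * A * q ^ k) * qinf (A * Z * q ^ k))
    \<le> C * (emaj (norm (A * B)) * emaj (norm (A / B)) * emaj (norm (s * A)) * emaj (norm (A * Z)) * (norm q ^ tri k * norm (s * Z) ^ k))"
    using ghat_term_bound by blast
  fix K :: "complex set" assume K: "compact K" "K \<subseteq> - {0}"
  have "compact ((\<lambda>B. A * B) ` K)" "compact ((\<lambda>B. A / B) ` K)"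
    using K by (auto intro!: compact_continuous_image continuous_intros)
  then obtain R1 R2 where R: "\<And>B. B \<in> K \<Longrightarrow> norm (A * B) \<le> R1" "\<And>B. B \<in> K \<Longrightarrow> norm (A / B) \<le> R2"
    by (metis bounded_iff compact_imp_bounded imageI)
  have C0: "C \<ge> 0"
    using order_trans[OF norm_ge_zero C[of 0 0 0 0]] by (simp add: zero_le_mult_iff less_imp_le)
       (metis emaj_pos less_le_not_le mult_pos_pos)
  let ?M = "\<lambda>k. C * (emaj R1 * emaj R2 * emaj (norm (s * A)) * emaj (norm (A * Z)) * (norm q ^ tri k * norm (s * Z) ^ k))"
  show "\<exists>M. summable M \<and> (\<forall>k. \<forall>B\<in>K. norm (qfin (A * B) k * qfin (A / B) k * (- (s * Z)) ^ k * q ^ tri k / qfin q k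
     * qinf (s * A * q ^ k) * qinf (A * Z * q ^ k)) \<le> M k)"
  proof (intro exI[of _ ?M] conjI allI ballI)
    show "summable ?M" by (intro summable_mult qpow_tri_summable) auto
    fix k B assume B: "B \<in> K"
    show "norm (qfin (A * B) k * qfin (A / B) k * (- (s * Z)) ^ k * q ^ tri k / qfin q k
     * qinf (s * A * q ^ k) * qinf (A * Z * q ^ k)) \<le> ?M k"
      by (rule order_trans[OF C], intro mult_left_mono mult_right_mono mult_mono emaj_mono R B C0)
         (auto intro: less_imp_le)
  qed
qed (auto intro!: holomorphic_intros)

lemma ghat_holomorphic_Z: "(\<lambda>Z. ghat A Z B) holomorphic_on UNIV"
  unfolding ghat_def
proof (rule holomorphic_suminf)
  obtain C where C: "\<And>A Z B k. norm (qfin (A * B) k * qfin (A / B) k * (- (s * Z)) ^ k * q ^ tri k / qfin q k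
     * qinf (s * A * q ^ k) * qinf (A * Z * q ^ k))
    \<le> C * (emaj (norm (A * B)) * emaj (norm (A / B)) * emaj (norm (s * A)) * emaj (norm (A * Z)) * (norm q ^ tri k * norm (s * Z) ^ k))"
    using ghat_term_bound by blast
  fix K :: "complex set" assume K: "compact K" "K \<subseteq> UNIV"
  have "compact ((\<lambda>Z. A * Z) ` K)" "compact ((\<lambda>Z. s * Z) ` K)"
    using K by (auto intro!: compact_continuous_image continuous_intros)
  then obtain R1 R2 where R: "\<And>Z. Z \<in> K \<Longrightarrow> norm (A * Z) \<le> R1" "\<And>Z. Z \<in> K \<Longrightarrow> norm (s * Z) \<le> R2"
    by (metis bounded_iff compact_imp_bounded imageI)
  have C0: "C \<ge> 0"
    using order_trans[OF norm_ge_zero C[of 0 0 0 0]] by (simp add: zero_le_mult_iff less_imp_le)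
       (metis emaj_pos less_le_not_le mult_pos_pos)
  let ?M = "\<lambda>k. C * (emaj (norm (A * B)) * emaj (norm (A / B)) * emaj (norm (s * A)) * emaj R1 * (norm q ^ tri k * \<bar>R2\<bar> ^ k))"
  show "\<exists>M. summable M \<and> (\<forall>k. \<forall>Z\<in>K. norm (qfin (A * B) k * qfin (A / B) k * (- (s * Z)) ^ k * q ^ tri k / qfin q k
     * qinf (s * A * q ^ k) * qinf (A * Z * q ^ k)) \<le> M k)"
  proof (intro exI[of _ ?M] conjI allI ballI)
    show "summable ?M" by (intro summable_mult qpow_tri_summable) auto
    fix k Z assume Z: "Z \<in> K"
    have R2: "norm (s * Z) \<le> \<bar>R2\<bar>" using R(2)[OF Z] by linarith
    show "norm (qfin (A * B) k * qfin (A / B) k * (- (s * Z)) ^ k * q ^ tri k / qfin q k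
     * qinf (s * A * q ^ k) * qinf (A * Z * q ^ k)) \<le> ?M k"
      by (rule order_trans[OF C], intro mult_left_mono mult_right_mono mult_mono emaj_mono power_mono R R2 Z C0)
         (auto intro: less_imp_le)
  qed
qed (auto intro!: holomorphic_intros)

lemma ghat_inv: "ghat A Z (1 / B) = ghat A Z B"
  unfolding ghat_def by (simp add: mult_ac)

lemma ghat_2phi1:
  assumes nz: "A \<noteq> 0" "B \<noteq> 0" "qinf (s * A) \<noteq> 0" and z: "norm (Z / B) < 1"
  shows "ghat A Z B = qinf (s * A) * (qinf (Z / B) *
     (\<Sum>j. qfin (A * B) j * qfin (s * B) j / (qfin q j * qfin (s * A) j) * (Z / B) ^ j))"
proof -
  have c: "s * A = A / B * (s * B)" using nz by simp
  have e: "s * B * (Z / B) = s * Z" "A * B * (Z / B) = A * Z" using nz by simp_all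
  have t: "qfin (A * B) k * qfin (A / B) k * (- (s * Z)) ^ k * q ^ tri k / qfin q k
     * qinf (s * A * q ^ k) * qinf (A * Z * q ^ k)
    = qinf (s * A) * (qfin (A * B) k * qfin (A / B) k * (- (s * Z)) ^ k * q ^ tri k / (qfin q k * qfin (s * A) k) * qinf (A * Z * q ^ k))" for k
    using qinf_split[of "s * A" k] qfin_nz_if_qinf_nz[OF nz(3), of k] by (simp add: field_simps)
  have "summable (\<lambda>k. qfin (A * B) k * qfin (A / B) k * (- (s * Z)) ^ k * q ^ tri k / qfin q k
     * qinf (s * A * q ^ k) * qinf (A * Z * q ^ k))"
  proof -
    obtain C where C: "\<And>A Z B k. norm (qfin (A * B) k * qfin (A / B) k * (- (s * Z)) ^ k * q ^ tri k / qfin q k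
     * qinf (s * A * q ^ k) * qinf (A * Z * q ^ k))
    \<le> C * (emaj (norm (A * B)) * emaj (norm (A / B)) * emaj (norm (s * A)) * emaj (norm (A * Z)) * (norm q ^ tri k * norm (s * Z) ^ k))"
      using ghat_term_bound by blast
    show ?thesis
      by (rule summable_comparison_test'[OF _ C]) (intro summable_mult qpow_tri_summable, auto)
  qed
  then have "summable (\<lambda>k. qfin (A * B) k * qfin (A / B) k * (- (s * Z)) ^ k * q ^ tri k / (qfin q k * qfin (s * A) k) * qinf (A * Z * q ^ k))"
    unfolding t using nz(3) by (rule summable_mult_D)
  then show ?thesis
    unfolding ghat_def t jackson[OF c nz(3) z] e by (rule suminf_mult)
qed

lemma sA_small: "norm A < 1 \<Longrightarrow> qinf (s * A) \<noteq> 0"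
proof -
  assume A: "norm A < 1"
  have "norm s ^ 2 < 1" using q_lt1 s2 by (metis norm_power)
  then have "norm s < 1" by (simp add: power_less_one_iff)
  then have "norm s * norm A \<le> 1 * norm A" by (intro mult_right_mono) auto
  then have "norm (s * A) < 1" using A by (simp add: norm_mult)
  then show ?thesis by (rule qinf_neq_0)
qed

text \<open>For |Z| < |B| < 1 / |A| both sides are 2phi1 series, the right one after B -> 1 / B, and
  \<open>heine_symmetric\<close> identifies them. As both are holomorphic in B off 0, the identity
  spreads from this annulus.\<close>

lemma ghat_swap:
  assumes nz: "A \<noteq> 0" "Z \<noteq> 0" "B \<noteq> 0" and A: "norm A < 1" and Z: "norm Z < 1"
  shows "ghat A Z B = ghat Z A B"
proof -
  define S where "S = {B :: complex. norm Z < norm B \<and> norm B < 1 / norm A}"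
  have eq: "ghat A Z B = ghat Z A B" if "B \<in> S" for B
  proof -
    have B: "B \<noteq> 0" "norm (Z / B) < 1" "norm (A * B) < 1"
      using that nz by (auto simp: S_def norm_divide norm_mult divide_less_eq less_divide_eq mult.commute)
    have B1: "1 / B \<noteq> 0" "norm (A / (1 / B)) < 1" using B by auto
    have s1: "qfin (A * B) n = qinf (A * B) / qinf (A * B * q ^ n)" for n
      using qinf_split[of "A * B" n] qinf_neq_0[OF norm_mult_qpow_lt1[OF B(3)]] by (simp add: field_simps)
    have s2: "qfin (Z / B) n = qinf (Z / B) / qinf (Z / B * q ^ n)" for n
      using qinf_split[of "Z / B" n] qinf_neq_0[OF norm_mult_qpow_lt1[OF B(2)]] by (simp add: field_simps)
    have s3: "1 / qfin (s * A) n = qinf (s * A * q ^ n) / qinf (s * A)" for n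
      using qinf_split[of "s * A" n] sA_small[OF A] by (simp add: field_simps)
    have s4: "1 / qfin (s * Z) n = qinf (s * Z * q ^ n) / qinf (s * Z)" for n
      using qinf_split[of "s * Z" n] sA_small[OF Z] by (simp add: field_simps)
    have h: "(\<Sum>n. qfin (s * B) n / qfin q n * (Z / B) ^ n * (qinf (s * A * q ^ n) / qinf (A * B * q ^ n)))
       = (\<Sum>n. qfin (s / B) n / qfin q n * (A * B) ^ n * (qinf (s * Z * q ^ n) / qinf (Z / B * q ^ n)))"
      using heine_symmetric[OF B(2) B(3), of "s * B" "s / B"] B(1) by (simp add: mult_ac)
    have t1: "qfin (A * B) n * qfin (s * B) n / (qfin q n * qfin (s * A) n) * (Z / B) ^ n
       = qinf (A * B) / qinf (s * A) * (qfin (s * B) n / qfin q n * (Z / B) ^ n * (qinf (s * A * q ^ n) / qinf (A * B * q ^ n)))" for n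
    proof -
      have "qfin (A * B) n * qfin (s * B) n / (qfin q n * qfin (s * A) n) * (Z / B) ^ n
        = qfin (A * B) n * qfin (s * B) n / qfin q n * (1 / qfin (s * A) n) * (Z / B) ^ n" by simp
      then show ?thesis unfolding s3 s1 by (simp add: mult_ac)
    qed
    have t2: "qfin (Z / B) n * qfin (s / B) n / (qfin q n * qfin (s * Z) n) * (A * B) ^ n
       = qinf (Z / B) / qinf (s * Z) * (qfin (s / B) n / qfin q n * (A * B) ^ n * (qinf (s * Z * q ^ n) / qinf (Z / B * q ^ n)))" for n
    proof -
      have "qfin (Z / B) n * qfin (s / B) n / (qfin q n * qfin (s * Z) n) * (A * B) ^ n
        = qfin (Z / B) n * qfin (s / B) n / qfin q n * (1 / qfin (s * Z) n) * (A * B) ^ n" by simp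
      then show ?thesis unfolding s4 s2 by (simp add: mult_ac)
    qed
    obtain C where C: "C > 0" "\<And>k. norm (qinf (s * A * q ^ k) / qinf (A * B * q ^ k)) \<le> C"
    proof -
      have "(\<lambda>k. qinf (s * A * q ^ k) / qinf (A * B * q ^ k)) \<longlonglongrightarrow> qinf (s * A * 0) / qinf (A * B * 0)"
        using q_lt1 by (intro tendsto_intros LIMSEQ_power_zero) auto
      then have "Bseq (\<lambda>k. qinf (s * A * q ^ k) / qinf (A * B * q ^ k))"
        using convergentI convergent_imp_Bseq by blast
      then show ?thesis using that by (auto simp: Bseq_def)
    qed
    obtain C' where C': "C' > 0" "\<And>k. norm (qinf (s * Z * q ^ k) / qinf (Z / B * q ^ k)) \<le> C'"
    proof -
      have "(\<lambda>k. qinf (s * Z * q ^ k) / qinf (Z / B * q ^ k)) \<longlonglongrightarrow> qinf (s * Z * 0) / qinf (Z / B * 0)"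
        using q_lt1 by (intro tendsto_intros LIMSEQ_power_zero) auto
      then have "Bseq (\<lambda>k. qinf (s * Z * q ^ k) / qinf (Z / B * q ^ k))"
        using convergentI convergent_imp_Bseq by blast
      then show ?thesis using that by (auto simp: Bseq_def)
    qed
    have sm: "summable (\<lambda>n. qfin x n / qfin q n * y ^ n * r n)"
      if "norm y < 1" "\<And>n. norm (r n) \<le> C" for x y r and C :: real
    proof (rule summable_norm_cancel, rule summable_comparison_test'[where N = 0])
      show "summable (\<lambda>n. norm (qfin x n / qfin q n * y ^ n) * C)"
        by (intro summable_mult2 q_binomial_summable that)
      show "norm (norm (qfin x n / qfin q n * y ^ n * r n)) \<le> norm (qfin x n / qfin q n * y ^ n) * C" for n
        using mult_left_mono[OF that(2)[of n], of "norm (qfin x n / qfin q n * y ^ n)"] by (simp add: norm_mult norm_divide)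
    qed
    have "ghat A Z B = qinf (Z / B) * qinf (A * B) * 
      (\<Sum>n. qfin (s * B) n / qfin q n * (Z / B) ^ n * (qinf (s * A * q ^ n) / qinf (A * B * q ^ n)))"
      unfolding ghat_2phi1[OF nz(1) B(1) sA_small[OF A] B(2)] t1 suminf_mult[OF sm[OF B(2) C(2)]]
      using sA_small[OF A] by simp
    also have "\<dots> = ghat Z A (1 / B)"
    proof -
      have e: "A / (1 / B) = A * B" "Z * (1 / B) = Z / B" "s * (1 / B) = s / B" by simp_all
      show ?thesis
        unfolding h ghat_2phi1[OF nz(2) B1(1) sA_small[OF Z] B1(2)] e t2 suminf_mult[OF sm[OF B(3) C'(2)]]
        using sA_small[OF Z] by simp
    qed
    finally show ?thesis by (simp only: ghat_inv)
  qed
  have ne: "S \<noteq> {}"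
  proof -
    \<comment> \<open>The bounds on |A| and |Z| place the point 1 in the annulus.\<close>
    have "1 \<in> S" using A Z nz by (auto simp: S_def field_simps)
    then show ?thesis by auto
  qed
  have op: "open S" unfolding S_def by (intro open_Collect_conj open_Collect_less continuous_intros)
  show ?thesis
  proof (rule analytic_continuation_open[OF op _ ne _ _ ghat_holomorphic_B ghat_holomorphic_B])
    show "connected (- {0::complex})" by (intro connected_punctured_universe) simp
    show "S \<subseteq> - {0}" by (auto simp: S_def)
  qed (use eq nz in auto)
qed

text \<open>The part of the summand in the q-Clausen formula that is independent of B; only (A B)_k
  (A / B)_k is missing.\<close>

definition clausen_term :: "complex \<Rightarrow> complex \<Rightarrow> nat \<Rightarrow> complex" where
  "clausen_term A Z k = qinf (s * A * q ^ k) ^ 2 * qinf (A * Z * q ^ k) * qfin (A\<^sup>2) (2 * k) / (qfin q k * qfin (A\<^sup>2) k)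
     * (q ^ k / (qinf (Z / A) * qfin (q * A / Z) k))"

text \<open>Inserting the coefficients into the Cauchy product and summing over \<open>N\<close> first, which is
  legitimate since \<open>A B = 1 / q\<^sup>n\<close> leaves finitely many \<open>l\<close>.\<close>

lemma terminating_clausen_small:
  assumes nz: "A \<noteq> 0" "Z \<noteq> 0" and sA: "qinf (s * A) \<noteq> 0" and A2: "qinf (A\<^sup>2) \<noteq> 0"
    and AB: "A * B * q ^ n = 1" and Z: "norm Z < norm B" "norm Z * norm B < 1"
  shows "ghat A Z B ^ 2 = (\<Sum>l\<le>n. qfin (A * B) l * qfin (A / B) l * qfin (A\<^sup>2) (2 * l) * qinf (s * A * q ^ l) ^ 2
      / (qfin q l * qfin (A\<^sup>2) l) * ((- Z / A) ^ l / q ^ tri l) * qinf (A * Z * q ^ l) * qinf (Z / B) * qfin (Z * B) (n - l))"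
proof -
  have B: "B \<noteq> 0" using AB by auto
  have z1: "norm (Z / B) < 1" using Z(1) B by (simp add: norm_divide)
  have z2: "norm (Z / (1 / B)) < 1" using Z(2) by (simp add: norm_mult)
  have ZB: "norm (Z * B) < 1" using Z(2) by (simp add: norm_mult)
  have sAk: "qfin (s * A) k \<noteq> 0" and A2k: "qfin (A\<^sup>2) k \<noteq> 0" for k
    using sA A2 qfin_nz_if_qinf_nz by auto
  define a where "a j = qfin (A * B) j * qfin (s * B) j / (qfin q j * qfin (s * A) j) * (Z / B) ^ j" for j
  define b where "b j = qfin (A / B) j * qfin (s / B) j / (qfin q j * qfin (s * A) j) * (Z * B) ^ j" for j
  define c where "c N l = qfin (A\<^sup>2) (N + l) * qfin (A * B) l * qfin (A / B) l
         / (qfin q l * qfin (s * A) l ^ 2 * qfin (A\<^sup>2) l * qfin q (N - l))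
         * ((- 1) ^ l * q ^ tri l * q ^ l / q ^ (N * l))" for N l
  have sums: "summable (\<lambda>j. norm (qfin x j * qfin y j / (qfin q j * qfin (s * A) j) * w ^ j))" if "norm w < 1" for x y w
  proof -
    obtain C1 where C1: "C1 > 0" "\<And>k. norm (qfin y k / qfin (s * A) k) \<le> C1"
      using qfin_quot_bounded[OF sA] by blast
    show ?thesis
    proof (rule summable_comparison_test'[where N = 0])
      show "summable (\<lambda>j. norm (qfin x j / qfin q j * w ^ j) * C1)"
        by (intro summable_mult2 q_binomial_summable that)
      fix j :: nat
      have "norm (qfin x j * qfin y j / (qfin q j * qfin (s * A) j) * w ^ j)
         = norm (qfin x j / qfin q j * w ^ j) * norm (qfin y j / qfin (s * A) j)"
        by (simp add: norm_mult norm_divide)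
      also have "\<dots> \<le> norm (qfin x j / qfin q j * w ^ j) * C1" by (intro mult_left_mono C1) auto
      finally show "norm (norm (qfin x j * qfin y j / (qfin q j * qfin (s * A) j) * w ^ j)) \<le> norm (qfin x j / qfin q j * w ^ j) * C1"
        by simp
    qed
  qed
  have g1: "ghat A Z B = qinf (s * A) * (qinf (Z / B) * suminf a)"
    unfolding a_def by (rule ghat_2phi1[OF nz(1) B sA z1])
  have g2: "ghat A Z B = qinf (s * A) * (qinf (Z * B) * suminf b)"
    using ghat_2phi1[OF nz(1) _ sA z2] B unfolding b_def by (simp add: ghat_inv)
  have "(\<lambda>N. \<Sum>i\<le>N. a i * b (N - i)) sums (suminf a * suminf b)"
    unfolding a_def b_def by (intro Cauchy_product_sums sums z1 ZB)
  \<comment> \<open>(A B)_l vanishes for l > n, so the range of l can be fixed independently of N.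
    The conditional retains l <= N, and the series over N becomes a finite sum of series.\<close>
  also have "(\<lambda>N. \<Sum>i\<le>N. a i * b (N - i)) = (\<lambda>N. \<Sum>l\<le>n. if l \<le> N then (Z / A) ^ N * c N l else 0)"
  proof
    fix N
    have "(\<Sum>i\<le>N. a i * b (N - i)) = Z ^ N * (\<Sum>j\<le>N. qfin (A * B) j * qfin (s * B) j / (qfin q j * qfin (s * A) j)
      * (qfin (A / B) (N - j) * qfin (s / B) (N - j) / (qfin q (N - j) * qfin (s * A) (N - j)))
      * (B ^ (N - j) / B ^ j))"
      unfolding sum_distrib_left a_def b_def
    proof (intro sum.cong refl)
      fix i assume "i \<in> {..N}"
      then have "Z ^ N = Z ^ i * Z ^ (N - i)" by (simp flip: power_add)
      then show "qfin (A * B) i * qfin (s * B) i / (qfin q i * qfin (s * A) i) * (Z / B) ^ i *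
         (qfin (A / B) (N - i) * qfin (s / B) (N - i) / (qfin q (N - i) * qfin (s * A) (N - i)) * (Z * B) ^ (N - i))
         = Z ^ N * (qfin (A * B) i * qfin (s * B) i / (qfin q i * qfin (s * A) i)
      * (qfin (A / B) (N - i) * qfin (s / B) (N - i) / (qfin q (N - i) * qfin (s * A) (N - i)))
      * (B ^ (N - i) / B ^ i))"
        by (simp add: power_mult_distrib power_divide mult_ac)
    qed
    also have "\<dots> = (\<Sum>l\<le>N. (Z / A) ^ N * c N l)"
      unfolding product_coefficient[OF nz(1) B sAk A2k AB] c_def
      by (simp add: sum_distrib_left power_divide sum_divide_distrib mult_ac)
    also have "\<dots> = (\<Sum>l\<in>{..N} \<inter> {..n}. (Z / A) ^ N * c N l)"
    proof (rule sum.mono_neutral_right)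
      show "\<forall>i\<in>{..N} - {..N} \<inter> {..n}. (Z / A) ^ N * c N i = 0"
      proof
        fix i assume "i \<in> {..N} - {..N} \<inter> {..n}"
        then have "n < i" by auto
        then have "qfin (A * B) i = 0" using AB by (auto simp: qfin_eq_0_iff)
        then show "(Z / A) ^ N * c N i = 0" by (simp add: c_def)
      qed
    qed auto
    also have "\<dots> = (\<Sum>l\<in>{..N} \<inter> {..n}. if l \<le> N then (Z / A) ^ N * c N l else 0)"
      by (intro sum.cong) auto
    also have "\<dots> = (\<Sum>l\<le>n. if l \<le> N then (Z / A) ^ N * c N l else 0)"
      by (rule sum.mono_neutral_left) auto
    finally show "(\<Sum>i\<le>N. a i * b (N - i)) = (\<Sum>l\<le>n. if l \<le> N then (Z / A) ^ N * c N l else 0)" .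
  qed
  finally have s1: "(\<lambda>N. \<Sum>l\<le>n. if l \<le> N then (Z / A) ^ N * c N l else 0) sums (suminf a * suminf b)" .
  define K where "K l = qfin (A\<^sup>2) (2 * l) * qfin (A * B) l * qfin (A / B) l / (qfin q l * qfin (s * A) l ^ 2 * qfin (A\<^sup>2) l)
      * ((- Z / A) ^ l / q ^ tri l)" for l
  \<comment> \<open>By A B = q^(-n) the argument of the inner q-binomial series is Z B q^(n-l),
    which lies in the unit disc.\<close>
  have zl: "norm (Z / (A * q ^ l)) < 1" and zl': "Z / (A * q ^ l) = Z * B * q ^ (n - l)" if "l \<le> n" for l
  proof -
    have q: "q ^ n = q ^ l * q ^ (n - l)" using that by (simp flip: power_add)
    then have "A * q ^ l * (B * q ^ (n - l)) = 1" using AB by (simp add: mult_ac)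
    then show *: "Z / (A * q ^ l) = Z * B * q ^ (n - l)" using nz q_nz by (simp add: field_simps)
    show "norm (Z / (A * q ^ l)) < 1" unfolding * by (rule norm_mult_qpow_lt1[OF ZB])
  qed
  have s2: "(\<lambda>N. if l \<le> N then (Z / A) ^ N * c N l else 0) sums (K l * (qinf (A * Z * q ^ l) / qinf (Z / (A * q ^ l))))"
    if l: "l \<le> n" for l
  proof -
    have t: "(Z / A) ^ (m + l) * c (m + l) l = K l * (qfin (A\<^sup>2 * q ^ (2 * l)) m / qfin q m * (Z / (A * q ^ l)) ^ m)" for m
    proof -
      have ll: "(q ^ l) ^ l = (q ^ tri l)\<^sup>2 * q ^ l"
        unfolding power_mult[symmetric] by (simp add: square_eq_tri power_add power_mult mult.commute)
      have e: "m + l + l = 2 * l + m" by simp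
      have sg: "(- Z / A) ^ l = (- 1) ^ l * (Z / A) ^ l"
        by (simp flip: power_mult_distrib)
      show ?thesis
        unfolding c_def K_def e qfin_add[of _ "2 * l"] sg using nz q_nz
        by (simp add: power_add add_mult_distrib ll power_divide power_mult_distrib power_mult power2_eq_square field_simps)
    qed
    have "A\<^sup>2 * q ^ (2 * l) * (Z / (A * q ^ l)) = A * Z * q ^ l"
      using nz q_nz by (simp add: power2_eq_square power_mult mult.commute[of 2] power_mult_distrib field_simps)
    then have "(\<lambda>m. (Z / A) ^ (m + l) * c (m + l) l) sums (K l * (qinf (A * Z * q ^ l) / qinf (Z / (A * q ^ l))))"
      unfolding t using q_binomial[OF zl[OF l], of "A\<^sup>2 * q ^ (2 * l)"] by (intro sums_mult) simp
    then have "(\<lambda>m. if l \<le> m + l then (Z / A) ^ (m + l) * c (m + l) l else 0) sums (K l * (qinf (A * Z * q ^ l) / qinf (Z / (A * q ^ l))))"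
      by simp
    then show ?thesis
      using sums_iff_shift[of "\<lambda>N. if l \<le> N then (Z / A) ^ N * c N l else 0" l] by simp
  qed
  have "(\<lambda>N. \<Sum>l\<le>n. if l \<le> N then (Z / A) ^ N * c N l else 0) sums (\<Sum>l\<le>n. K l * (qinf (A * Z * q ^ l) / qinf (Z / (A * q ^ l))))"
    by (intro sums_sum s2) simp
  then have ab: "suminf a * suminf b = (\<Sum>l\<le>n. K l * (qinf (A * Z * q ^ l) / qinf (Z / (A * q ^ l))))"
    using s1 sums_unique2 by blast
  have "ghat A Z B ^ 2 = qinf (s * A) ^ 2 * qinf (Z / B) * qinf (Z * B) * (suminf a * suminf b)"
    using g1 g2 by (simp add: power2_eq_square)
  also have "\<dots> = (\<Sum>l\<le>n. qfin (A * B) l * qfin (A / B) l * qfin (A\<^sup>2) (2 * l) * qinf (s * A * q ^ l) ^ 2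
      / (qfin q l * qfin (A\<^sup>2) l) * ((- Z / A) ^ l / q ^ tri l) * qinf (A * Z * q ^ l) * qinf (Z / B) * qfin (Z * B) (n - l))"
    unfolding ab sum_distrib_left
  proof (intro sum.cong refl)
    fix l assume "l \<in> {..n}"
    then have l: "l \<le> n" by simp
    have "qinf (Z * B) = qfin (Z * B) (n - l) * qinf (Z / (A * q ^ l))"
      unfolding zl'[OF l] by (rule qinf_split)
    moreover have "qinf (s * A) = qfin (s * A) l * qinf (s * A * q ^ l)" by (rule qinf_split)
    ultimately show "qinf (s * A) ^ 2 * qinf (Z / B) * qinf (Z * B) * (K l * (qinf (A * Z * q ^ l) / qinf (Z / (A * q ^ l))))
       = qfin (A * B) l * qfin (A / B) l * qfin (A\<^sup>2) (2 * l) * qinf (s * A * q ^ l) ^ 2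
      / (qfin q l * qfin (A\<^sup>2) l) * ((- Z / A) ^ l / q ^ tri l) * qinf (A * Z * q ^ l) * qinf (Z / B) * qfin (Z * B) (n - l)"
      using sAk[of l] qinf_neq_0[OF zl[OF l]] unfolding K_def by (simp add: power_mult_distrib mult_ac)
  qed
  finally show ?thesis .
qed

text \<open>The formula for small Z contains the finite product (Z B)_(n-l) where a quotient of
  infinite products might stand. It is therefore holomorphic in Z off 0 and can be continued; only
  afterwards is it brought to the form that makes sense without termination.\<close>

theorem terminating_clausen:
  assumes nz: "A \<noteq> 0" "Z \<noteq> 0" and sA: "qinf (s * A) \<noteq> 0" and A2: "qinf (A\<^sup>2) \<noteq> 0"
    and AB: "A * B * q ^ n = 1" and ZA: "qinf (Z / A) \<noteq> 0" "\<And>k. qfin (q * A / Z) k \<noteq> 0"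
  shows "ghat A Z B ^ 2 = qinf (Z * B) * qinf (Z / B) * (\<Sum>l\<le>n. qfin (A * B) l * qfin (A / B) l * clausen_term A Z l)"
proof -
  have B: "B \<noteq> 0" using AB by auto
  define R where "R Z = (\<Sum>l\<le>n. qfin (A * B) l * qfin (A / B) l * qfin (A\<^sup>2) (2 * l) * qinf (s * A * q ^ l) ^ 2
      / (qfin q l * qfin (A\<^sup>2) l) * ((- Z / A) ^ l / q ^ tri l) * qinf (A * Z * q ^ l) * qinf (Z / B) * qfin (Z * B) (n - l))" for Z
  define S where "S = {Z :: complex. Z \<noteq> 0 \<and> norm Z < norm B \<and> norm Z * norm B < 1}"
  have "ghat A Z B ^ 2 = R Z"
  proof (rule analytic_continuation_open[of S "- {0}" "\<lambda>Z. ghat A Z B ^ 2" R])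
    show "open S" unfolding S_def by (intro open_Collect_conj open_Collect_less open_Collect_neq continuous_intros)
    define r where "r = min (norm B / 2) (1 / (2 * norm B))"
    have "r \<le> norm B / 2" "r > 0" using B by (auto simp: r_def)
    moreover have "r * norm B \<le> 1 / (2 * norm B) * norm B"
      unfolding r_def by (intro mult_right_mono) auto
    moreover have "1 / (2 * norm B) * norm B < 1" using B by simp
    ultimately have "complex_of_real r \<in> S"
      using B by (auto simp: S_def)
    then show "S \<noteq> {}" by auto
    show "connected (- {0::complex})" by (intro connected_punctured_universe) simp
    show "S \<subseteq> - {0}" by (auto simp: S_def)
    show "(\<lambda>Z. ghat A Z B ^ 2) holomorphic_on - {0}"
      by (intro holomorphic_intros holomorphic_on_subset[OF ghat_holomorphic_Z]) auto
    have "qfin (A\<^sup>2) k \<noteq> 0" for k using A2 qfin_nz_if_qinf_nz by auto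
    then show "R holomorphic_on - {0}"
      unfolding R_def using B nz q_nz by (intro holomorphic_intros) auto
    show "ghat A Z B ^ 2 = R Z" if "Z \<in> S" for Z
      unfolding R_def using that by (intro terminating_clausen_small nz sA A2 AB) (auto simp: S_def)
  qed (use nz in auto)
  also have "R Z = qinf (Z * B) * qinf (Z / B) * (\<Sum>l\<le>n. qfin (A * B) l * qfin (A / B) l * clausen_term A Z l)"
    unfolding R_def sum_distrib_left
  proof (intro sum.cong refl)
    fix l assume "l \<in> {..n}"
    then have q: "q ^ n = q ^ l * q ^ (n - l)" by (simp flip: power_add)
    then have "A * q ^ l * (B * q ^ (n - l)) = 1" using AB by (simp add: mult_ac)
    then have "Z * B * q ^ (n - l) = Z / A / q ^ l" using nz q_nz by (simp add: field_simps)
    then have e: "qinf (Z * B) = qfin (Z * B) (n - l) * qinf (Z / A / q ^ l)"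
      using qinf_split[of "Z * B" "n - l"] by simp
    have rv: "qinf (Z / A / q ^ l) * q ^ tri (Suc l) = qfin (q * A / Z) l * (- Z / A) ^ l * qinf (Z / A)"
      using qinf_reverse[of "Z / A" l] nz by simp
    have nz': "qinf (Z / A / q ^ l) \<noteq> 0" using rv ZA nz q_nz by auto
    \<comment> \<open>Reversal trades the power of - Z / A for (q A / Z)_l in the
      denominator.\<close>
    have "(- Z / A) ^ l / q ^ tri l = qinf (Z / A / q ^ l) * (q ^ l / (qinf (Z / A) * qfin (q * A / Z) l))"
      using rv ZA q_nz by (simp add: power_add field_simps)
    then show "qfin (A * B) l * qfin (A / B) l * qfin (A\<^sup>2) (2 * l) * qinf (s * A * q ^ l) ^ 2
      / (qfin q l * qfin (A\<^sup>2) l) * ((- Z / A) ^ l / q ^ tri l) * qinf (A * Z * q ^ l) * qinf (Z / B) * qfin (Z * B) (n - l)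
      = qinf (Z * B) * qinf (Z / B) * (qfin (A * B) l * qfin (A / B) l * clausen_term A Z l)"
      unfolding e clausen_term_def by (simp add: mult_ac)
  qed
  finally show ?thesis .
qed

end

section \<open>Residue sums over annuli\<close>

text \<open>Induction on the poles: subtracting c p / (w - p) makes p removable, and this principal
  part integrates to 2 pi i c p over the outer circle and to 0 over the inner one. The value c p = 0
  is allowed, so removable points may be listed among the poles.\<close>

lemma annulus_contour_difference:
  fixes F :: "complex \<Rightarrow> complex"
  assumes "finite Q" "\<And>p. p \<in> Q \<Longrightarrow> r < norm p \<and> norm p < R" "0 < r" "r < R"
    and "open T" "{w. r \<le> norm w \<and> norm w \<le> R} \<subseteq> T"
    and "F holomorphic_on T - Q"
    and "\<And>p. p \<in> Q \<Longrightarrow> ((\<lambda>w. F w * (w - p)) \<longlongrightarrow> c p) (at p)"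
  shows "contour_integral (circlepath 0 R) F - contour_integral (circlepath 0 r) F = 2 * of_real pi * \<i> * (\<Sum>p\<in>Q. c p)"
  using assms
proof (induction Q arbitrary: F rule: finite_induct)
  case empty
  have "homotopic_loops T (circlepath 0 R) (circlepath 0 r)"
  proof (rule homotopic_loops_linear)
    fix t :: real
    have "closed_segment (circlepath 0 R t) (circlepath 0 r t) \<subseteq> {w. r \<le> norm w \<and> norm w \<le> R}"
    proof
      fix x assume "x \<in> closed_segment (circlepath 0 R t) (circlepath 0 r t)"
      then obtain u where u: "0 \<le> u" "u \<le> 1" and x: "x = (1 - u) *\<^sub>R circlepath 0 R t + u *\<^sub>R circlepath 0 r t"
        by (auto simp: closed_segment_def)
      have "x = of_real ((1 - u) * R + u * r) * exp (2 * of_real pi * \<i> * t)"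
        unfolding x circlepath_def part_circlepath_def by (simp add: linepath_def scaleR_conv_of_real algebra_simps)
      then have "norm x = \<bar>(1 - u) * R + u * r\<bar>" by (simp only: norm_mult norm_of_real norm_exp_eq_Re) simp
      moreover have "(1 - u) * R + u * r = R - u * (R - r)" by (simp add: algebra_simps)
      moreover have "u * (R - r) \<le> R - r" "u * (R - r) \<ge> 0"
        using u empty.prems(3) by (auto simp: mult_left_le_one_le)
      ultimately show "x \<in> {w. r \<le> norm w \<and> norm w \<le> R}" using empty.prems(2) by auto
    qed
    then show "closed_segment (circlepath 0 R t) (circlepath 0 r t) \<subseteq> T" using empty.prems(5) by blast
  qed auto
  then have "contour_integral (circlepath 0 R) F = contour_integral (circlepath 0 r) F"
    by (rule Cauchy_theorem_homotopic_loops) (use empty.prems in auto)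
  then show ?case by simp
next
  case (insert p Q)
  define A where "A = T - Q"
  have pT: "p \<in> A" and pr: "r < norm p" "norm p < R"
    using insert.prems(1)[of p] insert.prems(5) insert.hyps(2) by (auto simp: A_def)
  have A: "open A" unfolding A_def using insert.prems(4) insert.hyps(1) by (intro open_Diff finite_imp_closed)
  have hF: "F holomorphic_on A - {p}"
    using insert.prems(6) unfolding A_def Diff_insert[symmetric] .
  have "(\<lambda>w. F w * (w - p)) holomorphic_on A - {p}" by (intro holomorphic_intros hF)
  then have f1: "(\<lambda>w. if w = p then c p else F w * (w - p)) holomorphic_on A"
    by (rule removable_singularity[OF _ A]) (use insert.prems(7) in auto)
  \<comment> \<open>L is the value that the difference has to take at p: the derivative of the
    holomorphic extension of \<open>F w * (w - p)\<close>.\<close>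
  then obtain L where "((\<lambda>w. if w = p then c p else F w * (w - p)) has_field_derivative L) (at p)"
    using pT A by (meson holomorphic_on_imp_differentiable_at field_differentiable_def)
  then have "((\<lambda>w. ((if w = p then c p else F w * (w - p)) - c p) / (w - p)) \<longlongrightarrow> L) (at p)"
    by (simp add: has_field_derivative_iff)
  then have L: "((\<lambda>w. F w - c p / (w - p)) \<longlongrightarrow> L) (at p)"
    by (rule Lim_transform_eventually) (auto simp: eventually_at_filter diff_divide_distrib intro!: always_eventually)
  define G where "G = (\<lambda>w. if w = p then L else F w - c p / (w - p))"
  have G: "G holomorphic_on T - Q"
    unfolding G_def A_def[symmetric] by (rule removable_singularity[OF _ A L]) (intro holomorphic_intros hF, auto)
  have lim: "((\<lambda>w. G w * (w - p')) \<longlongrightarrow> c p') (at p')" if p': "p' \<in> Q" for p'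
  proof -
    have ne: "p' \<noteq> p" using p' insert.hyps by auto
    have "((\<lambda>w. F w * (w - p') - c p / (w - p) * (w - p')) \<longlongrightarrow> c p' - c p / (p' - p) * (p' - p')) (at p')"
      using ne by (intro tendsto_intros insert.prems(7)) (use p' in auto)
    then have "((\<lambda>w. F w * (w - p') - c p / (w - p) * (w - p')) \<longlongrightarrow> c p') (at p')" by simp
    moreover have "eventually (\<lambda>w. w \<noteq> p) (at p')"
      using ne by (intro tendsto_imp_eventually_ne[OF tendsto_ident_at])
    ultimately show ?thesis
      by (rule Lim_transform_eventually[OF _ eventually_mono]) (auto simp: G_def algebra_simps)
  qed
  have IH: "contour_integral (circlepath 0 R) G - contour_integral (circlepath 0 r) G = 2 * of_real pi * \<i> * (\<Sum>p\<in>Q. c p)"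
    by (rule insert.IH) (use insert.prems G lim in auto)
  have circ: "contour_integral (circlepath 0 \<rho>) G = contour_integral (circlepath 0 \<rho>) F - c p * contour_integral (circlepath 0 \<rho>) (\<lambda>w. 1 / (w - p))"
    if \<rho>: "\<rho> = r \<or> \<rho> = R" for \<rho>
  proof -
    have \<rho>0: "\<rho> > 0" using \<rho> insert.prems by auto
    have sub: "path_image (circlepath 0 \<rho>) \<subseteq> A - {p}"
      using \<rho> insert.prems(1,3,5) \<rho>0 unfolding A_def by (auto simp: subset_iff)
    have iF: "F contour_integrable_on circlepath 0 \<rho>"
      by (rule contour_integrable_holomorphic_simple[OF hF _ _ sub]) (use A in auto)
    have iP: "(\<lambda>w. 1 / (w - p)) contour_integrable_on circlepath 0 \<rho>"
      by (rule contour_integrable_holomorphic_simple[OF _ _ _ sub]) (use A in \<open>auto intro!: holomorphic_intros\<close>)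
    have "contour_integral (circlepath 0 \<rho>) G = contour_integral (circlepath 0 \<rho>) (\<lambda>w. F w - c p * (1 / (w - p)))"
      using sub by (intro contour_integral_eq) (auto simp: G_def)
    also have "\<dots> = contour_integral (circlepath 0 \<rho>) F - contour_integral (circlepath 0 \<rho>) (\<lambda>w. c p * (1 / (w - p)))"
      by (intro contour_integral_diff iF contour_integrable_lmul iP)
    also have "contour_integral (circlepath 0 \<rho>) (\<lambda>w. c p * (1 / (w - p))) = c p * contour_integral (circlepath 0 \<rho>) (\<lambda>w. 1 / (w - p))"
      by (rule contour_integral_lmul[OF iP])
    finally show ?thesis .
  qed
  have "winding_number (circlepath 0 R) p = 1"
    using pr by (intro winding_number_circlepath) auto
  moreover have "p \<notin> path_image (circlepath 0 R)" using pr insert.prems by auto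
  ultimately have wR: "contour_integral (circlepath 0 R) (\<lambda>w. 1 / (w - p)) = 2 * of_real pi * \<i>"
    using winding_number_valid_path[of "circlepath 0 R" p] by (simp add: field_simps)
  have "winding_number (circlepath 0 r) p = 0"
    by (rule winding_number_zero_outside[of _ "cball 0 r"]) (use pr insert.prems(2) in auto)
  moreover have "p \<notin> path_image (circlepath 0 r)" using pr insert.prems by auto
  ultimately have wr: "contour_integral (circlepath 0 r) (\<lambda>w. 1 / (w - p)) = 0"
    using winding_number_valid_path[of "circlepath 0 r" p] by simp
  have "contour_integral (circlepath 0 R) F - contour_integral (circlepath 0 r) F
      = (contour_integral (circlepath 0 R) G - contour_integral (circlepath 0 r) G) + c p * (2 * of_real pi * \<i>)"
    using circ[of r] circ[of R] by (simp add: wR wr)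
  then show ?case unfolding IH using insert.hyps by (simp add: algebra_simps)
qed

text \<open>The annuli exhaust P, so their finite residue sums converge to the unordered sum. The
  decay is required of |F w| |w| because the length of the circle contributes the factor
  |w|.\<close>

theorem residue_sum_zero:
  fixes F :: "complex \<Rightarrow> complex" and rr RR M :: "nat \<Rightarrow> real"
  assumes hol: "F holomorphic_on - {0} - P" and P0: "0 \<notin> P"
    and fin: "\<And>r R. 0 < r \<Longrightarrow> finite {p \<in> P. r \<le> norm p \<and> norm p \<le> R}"
    and lim: "\<And>p. p \<in> P \<Longrightarrow> ((\<lambda>w. F w * (w - p)) \<longlongrightarrow> c p) (at p)"
    and rr: "\<And>n. 0 < rr n" "rr \<longlonglongrightarrow> 0" and RR: "filterlim RR at_top sequentially"
    and avoid: "\<And>n p. p \<in> P \<Longrightarrow> norm p \<noteq> rr n \<and> norm p \<noteq> RR n"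
    and decay: "\<And>n w. norm w = rr n \<or> norm w = RR n \<Longrightarrow> norm (F w) * norm w \<le> M n" "M \<longlonglongrightarrow> 0"
    and summ: "c summable_on P"
  shows "infsum c P = 0"
proof -
  define Q where "Q n = {p \<in> P. rr n \<le> norm p \<and> norm p \<le> RR n}" for n
  have finQ: "finite (Q n)" for n unfolding Q_def using fin rr(1) .
  \<comment> \<open>P is locally finite away from 0, so deleting the poles outside the annulus
    leaves an open set in which F is singular at most at the points of \<open>Q n\<close>.\<close>
  have open_far: "open (- {0} - (P - Q n))" for n
    unfolding open_subopen[of "- {0} - (P - Q n)"]
  proof
    fix w assume w: "w \<in> - {0} - (P - Q n)"
    define U where "U = {x. norm w / 2 < norm x \<and> norm x < 2 * norm w} - ({p \<in> P. norm w / 2 \<le> norm p \<and> norm p \<le> 2 * norm w} - Q n)"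
    have "finite {p \<in> P. norm w / 2 \<le> norm p \<and> norm p \<le> 2 * norm w}" using w by (intro fin) auto
    then have "open U"
      unfolding U_def by (intro open_Diff finite_imp_closed finite_Diff open_Collect_conj open_Collect_less continuous_intros)
    moreover have "w \<in> U" using w by (auto simp: U_def)
    moreover have "U \<subseteq> - {0} - (P - Q n)" by (auto simp: U_def)
    ultimately show "\<exists>U. open U \<and> w \<in> U \<and> U \<subseteq> - {0} - (P - Q n)" by blast
  qed
  have bound: "norm (\<Sum>p\<in>Q n. c p) \<le> 2 * M n" if lt: "rr n < RR n" for n
  proof -
    define T where "T = - {0} - (P - Q n)"
    have QP: "Q n \<subseteq> P" by (auto simp: Q_def)
    have T: "open T" unfolding T_def by (rule open_far)
    have TQ: "T - Q n = - {0} - P" using QP by (auto simp: T_def)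
    have hol': "F holomorphic_on T - Q n" unfolding TQ by (rule hol)
    have ann: "{w. rr n \<le> norm w \<and> norm w \<le> RR n} \<subseteq> T"
      using rr(1)[of n] by (auto simp: T_def Q_def)
    have e: "contour_integral (circlepath 0 (RR n)) F - contour_integral (circlepath 0 (rr n)) F = 2 * of_real pi * \<i> * (\<Sum>p\<in>Q n. c p)"
    proof (rule annulus_contour_difference[OF finQ _ rr(1) lt T ann hol'])
      show "rr n < norm p \<and> norm p < RR n" if "p \<in> Q n" for p
        using that avoid[of p n] by (auto simp: Q_def less_le)
      show "((\<lambda>w. F w * (w - p)) \<longlongrightarrow> c p) (at p)" if "p \<in> Q n" for p
        using that lim by (auto simp: Q_def)
    qed
    have M0: "M n \<ge> 0" using decay(1)[of "of_real (rr n)" n] rr(1)[of n]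
      by (metis abs_of_pos norm_of_real norm_ge_zero mult_nonneg_nonneg order_trans)
    have b: "norm (contour_integral (circlepath 0 \<rho>) F) \<le> 2 * pi * M n" if \<rho>: "\<rho> = rr n \<or> \<rho> = RR n" for \<rho>
    proof -
      have \<rho>0: "\<rho> > 0" using \<rho> rr(1)[of n] lt by auto
      have sub: "path_image (circlepath 0 \<rho>) \<subseteq> - {0} - P"
        using \<rho> avoid \<rho>0 by auto
      have "open (T - Q n)" using T finQ by (intro open_Diff finite_imp_closed)
      then have "F contour_integrable_on circlepath 0 \<rho>"
        by (intro contour_integrable_holomorphic_simple[OF hol]) (use sub TQ in auto)
      then have "(F has_contour_integral contour_integral (circlepath 0 \<rho>) F) (circlepath 0 \<rho>)"
        by (rule has_contour_integral_integral)
      then have "norm (contour_integral (circlepath 0 \<rho>) F) \<le> M n / \<rho> * (2 * pi * \<rho>)"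
      proof (rule has_contour_integral_bound_circlepath)
        show "norm (F x) \<le> M n / \<rho>" if "norm (x - 0) = \<rho>" for x
          using decay(1)[of x n] that \<rho> \<rho>0 by (auto simp: field_simps)
      qed (use \<rho>0 M0 in auto)
      then show ?thesis using \<rho>0 by (simp add: mult.commute)
    qed
    have "2 * pi * norm (\<Sum>p\<in>Q n. c p) = norm (2 * of_real pi * \<i> * (\<Sum>p\<in>Q n. c p))"
      by (simp add: norm_mult)
    also have "\<dots> \<le> 2 * pi * M n + 2 * pi * M n"
      unfolding e[symmetric] by (rule order_trans[OF norm_triangle_ineq4]) (intro add_mono b, auto)
    finally have "2 * pi * norm (\<Sum>p\<in>Q n. c p) \<le> 2 * pi * (2 * M n)" by simp
    then show ?thesis using pi_gt_zero by (simp only: mult_le_cancel_left_pos mult_pos_pos zero_less_numeral)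
  qed
  have lt: "eventually (\<lambda>n. rr n < RR n) sequentially"
  proof -
    have "eventually (\<lambda>n. rr n < 1) sequentially" using rr(2) by (rule order_tendstoD) simp
    moreover have "eventually (\<lambda>n. RR n \<ge> 1) sequentially" using RR by (simp add: filterlim_at_top)
    ultimately show ?thesis by eventually_elim linarith
  qed
  have "filterlim Q (finite_subsets_at_top P) sequentially"
    unfolding filterlim_finite_subsets_at_top
  proof (intro allI impI)
    fix X assume X: "finite X \<and> X \<subseteq> P"
    have "eventually (\<lambda>n. \<forall>x\<in>X. x \<in> Q n) sequentially"
    proof (intro eventually_ball_finite ballI)
      fix x assume "x \<in> X"
      then have x: "x \<in> P" "norm x > 0" using X P0 by auto
      have "eventually (\<lambda>n. rr n < norm x) sequentially" using rr(2) x by (auto intro: order_tendstoD)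
      moreover have "eventually (\<lambda>n. RR n \<ge> norm x) sequentially" using RR by (simp add: filterlim_at_top)
      ultimately show "eventually (\<lambda>n. x \<in> Q n) sequentially"
        by eventually_elim (use x in \<open>auto simp: Q_def\<close>)
    qed (use X in auto)
    then show "eventually (\<lambda>n. finite (Q n) \<and> X \<subseteq> Q n \<and> Q n \<subseteq> P) sequentially"
      by eventually_elim (use finQ in \<open>auto simp: Q_def\<close>)
  qed
  moreover have "(sum c \<longlongrightarrow> infsum c P) (finite_subsets_at_top P)"
    using has_sum_infsum[OF summ] by (simp add: has_sum_def)
  ultimately have "(\<lambda>n. sum c (Q n)) \<longlonglongrightarrow> infsum c P"
    by (rule filterlim_compose[rotated])
  moreover have "(\<lambda>n. sum c (Q n)) \<longlonglongrightarrow> 0"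
  proof (rule Lim_null_comparison)
    show "eventually (\<lambda>n. norm (sum c (Q n)) \<le> 2 * M n) sequentially"
      using lt by eventually_elim (rule bound)
    show "(\<lambda>n. 2 * M n) \<longlonglongrightarrow> 0" using tendsto_mult_left[OF decay(2), of 2] by simp
  qed
  ultimately show ?thesis using LIMSEQ_unique by blast
qed

section \<open>Simple poles and lower bounds for infinite factorials\<close>

context qdisc
begin

text \<open>The factorial \<open>(x)\<^sub>\<infinity>\<close> without its \<open>n\<close>-th factor, counted from zero.\<close>

definition qrem :: "nat \<Rightarrow> complex \<Rightarrow> complex" where
  "qrem n x = qfin x n * qinf (x * q ^ Suc n)"

lemma qinf_qrem: "qinf x = (1 - x * q ^ n) * qrem n x"
  using qinf_split[of x "Suc n"] by (simp add: qrem_def qfin_Suc mult_ac)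

lemma qrem_tendsto [tendsto_intros]:
  assumes "(f \<longlongrightarrow> l) F" shows "((\<lambda>x. qrem n (f x)) \<longlongrightarrow> qrem n l) F"
  unfolding qrem_def qfin_def by (intro tendsto_intros assms)

text \<open>The powers of q are distinct, so two factors cannot vanish together: the zeros of the
  infinite factorial are simple.\<close>

lemma qrem_nz: assumes "x * q ^ n = 1" shows "qrem n x \<noteq> 0"
proof -
  have "x * q ^ j \<noteq> 1" if "j \<noteq> n" for j
  proof
    assume j: "x * q ^ j = 1"
    then have "x * q ^ j = x * q ^ n" using assms by simp
    moreover have "x \<noteq> 0" using assms by auto
    ultimately have "q ^ j = q ^ n" by simp
    moreover have "q ^ a \<noteq> q ^ b" if "a < b" for a b
    proof -
      obtain d where "b = a + Suc d" using \<open>a < b\<close> less_imp_Suc_add by auto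
      then have "q ^ b = q ^ a * q ^ Suc d" by (simp add: power_add)
      then show ?thesis using q_power_neq_1[of d] q_nz by auto
    qed
    ultimately show False using that by (metis nat_neq_iff)
  qed
  then have "qfin x n \<noteq> 0" "qinf (x * q ^ Suc n) \<noteq> 0"
    by (auto simp: qfin_eq_0_iff qinf_eq_0_iff mult.assoc simp flip: power_add power_Suc)
  then show ?thesis by (simp add: qrem_def)
qed

lemma simple_zero_limit:
  assumes "A * p * q ^ n = 1"
  shows "((\<lambda>w. (w - p) / qinf (A * w)) \<longlongrightarrow> - p / qrem n (A * p)) (at p)"
proof -
  have nz: "A \<noteq> 0" "p \<noteq> 0" using assms by auto
  have "((\<lambda>w. - p / qrem n (A * w)) \<longlongrightarrow> - p / qrem n (A * p)) (at p)"
    by (intro tendsto_intros qrem_nz assms)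
  moreover have "- p / qrem n (A * w) = (w - p) / qinf (A * w)" if "w \<noteq> p" for w
  proof -
    have "1 - A * w * q ^ n = - (w - p) / p" using assms nz by (simp add: field_simps)
    then have m: "qinf (A * w) = - (w - p) / p * qrem n (A * w)" using qinf_qrem[of "A * w" n] by simp
    have h: "- p / Q = d / (- d / p * Q)" if "d \<noteq> 0" for d Q
      using nz that by (simp add: field_simps)
    show ?thesis unfolding m by (rule h) (use that in simp)
  qed
  then have "eventually (\<lambda>w. - p / qrem n (A * w) = (w - p) / qinf (A * w)) (at p)"
    by (auto simp: eventually_at_filter)
  ultimately show ?thesis by (rule Lim_transform_eventually)
qed

lemma simple_zero_limit':
  assumes "p = A * q ^ n" "p \<noteq> 0"
  shows "((\<lambda>w. (w - p) / qinf (A / w)) \<longlongrightarrow> p / qrem n (A / p)) (at p)"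
proof -
  have e: "A / p * q ^ n = 1" using assms by simp
  have lim0: "((\<lambda>w. w / qrem n (A / w)) \<longlongrightarrow> p / qrem n (A / p)) (at p)"
    by (intro tendsto_intros qrem_nz e assms)
  have eq: "w / qrem n (A / w) = (w - p) / qinf (A / w)" if "w \<noteq> p" "w \<noteq> 0" for w
  proof -
    have "1 - A / w * q ^ n = (w - p) / w" using assms that by (simp add: field_simps)
    then have m: "qinf (A / w) = (w - p) / w * qrem n (A / w)" using qinf_qrem[of "A / w" n] by simp
    have h: "w / Q = d / (d / w * Q)" if "d \<noteq> 0" for d Q
      using \<open>w \<noteq> 0\<close> that by (simp add: field_simps)
    show ?thesis unfolding m by (rule h) (use that in simp)
  qed
  have e1: "eventually (\<lambda>w. w \<noteq> p) (at p)" by (auto simp: eventually_at_filter)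
  have e2: "eventually (\<lambda>w. w \<noteq> 0) (at p)"
    using tendsto_imp_eventually_ne[OF tendsto_ident_at assms(2)] .
  have "eventually (\<lambda>w. w / qrem n (A / w) = (w - p) / qinf (A / w)) (at p)"
    by (rule eventually_mono[OF eventually_conj[OF e1 e2]]) (use eq in simp)
  with lim0 show ?thesis by (rule Lim_transform_eventually)
qed

lemma finite_geometric_above: "0 < r \<Longrightarrow> finite {p \<in> range (\<lambda>n. c * q ^ n). r \<le> norm p}"
proof -
  assume r: "0 < r"
  have "(\<lambda>n. norm (c * q ^ n)) \<longlonglongrightarrow> norm (c * 0)"
    using q_lt1 by (intro tendsto_intros LIMSEQ_power_zero)
  then have "eventually (\<lambda>n. norm (c * q ^ n) < r) sequentially"
    using r by (intro order_tendstoD) auto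
  then obtain N where "\<And>n. n \<ge> N \<Longrightarrow> norm (c * q ^ n) < r" by (auto simp: eventually_sequentially)
  then have "{p \<in> range (\<lambda>n. c * q ^ n). r \<le> norm p} \<subseteq> (\<lambda>n. c * q ^ n) ` {..<N}"
    by (auto simp: not_le) (metis imageI lessThan_iff linorder_not_le)
  then show ?thesis by (rule finite_subset) auto
qed

lemma finite_geometric_below:
  assumes "c \<noteq> 0" shows "finite {p \<in> range (\<lambda>n. c / q ^ n). norm p \<le> R}"
proof (cases "R > 0")
  case True
  have "finite {p \<in> range (\<lambda>n. 1 / c * q ^ n). 1 / R \<le> norm p}"
    using True by (intro finite_geometric_above) auto
  then have "finite (inverse ` {p \<in> range (\<lambda>n. 1 / c * q ^ n). 1 / R \<le> norm p})" by (rule finite_imageI)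
  moreover have "{p \<in> range (\<lambda>n. c / q ^ n). norm p \<le> R} \<subseteq> inverse ` {p \<in> range (\<lambda>n. 1 / c * q ^ n). 1 / R \<le> norm p}"
  proof
    fix p assume "p \<in> {p \<in> range (\<lambda>n. c / q ^ n). norm p \<le> R}"
    then obtain n where p: "p = c / q ^ n" "norm p \<le> R" by auto
    then have p0: "p \<noteq> 0" using assms q_nz by auto
    have "1 / R \<le> 1 / norm p" using p(2) p0 True by (intro divide_left_mono) auto
    then have "inverse p \<in> {p \<in> range (\<lambda>n. 1 / c * q ^ n). 1 / R \<le> norm p}"
      using p(1) by (auto simp: norm_inverse inverse_eq_divide norm_divide image_iff)
    then show "p \<in> inverse ` {p \<in> range (\<lambda>n. 1 / c * q ^ n). 1 / R \<le> norm p}"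
      using inverse_inverse_eq[of p] by (metis image_eqI)
  qed
  ultimately show ?thesis by (rule finite_subset[rotated])
next
  case False
  have "norm p > 0" if "p \<in> range (\<lambda>n. c / q ^ n)" for p
    using that assms q_nz by auto
  then have "\<not> norm p \<le> R" if "p \<in> range (\<lambda>n. c / q ^ n)" for p
    using that False order_less_le_trans by blast
  then have "{p \<in> range (\<lambda>n. c / q ^ n). norm p \<le> R} = {}" by blast
  then show ?thesis by (simp only: finite.emptyI)
qed

lemma qinf_lower_disc:
  assumes "\<rho> < 1" shows "\<exists>c>0. \<forall>x. norm x \<le> \<rho> \<longrightarrow> c \<le> norm (qinf x)"
proof (cases "\<rho> \<ge> 0")
  case True
  have "\<exists>x\<in>cball 0 \<rho>. \<forall>y\<in>cball 0 \<rho>. norm (qinf x) \<le> norm (qinf y)"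
    using True by (intro continuous_attains_inf continuous_intros) auto
  then obtain x where x: "norm x \<le> \<rho>" "\<And>y. norm y \<le> \<rho> \<Longrightarrow> norm (qinf x) \<le> norm (qinf y)" by auto
  have "norm (qinf x) > 0" using qinf_neq_0[of x] x(1) assms by auto
  with x(2) show ?thesis by blast
next
  case False
  then show ?thesis by (intro exI[of _ 1]) (auto intro: order_trans[OF norm_ge_zero])
qed

text \<open>On |x| = \<rho> / |q|^n factors are peeled off one at a time by |1 - x| >= |x| - 1, and
  \<rho> > |q| keeps each of these bounds positive. Their product grows faster than every power of
  |x|; the square root is all that the later estimates use.\<close>

lemma qinf_lower:
  assumes "norm q < \<rho>" "\<rho> < 1"
  shows "\<exists>c>0. \<forall>x. norm x \<le> \<rho> \<or> (\<exists>n. norm x = \<rho> / norm q ^ n) \<longrightarrow> c * sqrt (norm x) \<le> norm (qinf x)"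
proof -
  obtain c0 where c0: "c0 > 0" "\<And>x. norm x \<le> \<rho> \<Longrightarrow> c0 \<le> norm (qinf x)"
    using qinf_lower_disc[OF assms(2)] by blast
  have q0: "norm q > 0" using q_nz by simp
  define g where "g n = c0 * (\<Prod>i<n. \<rho> / norm q ^ Suc i - 1)" for n
  have f: "\<rho> / norm q ^ Suc i - 1 > 0" for i
  proof -
    have "norm q ^ Suc i \<le> norm q" using q_lt1 by (simp add: mult_left_le power_le_one)
    also have "\<dots> < \<rho>" by fact
    finally show ?thesis using q0 by (simp add: field_simps)
  qed
  have gpos: "g n > 0" for n unfolding g_def using f c0(1) by (intro mult_pos_pos prod_pos) auto
  have low: "g n \<le> norm (qinf x)" if "norm x = \<rho> / norm q ^ n" for n x
    using that
  proof (induction n arbitrary: x)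
    case 0 then show ?case using c0(2)[of x] by (simp add: g_def)
  next
    case (Suc n)
    have "norm (x * q) = \<rho> / norm q ^ n" using Suc.prems q0 by (simp add: norm_mult)
    then have IH: "g n \<le> norm (qinf (x * q))" by (rule Suc.IH)
    have "norm x - 1 \<le> norm (1 - x)" by (metis norm_minus_commute norm_one norm_triangle_ineq2)
    then have "g n * (\<rho> / norm q ^ Suc n - 1) \<le> norm (qinf (x * q)) * norm (1 - x)"
      using IH f[of n] unfolding Suc.prems by (intro mult_mono) (auto simp: less_imp_le)
    also have "\<dots> = norm (qinf x)" unfolding qinf_split1[of x] by (simp add: norm_mult)
    finally show ?case by (simp add: g_def mult_ac)
  qed
  define t where "t = sqrt (norm q)"
  have t: "t > 0" using q0 by (simp add: t_def)
  have "filterlim (\<lambda>i. \<rho> / norm q ^ Suc i - 1) at_top sequentially"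
  proof -
    have "filterlim (\<lambda>i. (1 / norm q) ^ i) at_top sequentially"
      using filterlim_inverse_at_top[OF LIMSEQ_power_zero[of "norm q"]] q0 q_lt1
      by (simp add: power_divide inverse_eq_divide)
    then have "filterlim (\<lambda>i. (1 / norm q) ^ Suc i) at_top sequentially"
      by (rule filterlim_compose[OF _ filterlim_Suc])
    moreover have "0 < \<rho>" using assms q0 by linarith
    ultimately have "filterlim (\<lambda>i. \<rho> * (1 / norm q) ^ Suc i) at_top sequentially"
      by (intro filterlim_tendsto_pos_mult_at_top[OF tendsto_const])
    then have "filterlim (\<lambda>i. -1 + \<rho> * (1 / norm q) ^ Suc i) at_top sequentially"
      by (intro filterlim_tendsto_add_at_top[OF tendsto_const])
    then show ?thesis by (simp add: power_divide)
  qed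
  \<comment> \<open>With the threshold 2 / t, the quantity \<open>g n * t ^ n\<close> at least
    doubles at each step from N on.\<close>
  then have "eventually (\<lambda>i. \<rho> / norm q ^ Suc i - 1 \<ge> 2 / t) sequentially" by (simp add: filterlim_at_top)
  then obtain N where N: "\<And>i. i \<ge> N \<Longrightarrow> \<rho> / norm q ^ Suc i - 1 \<ge> 2 / t" by (auto simp: eventually_sequentially)
  \<comment> \<open>Summability serves only to bound the reciprocals of
    \<open>g n * t ^ n\<close>.\<close>
  have "summable (\<lambda>n. 1 / (g n * t ^ n))"
  proof (rule summable_ratio_test[where c = "1/2" and N = N])
    fix n assume "N \<le> n"
    from N[OF this] have "g n * t ^ n * 2 \<le> g n * t ^ n * (t * (\<rho> / norm q ^ Suc n - 1))"
      using gpos[of n] t by (intro mult_left_mono) (auto simp: field_simps less_imp_le)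
    also have "\<dots> = g (Suc n) * t ^ Suc n" by (simp add: g_def mult_ac)
    finally have "1 / (g (Suc n) * t ^ Suc n) \<le> 1 / (g n * t ^ n * 2)"
      using gpos t by (intro divide_left_mono) (auto intro!: mult_pos_pos zero_less_power)
    moreover have "g (Suc n) * t ^ Suc n > 0" "g n * t ^ n > 0" using gpos t by (auto intro!: mult_pos_pos)
    ultimately show "norm (1 / (g (Suc n) * t ^ Suc n)) \<le> 1 / 2 * norm (1 / (g n * t ^ n))"
      by (simp only: real_norm_def abs_divide abs_one abs_of_pos)
  qed simp
  then have "Bseq (\<lambda>n. 1 / (g n * t ^ n))"
    by (rule convergent_imp_Bseq[OF convergentI[OF summable_LIMSEQ_zero]])
  then obtain K where K: "K > 0" "\<And>n. norm (1 / (g n * t ^ n)) \<le> K" by (auto simp: Bseq_def)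
  have low2: "1 / (K * sqrt \<rho>) * sqrt (norm x) \<le> norm (qinf x)" if x: "norm x = \<rho> / norm q ^ n" for n x
  proof -
    have "1 / (g n * t ^ n) \<le> K" using K(2)[of n] by (metis abs_le_D1 real_norm_def)
    moreover have "g n * t ^ n > 0" using gpos t by (auto intro!: mult_pos_pos)
    ultimately have "1 / K \<le> g n * t ^ n" using K(1) by (simp add: field_simps)
    then have "1 / K / t ^ n \<le> g n" by (simp only: pos_divide_le_eq[OF zero_less_power[OF t]])
    also have "g n \<le> norm (qinf x)" by (rule low[OF x])
    finally have "1 / K / t ^ n \<le> norm (qinf x)" .
    moreover have "sqrt (norm x) = sqrt \<rho> / t ^ n" unfolding x t_def by (simp add: real_sqrt_divide real_sqrt_power)
    ultimately show ?thesis using assms q0 by simp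
  qed
  have low3: "c0 * sqrt (norm x) \<le> norm (qinf x)" if "norm x \<le> \<rho>" for x
  proof -
    have "c0 * sqrt (norm x) \<le> c0 * 1" using that assms c0 by (intro mult_left_mono) auto
    then show ?thesis using c0(2)[OF that] by simp
  qed
  define c where "c = min c0 (1 / (K * sqrt \<rho>))"
  have "\<rho> > 0" using assms q0 by linarith
  then have "c > 0" using c0(1) K(1) by (simp add: c_def)
  moreover have "c * sqrt (norm x) \<le> norm (qinf x)" if "norm x \<le> \<rho> \<or> (\<exists>n. norm x = \<rho> / norm q ^ n)" for x
  proof -
    have "c * sqrt (norm x) \<le> c0 * sqrt (norm x)" "c * sqrt (norm x) \<le> 1 / (K * sqrt \<rho>) * sqrt (norm x)"
      by (intro mult_right_mono; simp add: c_def)+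
    then show ?thesis using that low2 low3 by (meson order_trans)
  qed
  ultimately show ?thesis by blast
qed

end

section \<open>The nonterminating q-Clausen formula\<close>

context qsqrt
begin

text \<open>One half of the right-hand side of the q-Clausen formula as a function of w = B;
  exchanging A and Z gives the other half.\<close>

definition clausen_part :: "complex \<Rightarrow> complex \<Rightarrow> complex \<Rightarrow> complex" where
  "clausen_part A Z w = qinf (Z * w) * qinf (Z / w) * (\<Sum>k. qfin (A * w) k * qfin (A / w) k * clausen_term A Z k)"

lemma norm_qinf_qpow_le: "norm (qinf (x * q ^ k)) \<le> emaj (norm x)"
  using norm_qinf_le[of "x * q ^ k"] emaj_mono[OF norm_mult_qpow_le[of x k]] by linarith

lemma clausen_term_bound:
  assumes "qinf (A\<^sup>2) \<noteq> 0" "qinf (q * A / Z) \<noteq> 0"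
  shows "\<exists>C\<ge>0. \<forall>k. norm (clausen_term A Z k) \<le> C * norm q ^ k"
proof -
  obtain C1 where C1: "C1 > 0" "\<And>k. norm (inverse (qfin q k)) \<le> C1"
    using qinf_inverse_bounded[OF qinf_q_nz] by blast
  obtain C2 where C2: "C2 > 0" "\<And>k. norm (inverse (qfin (A\<^sup>2) k)) \<le> C2"
    using qinf_inverse_bounded[OF assms(1)] by blast
  obtain C3 where C3: "C3 > 0" "\<And>k. norm (inverse (qfin (q * A / Z) k)) \<le> C3"
    using qinf_inverse_bounded[OF assms(2)] by blast
  define C where "C = emaj (norm (s * A)) ^ 2 * emaj (norm (A * Z)) * emaj (norm (A\<^sup>2)) * C1 * C2 * C3 * norm (inverse (qinf (Z / A)))"
  have "norm (clausen_term A Z k) \<le> C * norm q ^ k" for k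
  proof -
    have "norm (clausen_term A Z k) = norm (qinf (s * A * q ^ k)) ^ 2 * norm (qinf (A * Z * q ^ k)) * norm (qfin (A\<^sup>2) (2 * k))
       * norm (inverse (qfin q k)) * norm (inverse (qfin (A\<^sup>2) k)) * norm (inverse (qfin (q * A / Z) k)) * norm (inverse (qinf (Z / A))) * norm q ^ k"
      by (simp add: clausen_term_def norm_mult norm_divide norm_inverse norm_power field_simps)
    also have "\<dots> \<le> C * norm q ^ k"
      unfolding C_def
      by (intro mult_right_mono mult_mono power_mono norm_qinf_qpow_le norm_qfin_le C1 C2 C3 order_refl)
         (auto intro!: mult_nonneg_nonneg less_imp_le[OF emaj_pos] less_imp_le[OF C1(1)] less_imp_le[OF C2(1)] less_imp_le[OF C3(1)])
    finally show ?thesis .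
  qed
  moreover have "C \<ge> 0"
    unfolding C_def using C1(1) C2(1) C3(1) by (auto intro!: mult_nonneg_nonneg less_imp_le[OF emaj_pos])
  ultimately show ?thesis by blast
qed

lemma clausen_part_holomorphic:
  assumes "qinf (A\<^sup>2) \<noteq> 0" "qinf (q * A / Z) \<noteq> 0"
  shows "clausen_part A Z holomorphic_on - {0}"
proof -
  obtain C where C: "C \<ge> 0" "\<And>k. norm (clausen_term A Z k) \<le> C * norm q ^ k"
    using clausen_term_bound[OF assms] by blast
  have "(\<lambda>w. \<Sum>k. qfin (A * w) k * qfin (A / w) k * clausen_term A Z k) holomorphic_on - {0}"
  proof (rule holomorphic_suminf)
    fix K :: "complex set" assume K: "compact K" "K \<subseteq> - {0}"
    have "compact ((\<lambda>B. A * B) ` K)" "compact ((\<lambda>B. A / B) ` K)"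
      using K by (auto intro!: compact_continuous_image continuous_intros)
    then obtain R1 R2 where R: "\<And>B. B \<in> K \<Longrightarrow> norm (A * B) \<le> R1" "\<And>B. B \<in> K \<Longrightarrow> norm (A / B) \<le> R2"
      by (metis bounded_iff compact_imp_bounded imageI)
    show "\<exists>M. summable M \<and> (\<forall>k. \<forall>w\<in>K. norm (qfin (A * w) k * qfin (A / w) k * clausen_term A Z k) \<le> M k)"
    proof (intro exI conjI allI ballI)
      show "summable (\<lambda>k. emaj R1 * emaj R2 * (C * norm q ^ k))"
        using q_lt1 by (intro summable_mult summable_geometric) auto
      fix k w assume w: "w \<in> K"
      have "norm (qfin (A * w) k) \<le> emaj R1" "norm (qfin (A / w) k) \<le> emaj R2"
        using norm_qfin_le emaj_mono R[OF w] by (meson order_trans)+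
      then show "norm (qfin (A * w) k * qfin (A / w) k * clausen_term A Z k) \<le> emaj R1 * emaj R2 * (C * norm q ^ k)"
        unfolding norm_mult by (intro mult_mono C) (auto intro!: mult_nonneg_nonneg less_imp_le[OF emaj_pos])
    qed
  qed (auto intro!: holomorphic_intros)
  then show ?thesis unfolding clausen_part_def by (intro holomorphic_intros) auto
qed

lemma clausen_part_inv: "clausen_part A Z (1 / w) = clausen_part A Z w"
  by (simp add: clausen_part_def mult_ac)

text \<open>The prefactor vanishes. At these points the series in the other half terminates, so the
  terminating formula accounts for that half alone.\<close>

lemma clausen_part_zero: "Z * w * q ^ n = 1 \<Longrightarrow> clausen_part A Z w = 0"
  using qinf_eq_0_iff[of "Z * w"] by (auto simp: clausen_part_def)

lemma qinf_sq_nz: "norm A < 1 \<Longrightarrow> qinf (A\<^sup>2) \<noteq> 0"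
  by (rule qinf_neq_0) (simp add: norm_power power_less_one_iff)

definition clausen_defect :: "complex \<Rightarrow> complex \<Rightarrow> complex \<Rightarrow> complex" where
  "clausen_defect A Z w = ghat A Z w ^ 2 - clausen_part A Z w - clausen_part Z A w"

lemma clausen_defect_inv: "clausen_defect A Z (1 / w) = clausen_defect A Z w"
  by (simp add: clausen_defect_def ghat_inv clausen_part_inv)

text \<open>The half with A and Z exchanged is killed by its prefactor, and in the remaining one the
  series breaks off at n. The condition on Z / A keeps (Z / A) and (q A / Z)_k away from 0.\<close>

lemma clausen_defect_zero:
  assumes A: "A \<noteq> 0" "norm A < 1" and Z: "Z \<noteq> 0" and gen: "\<And>k::int. Z / A \<noteq> q powi k"
    and AB: "A * B * q ^ n = 1"
  shows "clausen_defect A Z B = 0"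
proof -
  have ZA: "qinf (Z / A) \<noteq> 0" "\<And>k. qfin (q * A / Z) k \<noteq> 0"
    using qfin_nz_powi(2)[OF gen, of 0] qfin_nz_powi(3)[OF gen] by auto
  have "(\<Sum>k. qfin (A * B) k * qfin (A / B) k * clausen_term A Z k) = (\<Sum>k\<le>n. qfin (A * B) k * qfin (A / B) k * clausen_term A Z k)"
  proof (rule suminf_finite)
    fix k assume "k \<notin> {..n}"
    then have "n < k" by simp
    then have "qfin (A * B) k = 0" using AB unfolding qfin_eq_0_iff by blast
    then show "qfin (A * B) k * qfin (A / B) k * clausen_term A Z k = 0" by simp
  qed simp
  then have "ghat A Z B ^ 2 = clausen_part A Z B"
    using terminating_clausen[OF A(1) Z sA_small[OF A(2)] qinf_sq_nz[OF A(2)] AB ZA] by (simp add: clausen_part_def)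
  moreover have "clausen_part Z A B = 0" using AB by (rule clausen_part_zero)
  ultimately show ?thesis by (simp add: clausen_defect_def)
qed

lemma sqrt_norm_qpow: "sqrt (norm (x * q ^ k)) = sqrt (norm x) * sqrt (norm q) ^ k"
  by (simp add: norm_mult norm_power real_sqrt_mult real_sqrt_power)

text \<open>On the circles \<open>|w| = |q|\<^sup>-\<^sup>n\<close> the factorials \<open>(A w q\<^sup>k)\<^sub>\<infinity>\<close> grow at least like the square root of
  their argument, uniformly in \<open>k\<close>.\<close>

lemma qinf_lower_circle:
  assumes "norm q < norm A" "norm A < 1"
  shows "\<exists>c>0. \<forall>n k w. norm w = 1 / norm q ^ n \<longrightarrow> c * sqrt (norm (A * w)) * sqrt (norm q) ^ k \<le> norm (qinf (A * w * q ^ k))"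
proof -
  obtain c where c: "c > 0" "\<And>x. norm x \<le> norm A \<or> (\<exists>n. norm x = norm A / norm q ^ n) \<Longrightarrow> c * sqrt (norm x) \<le> norm (qinf x)"
    using qinf_lower[OF assms] by blast
  have "c * sqrt (norm (A * w)) * sqrt (norm q) ^ k \<le> norm (qinf (A * w * q ^ k))" if w: "norm w = 1 / norm q ^ n" for n k w
  proof -
    have "norm (A * w * q ^ k) \<le> norm A \<or> (\<exists>n. norm (A * w * q ^ k) = norm A / norm q ^ n)"
    proof (cases "k \<le> n")
      case True
      then have "norm q ^ n = norm q ^ k * norm q ^ (n - k)" by (simp flip: power_add)
      then have "norm (A * w * q ^ k) = norm A / norm q ^ (n - k)"
        using w q_nz by (simp add: norm_mult norm_power)
      then show ?thesis by blast
    next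
      case False
      then have "norm q ^ k = norm q ^ n * norm q ^ (k - n)" by (simp flip: power_add)
      then have "norm (A * w * q ^ k) = norm A * norm q ^ (k - n)"
        using w q_nz by (simp add: norm_mult norm_power)
      also have "\<dots> \<le> norm A" using q_lt1 by (simp add: mult_left_le power_le_one)
      finally show ?thesis by blast
    qed
    from c(2)[OF this] show ?thesis unfolding sqrt_norm_qpow by (simp only: mult.assoc)
  qed
  with c(1) show ?thesis by blast
qed

text \<open>Write (A w)_k as (A w) / (A w q^k) and bound the tail from below. This gains |w|^(-1/2)
  and costs |q|^(-k/2), which the Gaussian factor of the series absorbs.\<close>

lemma ghat_decay:
  assumes "norm q < norm A" "norm A < 1"
  shows "\<exists>K\<ge>0. \<forall>n w. norm w = 1 / norm q ^ n \<longrightarrow> norm (ghat A Z w) \<le> K * norm (qinf (A * w)) / sqrt (norm w)"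
proof -
  obtain c where c: "c > 0" "\<And>n k w. norm w = 1 / norm q ^ n \<Longrightarrow> c * sqrt (norm (A * w)) * sqrt (norm q) ^ k \<le> norm (qinf (A * w * q ^ k))"
    using qinf_lower_circle[OF assms] by blast
  obtain C where C: "C > 0" "\<And>k. norm (inverse (qfin q k)) \<le> C"
    using qinf_inverse_bounded[OF qinf_q_nz] by blast
  define t where "t = sqrt (norm q)"
  have t: "t > 0" using q_nz by (simp add: t_def)
  define K0 where "K0 = 1 / (c * sqrt (norm A)) * emaj (norm A) * C * emaj (norm (s * A)) * emaj (norm (A * Z))"
  define Y where "Y k = norm q ^ tri k * (norm (s * Z) / t) ^ k" for k
  have Y: "summable Y" unfolding Y_def using t by (intro qpow_tri_summable) auto
  have A0: "norm A > 0" using assms(1) by (meson norm_ge_zero order_le_less_trans)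
  have K0: "K0 \<ge> 0" unfolding K0_def
    by (intro mult_nonneg_nonneg divide_nonneg_nonneg less_imp_le[OF emaj_pos]) (use c(1) C(1) A0 in auto)
  have "norm (ghat A Z w) \<le> (K0 * suminf Y) * norm (qinf (A * w)) / sqrt (norm w)" if w: "norm w = 1 / norm q ^ n" for n w
  proof -
    have w1: "norm w \<ge> 1" unfolding w using q_lt1 q_nz by (simp add: power_le_one)
    define b where "b k = K0 * norm (qinf (A * w)) / sqrt (norm w) * Y k" for k
    have tb: "norm (qfin (A * w) k * qfin (A / w) k * (- (s * Z)) ^ k * q ^ tri k / qfin q k
     * qinf (s * A * q ^ k) * qinf (A * Z * q ^ k)) \<le> b k" for k
    proof -
      have low: "c * sqrt (norm A) * sqrt (norm w) * t ^ k \<le> norm (qinf (A * w * q ^ k))"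
        using c(2)[OF w, of k] by (simp add: t_def norm_mult real_sqrt_mult mult_ac)
      moreover have pos: "0 < c * sqrt (norm A) * sqrt (norm w) * t ^ k"
        using c(1) A0 w1 t by (intro mult_pos_pos) auto
      ultimately have qpos: "norm (qinf (A * w * q ^ k)) > 0" by linarith
      then have "norm (qfin (A * w) k) = norm (qinf (A * w)) / norm (qinf (A * w * q ^ k))"
        using qfin_quot[of "A * w" k] by (simp add: norm_divide)
      also have "\<dots> \<le> norm (qinf (A * w)) / (c * sqrt (norm A) * sqrt (norm w) * t ^ k)"
        using low mult_pos_pos[OF qpos pos] by (intro divide_left_mono) auto
      finally have f1: "norm (qfin (A * w) k) \<le> norm (qinf (A * w)) / (c * sqrt (norm A) * sqrt (norm w) * t ^ k)" .
      have "norm (A / w) \<le> norm A" using w1 by (simp add: norm_divide divide_le_eq mult_le_cancel_left1)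
      then have f2: "norm (qfin (A / w) k) \<le> emaj (norm A)"
        using norm_qfin_le[of "A / w" k] emaj_mono by (meson order_trans)
      have "norm (qfin (A * w) k * qfin (A / w) k * (- (s * Z)) ^ k * q ^ tri k / qfin q k
     * qinf (s * A * q ^ k) * qinf (A * Z * q ^ k))
       = norm (qfin (A * w) k) * norm (qfin (A / w) k) * norm (inverse (qfin q k)) * norm (qinf (s * A * q ^ k)) * norm (qinf (A * Z * q ^ k))
         * (norm q ^ tri k * norm (s * Z) ^ k)"
        by (simp add: norm_mult norm_divide norm_power norm_inverse field_simps)
      also have "\<dots> \<le> norm (qinf (A * w)) / (c * sqrt (norm A) * sqrt (norm w) * t ^ k) * emaj (norm A) * C * emaj (norm (s * A)) * emaj (norm (A * Z))
         * (norm q ^ tri k * norm (s * Z) ^ k)"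
        by (intro mult_right_mono mult_mono f1 f2 C norm_qinf_qpow_le)
           (use c(1) A0 w1 t C(1) in \<open>auto intro!: mult_nonneg_nonneg divide_nonneg_nonneg less_imp_le[OF emaj_pos]\<close>)
      also have "\<dots> = b k" unfolding b_def K0_def Y_def by (simp add: power_divide mult_ac)
      finally show ?thesis .
    qed
    have bs: "summable b" unfolding b_def by (intro summable_mult Y)
    have "summable (\<lambda>k. norm (qfin (A * w) k * qfin (A / w) k * (- (s * Z)) ^ k * q ^ tri k / qfin q k
     * qinf (s * A * q ^ k) * qinf (A * Z * q ^ k)))"
      by (rule summable_comparison_test'[OF bs, where N = 0]) (use tb in simp)
    then have "norm (ghat A Z w) \<le> (\<Sum>k. norm (qfin (A * w) k * qfin (A / w) k * (- (s * Z)) ^ k * q ^ tri k / qfin q k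
     * qinf (s * A * q ^ k) * qinf (A * Z * q ^ k)))"
      unfolding ghat_def by (rule summable_norm)
    also have "\<dots> \<le> suminf b"
      by (intro suminf_le tb bs summable_comparison_test'[OF bs, where N = 0]) (use tb in simp)
    also have "\<dots> = (K0 * suminf Y) * norm (qinf (A * w)) / sqrt (norm w)"
      unfolding b_def suminf_mult[OF Y] by simp
    finally show ?thesis .
  qed
  moreover have "K0 * suminf Y \<ge> 0"
    using Y K0 t by (intro mult_nonneg_nonneg suminf_nonneg) (auto simp: Y_def)
  ultimately show ?thesis by blast
qed

text \<open>After the division, (A w)_k and (A / w)_k become reciprocals of tails. With t = sqrt |q|
  the tail of (A w) costs t^(-k), while \<open>clausen_term\<close> decays like t^(2 k); a geometric
  series in t remains.\<close>

lemma clausen_part_decay: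
  assumes A: "norm q < norm A" "norm A < 1" and Z: "norm Z < 1" and nz: "qinf (q * A / Z) \<noteq> 0"
  shows "\<exists>K. \<forall>n w. norm w = 1 / norm q ^ n \<longrightarrow>
    norm (clausen_part A Z w / (qinf (A * w) * qinf (A / w) * (qinf (Z * w) * qinf (Z / w)))) \<le> K / sqrt (norm w)"
proof -
  obtain c where c: "c > 0" "\<And>n k w. norm w = 1 / norm q ^ n \<Longrightarrow> c * sqrt (norm (A * w)) * sqrt (norm q) ^ k \<le> norm (qinf (A * w * q ^ k))"
    using qinf_lower_circle[OF A] by blast
  obtain c' where c': "c' > 0" "\<And>x. norm x \<le> norm A \<Longrightarrow> c' \<le> norm (qinf x)"
    using qinf_lower_disc[OF A(2)] by blast
  obtain C where C: "C \<ge> 0" "\<And>k. norm (clausen_term A Z k) \<le> C * norm q ^ k"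
    using clausen_term_bound[OF qinf_sq_nz[OF A(2)] nz] by blast
  define t where "t = sqrt (norm q)"
  have t: "t > 0" "t < 1" using q_nz q_lt1 by (auto simp: t_def)
  have tt: "norm q = t * t" by (simp add: t_def)
  have A0: "norm A > 0" using A(1) by (meson norm_ge_zero order_le_less_trans)
  define K where "K = C / (c * sqrt (norm A) * c') * (\<Sum>k. t ^ k)"
  have K0: "K \<ge> 0" unfolding K_def using C(1) c(1) c'(1) A0 t
    by (intro mult_nonneg_nonneg divide_nonneg_nonneg suminf_nonneg summable_geometric) auto
  have "norm (clausen_part A Z w / (qinf (A * w) * qinf (A / w) * (qinf (Z * w) * qinf (Z / w)))) \<le> K / sqrt (norm w)"
    if w: "norm w = 1 / norm q ^ n" for n w
  proof -
    have w1: "norm w \<ge> 1" unfolding w using q_lt1 q_nz by (simp add: power_le_one)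
    define b where "b k = C / (c * sqrt (norm A) * c') / sqrt (norm w) * t ^ k" for k
    have Aw: "norm (A / w) \<le> norm A" using w1 by (simp add: norm_divide divide_le_eq mult_le_cancel_left1)
    have low: "c * sqrt (norm A) * sqrt (norm w) * t ^ k \<le> norm (qinf (A * w * q ^ k))" for k
      using c(2)[OF w, of k] by (simp add: t_def norm_mult real_sqrt_mult mult_ac)
    have pos: "0 < c * sqrt (norm A) * sqrt (norm w) * t ^ k" for k
      using c(1) A0 w1 t by (intro mult_pos_pos) auto
    have n1: "qinf (A * w * q ^ k) \<noteq> 0" for k using low[of k] pos[of k] by auto
    have low': "c' \<le> norm (qinf (A / w * q ^ k))" for k
      using order_trans[OF norm_mult_qpow_le Aw] by (rule c'(2))
    have n2: "qinf (A / w * q ^ k) \<noteq> 0" for k using low'[of k] c'(1) by auto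
    have n3: "qinf (A * w) \<noteq> 0" "qinf (A / w) \<noteq> 0" using n1[of 0] n2[of 0] by auto
    have tb: "norm (qfin (A * w) k * qfin (A / w) k * clausen_term A Z k / (qinf (A * w) * qinf (A / w))) \<le> b k" for k
    proof -
      have "qfin (A * w) k * qfin (A / w) k * clausen_term A Z k / (qinf (A * w) * qinf (A / w))
        = clausen_term A Z k / (qinf (A * w * q ^ k) * qinf (A / w * q ^ k))"
        using n3 unfolding qfin_quot[OF n1] qfin_quot[OF n2] by simp
      then have "norm (qfin (A * w) k * qfin (A / w) k * clausen_term A Z k / (qinf (A * w) * qinf (A / w)))
        = norm (clausen_term A Z k) / (norm (qinf (A * w * q ^ k)) * norm (qinf (A / w * q ^ k)))"
        by (simp add: norm_divide norm_mult)
      also have "\<dots> \<le> C * norm q ^ k / (c * sqrt (norm A) * sqrt (norm w) * t ^ k * c')"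
        by (intro frac_le mult_mono low low' C mult_pos_pos pos c') (use pos[of k] C c' in \<open>auto simp: less_imp_le\<close>)
      also have "\<dots> = b k" unfolding b_def tt using t by (simp add: power_mult_distrib field_simps)
      finally show ?thesis .
    qed
    have bs: "summable b" unfolding b_def using t by (intro summable_mult summable_geometric) auto
    have sn: "summable (\<lambda>k. norm (qfin (A * w) k * qfin (A / w) k * clausen_term A Z k / (qinf (A * w) * qinf (A / w))))"
      by (rule summable_comparison_test'[OF bs, where N = 0]) (use tb in simp)
    have "summable (\<lambda>k. qfin (A * w) k * qfin (A / w) k * clausen_term A Z k / (qinf (A * w) * qinf (A / w)))"
      using sn by (rule summable_norm_cancel)
    then have "summable (\<lambda>k. qinf (A * w) * qinf (A / w) * (qfin (A * w) k * qfin (A / w) k * clausen_term A Z k / (qinf (A * w) * qinf (A / w))))"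
      by (rule summable_mult)
    then have sm: "summable (\<lambda>k. qfin (A * w) k * qfin (A / w) k * clausen_term A Z k)"
      using n3 by simp
    have "norm ((\<Sum>k. qfin (A * w) k * qfin (A / w) k * clausen_term A Z k) / (qinf (A * w) * qinf (A / w)))
       = norm (\<Sum>k. qfin (A * w) k * qfin (A / w) k * clausen_term A Z k / (qinf (A * w) * qinf (A / w)))"
      by (simp only: suminf_divide[OF sm])
    also have "\<dots> \<le> (\<Sum>k. norm (qfin (A * w) k * qfin (A / w) k * clausen_term A Z k / (qinf (A * w) * qinf (A / w))))"
      using sn by (rule summable_norm)
    also have "\<dots> \<le> suminf b" by (intro suminf_le tb bs sn)
    also have "\<dots> = K / sqrt (norm w)"
      unfolding b_def K_def using t by (subst suminf_mult) (auto intro!: summable_geometric)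
    finally have *: "norm ((\<Sum>k. qfin (A * w) k * qfin (A / w) k * clausen_term A Z k) / (qinf (A * w) * qinf (A / w))) \<le> K / sqrt (norm w)" .
    \<comment> \<open>Where (Z w)(Z / w) vanishes, the quotient is 0 by the convention for
      division.\<close>
    have "clausen_part A Z w / (qinf (A * w) * qinf (A / w) * (qinf (Z * w) * qinf (Z / w)))
        = (if qinf (Z * w) * qinf (Z / w) = 0 then 0 else (\<Sum>k. qfin (A * w) k * qfin (A / w) k * clausen_term A Z k) / (qinf (A * w) * qinf (A / w)))"
      by (auto simp: clausen_part_def)
    then show ?thesis using * K0 w1 by auto
  qed
  then show ?thesis by blast
qed

text \<open>By symmetry the square of \<open>ghat A Z w\<close> is its product with
  \<open>ghat Z A w\<close>, and the bounds for the two supply exactly the factors (A w) and (Z w)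
  of the divisor. The other two, (A / w) and (Z / w), have small arguments on these circles and are
  bounded below.\<close>

lemma clausen_defect_decay:
  assumes A: "norm q < norm A" "norm A < 1" and Z: "norm q < norm Z" "norm Z < 1"
    and nz: "qinf (q * A / Z) \<noteq> 0" "qinf (q * Z / A) \<noteq> 0"
  shows "\<exists>K. \<forall>n w. norm w = 1 / norm q ^ n \<longrightarrow>
    norm (clausen_defect A Z w / (qinf (A * w) * qinf (A / w) * (qinf (Z * w) * qinf (Z / w)))) \<le> K / sqrt (norm w)"
proof -
  obtain K1 where K1: "K1 \<ge> 0" "\<And>n w. norm w = 1 / norm q ^ n \<Longrightarrow> norm (ghat A Z w) \<le> K1 * norm (qinf (A * w)) / sqrt (norm w)"
    using ghat_decay[OF A] by blast
  obtain K2 where K2: "K2 \<ge> 0" "\<And>n w. norm w = 1 / norm q ^ n \<Longrightarrow> norm (ghat Z A w) \<le> K2 * norm (qinf (Z * w)) / sqrt (norm w)"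
    using ghat_decay[OF Z] by blast
  obtain K3 where K3: "\<And>n w. norm w = 1 / norm q ^ n \<Longrightarrow>
    norm (clausen_part A Z w / (qinf (A * w) * qinf (A / w) * (qinf (Z * w) * qinf (Z / w)))) \<le> K3 / sqrt (norm w)"
    using clausen_part_decay[OF A Z(2) nz(1)] by blast
  obtain K4 where K4: "\<And>n w. norm w = 1 / norm q ^ n \<Longrightarrow>
    norm (clausen_part Z A w / (qinf (Z * w) * qinf (Z / w) * (qinf (A * w) * qinf (A / w)))) \<le> K4 / sqrt (norm w)"
    using clausen_part_decay[OF Z A(2) nz(2)] by blast
  obtain c1 where c1: "c1 > 0" "\<And>x. norm x \<le> norm A \<Longrightarrow> c1 \<le> norm (qinf x)"
    using qinf_lower_disc[OF A(2)] by blast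
  obtain c2 where c2: "c2 > 0" "\<And>x. norm x \<le> norm Z \<Longrightarrow> c2 \<le> norm (qinf x)"
    using qinf_lower_disc[OF Z(2)] by blast
  obtain d1 where d1: "d1 > 0" "\<And>n k w. norm w = 1 / norm q ^ n \<Longrightarrow> d1 * sqrt (norm (A * w)) * sqrt (norm q) ^ k \<le> norm (qinf (A * w * q ^ k))"
    using qinf_lower_circle[OF A] by blast
  obtain d2 where d2: "d2 > 0" "\<And>n k w. norm w = 1 / norm q ^ n \<Longrightarrow> d2 * sqrt (norm (Z * w)) * sqrt (norm q) ^ k \<le> norm (qinf (Z * w * q ^ k))"
    using qinf_lower_circle[OF Z] by blast
  have A0: "norm A > 0" "norm Z > 0" using A(1) Z(1) by (meson norm_ge_zero order_le_less_trans)+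
  have "norm (clausen_defect A Z w / (qinf (A * w) * qinf (A / w) * (qinf (Z * w) * qinf (Z / w)))) \<le> (K1 * K2 / (c1 * c2) + K3 + K4) / sqrt (norm w)"
    if w: "norm w = 1 / norm q ^ n" for n w
  proof -
    have w1: "norm w \<ge> 1" unfolding w using q_lt1 q_nz by (simp add: power_le_one)
    then have w0: "w \<noteq> 0" by auto
    have Aw: "norm (A / w) \<le> norm A" and Zw: "norm (Z / w) \<le> norm Z"
      using w1 by (simp_all add: norm_divide divide_le_eq mult_le_cancel_left1)
    have "d1 * sqrt (norm (A * w)) > 0" "d2 * sqrt (norm (Z * w)) > 0" using d1 d2 A0 w0 by auto
    then have n: "norm (qinf (A * w)) > 0" "norm (qinf (Z * w)) > 0"
      using d1(2)[OF w, of 0] d2(2)[OF w, of 0] by auto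
    let ?D = "qinf (A * w) * qinf (A / w) * (qinf (Z * w) * qinf (Z / w))"
    have "norm (ghat A Z w) ^ 2 = norm (ghat A Z w) * norm (ghat Z A w)"
      using ghat_swap[of A Z w] A0 w0 A Z by (simp add: power2_eq_square)
    also have "\<dots> \<le> (K1 * norm (qinf (A * w)) / sqrt (norm w)) * (K2 * norm (qinf (Z * w)) / sqrt (norm w))"
      by (intro mult_mono K1(2)[OF w] K2(2)[OF w]) (use K1(1) in auto)
    also have "\<dots> = K1 * K2 * (norm (qinf (A * w)) * norm (qinf (Z * w))) / norm w"
      using w1 by (simp add: mult_ac)
    finally have g2: "norm (ghat A Z w) ^ 2 \<le> K1 * K2 * (norm (qinf (A * w)) * norm (qinf (Z * w))) / norm w" .
    have "norm (ghat A Z w ^ 2 / ?D) = norm (ghat A Z w) ^ 2 / ((norm (qinf (A * w)) * norm (qinf (Z * w))) * (norm (qinf (A / w)) * norm (qinf (Z / w))))"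
      by (simp add: norm_divide norm_mult norm_power mult_ac)
    also have "\<dots> \<le> (K1 * K2 * (norm (qinf (A * w)) * norm (qinf (Z * w))) / norm w) / ((norm (qinf (A * w)) * norm (qinf (Z * w))) * (c1 * c2))"
      by (intro frac_le g2 mult_left_mono mult_mono c1(2)[OF Aw] c2(2)[OF Zw] mult_pos_pos n c1(1) c2(1))
         (use K1 K2 w1 c1(1) c2(1) in \<open>auto intro!: divide_nonneg_nonneg mult_nonneg_nonneg\<close>)
    also have "\<dots> = K1 * K2 / (c1 * c2) / norm w" using n by (simp add: field_simps)
    also have "\<dots> \<le> K1 * K2 / (c1 * c2) / sqrt (norm w)"
    proof (intro divide_left_mono)
      have "sqrt (norm w) * 1 \<le> sqrt (norm w) * sqrt (norm w)" using w1 by (intro mult_left_mono) auto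
      then show "sqrt (norm w) \<le> norm w" by simp
    qed (use K1 K2 c1 c2 w0 in \<open>auto intro!: mult_pos_pos divide_nonneg_nonneg mult_nonneg_nonneg\<close>)
    finally have g: "norm (ghat A Z w ^ 2 / ?D) \<le> K1 * K2 / (c1 * c2) / sqrt (norm w)" .
    have p1: "norm (clausen_part A Z w / ?D) \<le> K3 / sqrt (norm w)" by (rule K3[OF w])
    have p2: "norm (clausen_part Z A w / ?D) \<le> K4 / sqrt (norm w)" using K4[OF w] by (simp add: mult_ac)
    have "clausen_defect A Z w / ?D = ghat A Z w ^ 2 / ?D - clausen_part A Z w / ?D - clausen_part Z A w / ?D"
      by (simp only: clausen_defect_def diff_divide_distrib)
    then have e: "norm (clausen_defect A Z w / ?D) = norm (ghat A Z w ^ 2 / ?D - clausen_part A Z w / ?D - clausen_part Z A w / ?D)"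
      by (rule arg_cong)
    have "norm (clausen_defect A Z w / ?D) \<le> norm (ghat A Z w ^ 2 / ?D) + norm (clausen_part A Z w / ?D) + norm (clausen_part Z A w / ?D)"
      unfolding e using norm_triangle_ineq4[of "ghat A Z w ^ 2 / ?D - clausen_part A Z w / ?D" "clausen_part Z A w / ?D"]
        norm_triangle_ineq4[of "ghat A Z w ^ 2 / ?D" "clausen_part A Z w / ?D"] by linarith
    also have "\<dots> \<le> (K1 * K2 / (c1 * c2) + K3 + K4) / sqrt (norm w)"
      using g p1 p2 by (simp add: add_divide_distrib)
    finally show ?thesis .
  qed
  then show ?thesis by blast
qed

text \<open>As |A| and |Z| are below 1 and Z / A is no power of q, only one of the four factors
  vanishes at p, and only to first order. A zero of E then removes the pole.\<close>

lemma defect_quotient_limit: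
  assumes A: "A \<noteq> 0" "norm A < 1" and Z: "norm Z < 1" and gen: "\<And>k::int. Z / A \<noteq> q powi k"
    and p: "p \<noteq> 0" "p \<noteq> B" "A * p * q ^ n = 1 \<or> p = A * q ^ n"
    and E: "(E \<longlongrightarrow> 0) (at p)"
  shows "((\<lambda>w. E w / (qinf (A * w) * qinf (A / w) * (qinf (Z * w) * qinf (Z / w)) * (w - B)) * (w - p)) \<longlongrightarrow> 0) (at p)"
proof -
  have AA: "norm (A * A * q ^ n) < 1"
    using A(2) by (intro norm_mult_qpow_lt1) (metis norm_mult norm_power power2_eq_square power_less_one_iff zero_less_numeral norm_ge_zero)
  have ZA: "norm (Z * A * q ^ n) < 1"
  proof (intro norm_mult_qpow_lt1)
    have "norm Z * norm A \<le> 1 * norm A" using Z by (intro mult_right_mono) auto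
    then show "norm (Z * A) < 1" using A(2) by (simp add: norm_mult)
  qed
  from p(3) show ?thesis
  proof
    assume p1: "A * p * q ^ n = 1"
    have e: "A / p = A * A * q ^ n" "Z / p = Z * A * q ^ n" using p1 p by (simp_all add: field_simps)
    have "Z * p \<noteq> q powi k" for k
    proof
      assume "Z * p = q powi k"
      moreover have "Z * (A * p * q ^ n) = A * (Z * p) * q ^ n" by simp
      ultimately have "Z / A = q powi (k + int n)" using p1 A q_nz by (simp add: power_int_add)
      then show False using gen by simp
    qed
    then have nz: "qinf (A / p) * (qinf (Z * p) * qinf (Z / p)) * (p - B) \<noteq> 0"
      unfolding e using qinf_neq_0[OF AA] qinf_neq_0[OF ZA] qfin_nz_powi(3)[of "Z * p"] p by simp
    have "((\<lambda>w. E w / (qinf (A / w) * (qinf (Z * w) * qinf (Z / w)) * (w - B)) * ((w - p) / qinf (A * w))) \<longlongrightarrow>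
       0 / (qinf (A / p) * (qinf (Z * p) * qinf (Z / p)) * (p - B)) * (- p / qrem n (A * p))) (at p)"
      by (intro tendsto_mult tendsto_divide E simple_zero_limit p1 nz tendsto_intros p(1))
    then show ?thesis by (simp add: mult_ac)
  next
    assume p2: "p = A * q ^ n"
    have e: "A * p = A * A * q ^ n" "Z * p = Z * A * q ^ n" using p2 by simp_all
    have "Z / p \<noteq> q powi k" for k
    proof
      assume "Z / p = q powi k"
      then have "Z / A = q powi (k + int n)" using p2 A q_nz by (simp add: power_int_add field_simps)
      then show False using gen by simp
    qed
    then have nz: "qinf (A * p) * (qinf (Z * p) * qinf (Z / p)) * (p - B) \<noteq> 0"
      unfolding e using qinf_neq_0[OF AA] qinf_neq_0[OF ZA] qfin_nz_powi(3)[of "Z / p"] p by simp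
    have "((\<lambda>w. E w / (qinf (A * w) * (qinf (Z * w) * qinf (Z / w)) * (w - B)) * ((w - p) / qinf (A / w))) \<longlongrightarrow>
       0 / (qinf (A * p) * (qinf (Z * p) * qinf (Z / p)) * (p - B)) * (p / qrem n (A / p))) (at p)"
      by (intro tendsto_mult tendsto_divide E simple_zero_limit'[OF p2 p(1)] nz tendsto_intros p(1))
    then show ?thesis by (simp add: mult_ac)
  qed
qed

text \<open>The nonterminating q-Clausen formula of Gasper and Rahman: the difference of the two sides,
  divided by \<open>(A w, A / w, Z w, Z / w)\<^sub>\<infinity>\<close>, is holomorphic on the punctured plane by the
  terminating case and tends to zero along circles, so it vanishes.\<close>

theorem nonterminating_clausen:
  assumes A: "norm q < norm A" "norm A < 1" and Z: "norm q < norm Z" "norm Z < 1"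
    and gen: "\<And>k::int. Z / A \<noteq> q powi k" and B: "B \<noteq> 0"
  shows "ghat A Z B ^ 2 = clausen_part A Z B + clausen_part Z A B"
proof -
  have A0: "A \<noteq> 0" and Z0: "Z \<noteq> 0" using A(1) Z(1) by (auto simp: not_less[symmetric])
  have gen': "A / Z \<noteq> q powi k" for k :: int
  proof
    assume "A / Z = q powi k"
    then have "Z / A = q powi (- k)" by (simp add: power_int_minus) (metis inverse_divide inverse_eq_divide)
    then show False using gen by blast
  qed
  have nz: "qinf (q * A / Z) \<noteq> 0" "qinf (q * Z / A) \<noteq> 0"
  proof -
    have "q * A / Z \<noteq> q powi k" for k
      using gen'[of "k - 1"] q_nz by (auto simp: power_int_diff field_simps)
    then show "qinf (q * A / Z) \<noteq> 0" by (rule qfin_nz_powi(3))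
    have "q * Z / A \<noteq> q powi k" for k
      using gen[of "k - 1"] q_nz by (auto simp: power_int_diff field_simps)
    then show "qinf (q * Z / A) \<noteq> 0" by (rule qfin_nz_powi(3))
  qed
  define E where "E = clausen_defect A Z"
  define D where "D w = qinf (A * w) * qinf (A / w) * (qinf (Z * w) * qinf (Z / w))" for w
  have E_inv: "E (1 / w) = E w" for w unfolding E_def by (rule clausen_defect_inv)
  have D_inv: "D (1 / w) = D w" for w by (simp add: D_def mult_ac)
  have E_swap: "clausen_defect Z A w = E w" if "w \<noteq> 0" for w
    unfolding E_def clausen_defect_def using ghat_swap[OF A0 Z0 that A(2) Z(2)] by simp
  \<comment> \<open>The zeros at p = A q^n are obtained from those at p = 1 / (A q^n) by
    inversion.\<close>
  have zeroA: "E p = 0" if "p \<noteq> 0" "A * p * q ^ n = 1 \<or> p = A * q ^ n" for p n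
  proof (cases "A * p * q ^ n = 1")
    case True
    then show ?thesis unfolding E_def by (rule clausen_defect_zero[OF A0 A(2) Z0 gen])
  next
    case False
    then have "A * (1 / p) * q ^ n = 1" using that by simp
    then have "E (1 / p) = 0" unfolding E_def by (rule clausen_defect_zero[OF A0 A(2) Z0 gen])
    then show ?thesis by (simp only: E_inv)
  qed
  have zeroZ: "E p = 0" if "p \<noteq> 0" "Z * p * q ^ n = 1 \<or> p = Z * q ^ n" for p n
  proof (cases "Z * p * q ^ n = 1")
    case True
    then have "clausen_defect Z A p = 0" by (rule clausen_defect_zero[OF Z0 Z(2) A0 gen'])
    then show ?thesis using E_swap that by simp
  next
    case False
    then have "Z * (1 / p) * q ^ n = 1" using that by simp
    then have "clausen_defect Z A (1 / p) = 0" by (rule clausen_defect_zero[OF Z0 Z(2) A0 gen'])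
    then show ?thesis using E_swap[of "1 / p"] E_inv[of p] that by simp
  qed
  have D0: "(\<exists>n. A * w * q ^ n = 1 \<or> w = A * q ^ n) \<or> (\<exists>n. Z * w * q ^ n = 1 \<or> w = Z * q ^ n)"
    if "w \<noteq> 0" "D w = 0" for w
    using that unfolding D_def by (auto simp: qinf_eq_0_iff field_simps)
  have hE: "E holomorphic_on - {0}"
    unfolding E_def clausen_defect_def
    by (intro holomorphic_intros ghat_holomorphic_B clausen_part_holomorphic qinf_sq_nz A Z nz)
  have hD: "D holomorphic_on - {0}" unfolding D_def by (intro holomorphic_intros) auto
  have cE: "(E \<longlongrightarrow> E p) (at p)" and cD: "(D \<longlongrightarrow> D p) (at p)" if "p \<noteq> 0" for p
  proof -
    have "continuous_on (- {0}) E" "continuous_on (- {0}) D"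
      using hE hD by (auto intro: holomorphic_on_imp_continuous_on)
    then have "isCont E p" "isCont D p"
      using that by (auto simp: continuous_on_eq_continuous_at open_Compl)
    then show "(E \<longlongrightarrow> E p) (at p)" "(D \<longlongrightarrow> D p) (at p)" by (auto simp: isCont_def)
  qed
  have "E B = 0"
  proof (cases "D B = 0")
    case True
    then show ?thesis using D0[OF B] zeroA[OF B] zeroZ[OF B] by blast
  next
    case DB: False
    obtain K where K: "\<And>n w. norm w = 1 / norm q ^ n \<Longrightarrow> norm (E w / D w) \<le> K / sqrt (norm w)"
      using clausen_defect_decay[OF A Z nz] unfolding E_def D_def by blast
    define t where "t = sqrt (norm q)"
    have t: "0 < t" "t < 1" "t ^ n = sqrt (norm q ^ n)" for n
      using q_nz q_lt1 by (auto simp: t_def real_sqrt_power)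
    have q0: "norm q > 0" using q_nz by simp
    have "(\<lambda>m. norm q ^ m) \<longlonglongrightarrow> 0" using q_lt1 by (intro LIMSEQ_power_zero) auto
    moreover have "0 < min (norm B / 2) (1 / (2 * norm B))" using B by simp
    ultimately have "eventually (\<lambda>m. norm q ^ m < min (norm B / 2) (1 / (2 * norm B))) sequentially"
      by (rule order_tendstoD)
    \<comment> \<open>m discards the first circles, so that the inner radii are below |B| / 2 and
      the outer ones above 2 |B|; this yields |w| <= 2 |w - B| on all of them.\<close>
    then obtain m where m: "norm q ^ m < norm B / 2" "norm q ^ m < 1 / (2 * norm B)"
      by (auto simp: eventually_sequentially)
    have qle: "norm q ^ (n + m) \<le> norm q ^ m" for n using q_lt1 by (intro power_decreasing) auto
    have Bsmall: "norm q ^ (n + m) < norm B / 2" for n using qle[of n] m(1) by linarith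
    have Bbig: "2 * norm B < 1 / norm q ^ (n + m)" for n
    proof -
      have "norm q ^ (n + m) * (2 * norm B) < 1 / (2 * norm B) * (2 * norm B)"
        using qle[of n] m(2) B by (intro mult_strict_right_mono) auto
      then show ?thesis using B q0 by (simp add: field_simps)
    qed
    \<comment> \<open>|A| and |Z| lie strictly between |q| and 1, so no zero of D has a power of |q|
      as its modulus.\<close>
    have Dout: "D w \<noteq> 0" if "norm w = 1 / norm q ^ n" for w n
    proof
      assume "D w = 0"
      moreover have "w \<noteq> 0" using that q0 by auto
      ultimately consider k where "A * w * q ^ k = 1" | k where "w = A * q ^ k" | k where "Z * w * q ^ k = 1" | k where "w = Z * q ^ k"
        using D0 by blast
      moreover have no: "X * w * q ^ k \<noteq> 1" "w \<noteq> X * q ^ k" if X: "norm q < norm X" "norm X < 1" for X k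
      proof
        assume e: "X * w * q ^ k = 1"
        then have "X = q ^ n / (q ^ k) * (1 / (w * q ^ n))" using q_nz \<open>w \<noteq> 0\<close> by (simp add: field_simps)
        then have "norm X = norm q ^ n / norm q ^ k" using that \<open>norm w = 1 / norm q ^ n\<close> q0 by (simp add: norm_mult norm_divide norm_power)
        also have "\<dots> = norm (q powi (int n - int k))" using q_nz by (simp add: power_int_diff norm_divide norm_power)
        finally have "norm (q powi (int n - int k)) = norm X" by simp
        moreover have "1 < 1 / norm q" using q0 q_lt1 by simp
        ultimately have "q powi (int n - int k) = 1" using X by (intro qpowi_near_1[OF refl]) auto
        then show False using \<open>norm (q powi (int n - int k)) = norm X\<close> X by simp
      next
        have "norm (X * q ^ k) < 1" using X by (intro norm_mult_qpow_lt1)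
        moreover have "norm w \<ge> 1" using \<open>norm w = 1 / norm q ^ n\<close> q0 q_lt1 by (simp add: power_le_one)
        ultimately show "w \<noteq> X * q ^ k" by auto
      qed
      ultimately show False using no[OF A] no[OF Z] by metis
    qed
    \<comment> \<open>The pole of F at w = B isolates the value to be determined: all other residues
      vanish, and the one at B is \<open>E B / D B\<close>.\<close>
    define P where "P = insert B {w. w \<noteq> 0 \<and> D w = 0}"
    define F where "F w = E w / (D w * (w - B))" for w
    define c where "c p = (if p = B then E B / D B else 0)" for p
    have inner: "norm (1 / w) = 1 / norm q ^ (n + m)" if "norm w = norm q ^ (n + m)" for w :: complex and n
      using that by (simp add: norm_divide)
    have "infsum c P = 0"
    proof (rule residue_sum_zero[where F = F and rr = "\<lambda>n. norm q ^ (n + m)" and RR = "\<lambda>n. 1 / norm q ^ (n + m)" and M = "\<lambda>n. 2 * \<bar>K\<bar> * t ^ (n + m)"])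
      show "F holomorphic_on - {0} - P"
        unfolding F_def by (intro holomorphic_intros holomorphic_on_subset[OF hE] holomorphic_on_subset[OF hD]) (auto simp: P_def)
      show "0 \<notin> P" using B by (auto simp: P_def)
      show "finite {p \<in> P. r \<le> norm p \<and> norm p \<le> R}" if r: "0 < r" for r R
      proof -
        have "{p \<in> P. r \<le> norm p \<and> norm p \<le> R} \<subseteq> insert B
          ({p \<in> range (\<lambda>n. 1 / A / q ^ n). norm p \<le> R} \<union> {p \<in> range (\<lambda>n. A * q ^ n). r \<le> norm p}
           \<union> ({p \<in> range (\<lambda>n. 1 / Z / q ^ n). norm p \<le> R} \<union> {p \<in> range (\<lambda>n. Z * q ^ n). r \<le> norm p}))"
        proof
          fix p assume p: "p \<in> {p \<in> P. r \<le> norm p \<and> norm p \<le> R}"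
          have u: "p = 1 / X / q ^ k" if "X * p * q ^ k = 1" for X k
          proof -
            have "X \<noteq> 0" using that by auto
            then show ?thesis using that q_nz by (simp add: field_simps)
          qed
          show "p \<in> insert B
          ({p \<in> range (\<lambda>n. 1 / A / q ^ n). norm p \<le> R} \<union> {p \<in> range (\<lambda>n. A * q ^ n). r \<le> norm p}
           \<union> ({p \<in> range (\<lambda>n. 1 / Z / q ^ n). norm p \<le> R} \<union> {p \<in> range (\<lambda>n. Z * q ^ n). r \<le> norm p}))"
          proof (cases "p = B")
            case False
            then have "p \<noteq> 0" "D p = 0" using p by (auto simp: P_def)
            from D0[OF this] show ?thesis using p by (blast intro: u)
          qed simp
        qed
        then show ?thesis
          by (rule finite_subset) (intro finite.insertI finite_UnI finite_geometric_above finite_geometric_below r, use A0 Z0 in auto)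
      qed
      show "((\<lambda>w. F w * (w - p)) \<longlongrightarrow> c p) (at p)" if "p \<in> P" for p
      proof (cases "p = B")
        case True
        have "((\<lambda>w. E w / D w) \<longlongrightarrow> E B / D B) (at B)" using B DB by (intro tendsto_intros cE cD)
        then have "((\<lambda>w. F w * (w - B)) \<longlongrightarrow> E B / D B) (at B)"
          by (rule Lim_transform_eventually) (auto simp: F_def eventually_at_filter)
        then show ?thesis using True by (simp add: c_def)
      next
        case False
        then have p: "p \<noteq> 0" "D p = 0" using that by (auto simp: P_def)
        from D0[OF this] have "((\<lambda>w. F w * (w - p)) \<longlongrightarrow> 0) (at p)"
        proof (elim disjE exE)
          fix n assume "A * p * q ^ n = 1"
          then have h: "A * p * q ^ n = 1 \<or> p = A * q ^ n" by simp
          then have E0: "(E \<longlongrightarrow> 0) (at p)" using cE[OF p(1)] zeroA[OF p(1)] by metis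
          show ?thesis
            unfolding F_def D_def by (rule defect_quotient_limit[OF A0 A(2) Z(2) gen p(1) False h E0])
        next
          fix n assume "p = A * q ^ n"
          then have h: "A * p * q ^ n = 1 \<or> p = A * q ^ n" by simp
          then have E0: "(E \<longlongrightarrow> 0) (at p)" using cE[OF p(1)] zeroA[OF p(1)] by metis
          show ?thesis
            unfolding F_def D_def by (rule defect_quotient_limit[OF A0 A(2) Z(2) gen p(1) False h E0])
        next
          fix n assume "Z * p * q ^ n = 1"
          then have h: "Z * p * q ^ n = 1 \<or> p = Z * q ^ n" by simp
          then have E0: "(E \<longlongrightarrow> 0) (at p)" using cE[OF p(1)] zeroZ[OF p(1)] by metis
          show ?thesis
            using defect_quotient_limit[OF Z0 Z(2) A(2) gen' p(1) False h E0] unfolding F_def D_def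
            by (simp add: mult_ac)
        next
          fix n assume "p = Z * q ^ n"
          then have h: "Z * p * q ^ n = 1 \<or> p = Z * q ^ n" by simp
          then have E0: "(E \<longlongrightarrow> 0) (at p)" using cE[OF p(1)] zeroZ[OF p(1)] by metis
          show ?thesis
            using defect_quotient_limit[OF Z0 Z(2) A(2) gen' p(1) False h E0] unfolding F_def D_def
            by (simp add: mult_ac)
        qed
        then show ?thesis using False by (simp add: c_def)
      qed
      show "0 < norm q ^ (n + m)" for n using q0 by simp
      show "(\<lambda>n. norm q ^ (n + m)) \<longlonglongrightarrow> 0"
        using q_lt1 by (intro LIMSEQ_ignore_initial_segment LIMSEQ_power_zero) auto
      then show "filterlim (\<lambda>n. 1 / norm q ^ (n + m)) at_top sequentially"
        using filterlim_inverse_at_top[of "\<lambda>n. norm q ^ (n + m)" sequentially] q0 by (simp add: inverse_eq_divide)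
      show "norm p \<noteq> norm q ^ (n + m) \<and> norm p \<noteq> 1 / norm q ^ (n + m)" if p: "p \<in> P" for n p
      proof (cases "p = B")
        case True
        have "norm q ^ (n + m) > 0" "1 / norm q ^ (n + m) > 0" using q0 by auto
        then show ?thesis unfolding True using Bsmall[of n] Bbig[of n] by (intro conjI notI; linarith)
      next
        case False
        then have p: "p \<noteq> 0" "D p = 0" using p by (auto simp: P_def)
        then show ?thesis using Dout[of p] Dout[of "1 / p"] inner[of p] D_inv[of p] by metis
      qed
      show "norm (F w) * norm w \<le> 2 * \<bar>K\<bar> * t ^ (n + m)" if w: "norm w = norm q ^ (n + m) \<or> norm w = 1 / norm q ^ (n + m)" for n w
      proof -
        \<comment> \<open>The inner circles are reduced to the outer ones by the invariance of E and
          D under w -> 1 / w.\<close>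
        have "norm (E w / D w) \<le> K * t ^ (n + m)"
          using w
        proof
          assume w: "norm w = norm q ^ (n + m)"
          have "norm (E (1 / w) / D (1 / w)) \<le> K / sqrt (norm (1 / w))" by (rule K[OF inner[OF w]])
          then show ?thesis unfolding E_inv D_inv inner[OF w] t(3) using q0 by (simp add: real_sqrt_divide)
        next
          assume w: "norm w = 1 / norm q ^ (n + m)"
          show ?thesis using K[OF w] unfolding w t(3) using q0 by (simp add: real_sqrt_divide)
        qed
        then have ED: "norm (E w / D w) \<le> \<bar>K\<bar> * t ^ (n + m)"
          by (rule order_trans) (use t(1) in \<open>auto intro!: mult_right_mono\<close>)
        have wB: "norm w \<le> 2 * norm (w - B)"
          using w
        proof
          assume w: "norm w = norm q ^ (n + m)"
          have "norm B - norm w \<le> norm (w - B)" by (metis norm_minus_commute norm_triangle_ineq2)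
          then show ?thesis using Bsmall[of n] w norm_ge_zero[of w] by linarith
        next
          assume w: "norm w = 1 / norm q ^ (n + m)"
          have "norm w - norm B \<le> norm (w - B)" by (rule norm_triangle_ineq2)
          then show ?thesis using Bbig[of n] w norm_ge_zero[of w] norm_ge_zero[of B] by linarith
        qed
        have w0: "norm w > 0" using w q0 by auto
        then have wB0: "norm (w - B) > 0" using wB by linarith
        have "norm (F w) * norm w = norm (E w / D w) * (norm w / norm (w - B))"
          by (simp add: F_def norm_divide norm_mult)
        also have "\<dots> \<le> \<bar>K\<bar> * t ^ (n + m) * 2"
          using wB wB0 t(1) by (intro mult_mono ED) (auto simp: divide_le_eq mult.commute)
        finally show ?thesis by simp
      qed
      show "(\<lambda>n. 2 * \<bar>K\<bar> * t ^ (n + m)) \<longlonglongrightarrow> 0"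
        using t by (intro tendsto_mult_right_zero LIMSEQ_ignore_initial_segment LIMSEQ_power_zero) auto
      have "c summable_on {B}" by simp
      then show "c summable_on P"
        by (subst summable_on_cong_neutral[of "{B}" P c c]) (auto simp: c_def P_def)
    qed
    moreover have "infsum c P = infsum c {B}"
      by (rule infsum_cong_neutral) (auto simp: c_def P_def)
    ultimately show ?thesis using DB by (simp add: c_def)
  qed
  then show ?thesis by (simp add: E_def clausen_defect_def algebra_simps)
qed

end

section \<open>Residues along two geometric progressions\<close>

lemma countable_avoid_above:
  fixes C :: "real set" assumes "countable C" shows "\<exists>r>a. r \<notin> C"
proof -
  have "uncountable {a<..<a+1}" by (simp add: uncountable_open_interval)
  then have "\<not> {a<..<a+1} \<subseteq> C" using assms countable_subset by blast
  then show ?thesis by auto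
qed

lemma countable_avoid_below:
  fixes C :: "real set" assumes "countable C" "a > 0" shows "\<exists>r>0. r < a \<and> r \<notin> C"
proof -
  have "uncountable {0<..<a}" using assms(2) by (simp add: uncountable_open_interval)
  then have "\<not> {0<..<a} \<subseteq> C" using assms countable_subset by blast
  then show ?thesis by auto
qed

lemma has_sum_finite_UN:
  fixes f :: "'b \<Rightarrow> complex"
  assumes "finite I" "\<And>i. i \<in> I \<Longrightarrow> (f has_sum S i) (A i)"
    and "\<And>i j. i \<in> I \<Longrightarrow> j \<in> I \<Longrightarrow> i \<noteq> j \<Longrightarrow> A i \<inter> A j = {}"
  shows "(f has_sum sum S I) (\<Union>i\<in>I. A i)"
  using assms
proof (induction I rule: finite_induct)
  case (insert i I)
  have "(f has_sum S i + sum S I) (A i \<union> (\<Union>i\<in>I. A i))"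
    by (rule has_sum_Un_disjoint) (use insert in auto)
  then show ?case using insert.hyps by simp
qed simp

context qdisc
begin

text \<open>The parameters are multiples of a common variable x, so that the residue series at
  different base points are one function evaluated at different x.\<close>

definition qfins :: "complex list \<Rightarrow> complex \<Rightarrow> nat \<Rightarrow> complex" where
  "qfins L x n = (\<Prod>b\<leftarrow>L. qfin (b * x) n)"

lemma qfins_0 [simp]: "qfins L x 0 = 1"
  by (induction L) (auto simp: qfins_def)

lemma qfins_Suc: "qfins L x (Suc n) = qfins L x n * (\<Prod>b\<leftarrow>L. 1 - b * x * q ^ n)"
  by (induction L) (auto simp: qfins_def qfin_Suc)

lemma qfins_eq_0_iff: "qfins L x n = 0 \<longleftrightarrow> (\<exists>b\<in>set L. qfin (b * x) n = 0)"
  by (induction L) (auto simp: qfins_def)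

lemma qfins_tendsto:
  assumes "(f \<longlongrightarrow> l) F" shows "((\<lambda>w. qfins L (f w) n) \<longlongrightarrow> qfins L l n) F"
proof (induction L)
  case Nil then show ?case by (simp add: qfins_def)
next
  case (Cons b L)
  have "((\<lambda>w. qfin (b * f w) n) \<longlongrightarrow> qfin (b * l) n) F"
    unfolding qfin_def by (intro tendsto_intros assms)
  from tendsto_mult[OF this Cons] show ?case by (simp add: qfins_def)
qed

lemma qfins_upper: "(\<And>b. b \<in> set L \<Longrightarrow> norm (b * x) \<le> R) \<Longrightarrow> norm (qfins L x n) \<le> emaj R ^ length L"
proof (induction L)
  case (Cons b L)
  have "norm (qfin (b * x) n) \<le> emaj R"
    using norm_qfin_le[of "b * x" n] emaj_mono[OF Cons.prems[of b]] by auto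
  then have "norm (qfin (b * x) n) * norm (qfins L x n) \<le> emaj R * emaj R ^ length L"
    using Cons by (intro mult_mono) (auto intro: less_imp_le[OF emaj_pos])
  then show ?case by (simp add: qfins_def norm_mult)
qed (simp add: qfins_def)

text \<open>The bound is uniform in n and x. It controls the denominators of the iterated functional
  equations far out and close to 0.\<close>

lemma qfins_lower:
  "\<exists>c>0. \<forall>x n. (\<forall>b\<in>set L. norm (b * x) \<le> 1 / 2) \<longrightarrow> c \<le> norm (qfins L x n)"
proof (induction L)
  case Nil
  show ?case by (intro exI[of _ 1]) (auto simp: qfins_def)
next
  case (Cons b L)
  then obtain c where c: "c > 0" "\<And>x n. (\<forall>b\<in>set L. norm (b * x) \<le> 1 / 2) \<Longrightarrow> c \<le> norm (qfins L x n)" by blast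
  obtain c' where c': "c' > 0" "\<And>x. norm x \<le> 1 / 2 \<Longrightarrow> c' \<le> norm (qinf x)"
    using qinf_lower_disc[of "1 / 2"] by auto
  have "c' / emaj (1 / 2) * c \<le> norm (qfins (b # L) x n)" if x: "\<forall>b\<in>set (b # L). norm (b * x) \<le> 1 / 2" for x n
  proof -
    have "norm (b * x * q ^ n) \<le> norm (b * x)"
      using q_lt1 by (simp add: norm_mult norm_power mult_left_le power_le_one)
    then have small: "norm (b * x * q ^ n) \<le> 1 / 2" using x by auto
    then have "norm (qinf (b * x * q ^ n)) \<le> emaj (1 / 2)"
      using norm_qinf_le emaj_mono by (meson order_trans)
    moreover have pos: "norm (qinf (b * x * q ^ n)) > 0" using qinf_neq_0[of "b * x * q ^ n"] small by auto
    ultimately have "c' / emaj (1 / 2) \<le> norm (qinf (b * x)) / norm (qinf (b * x * q ^ n))"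
      using c'(2)[of "b * x"] c'(1) x by (intro frac_le) auto
    also have "\<dots> = norm (qfin (b * x) n)" using qfin_quot[of "b * x" n] pos by (simp add: norm_divide)
    finally have "c' / emaj (1 / 2) * c \<le> norm (qfin (b * x) n) * norm (qfins L x n)"
      using c c' x by (intro mult_mono) (auto intro!: divide_nonneg_nonneg less_imp_le[OF emaj_pos])
    then show ?thesis by (simp add: qfins_def norm_mult)
  qed
  moreover have "c' / emaj (1 / 2) * c > 0" using c c' by simp
  ultimately show ?case by blast
qed

lemma qfins_quot_summable:
  assumes "\<And>b. b \<in> set L' \<Longrightarrow> qinf (b * x) \<noteq> 0"
  shows "summable (\<lambda>n. norm (q ^ n * qfins L x n / qfins L' x n))"
proof -
  have "\<exists>C. \<forall>n. norm (inverse (qfins L' x n)) \<le> C" using assms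
  proof (induction L')
    case (Cons b L')
    then obtain C where C: "\<And>n. norm (inverse (qfins L' x n)) \<le> C" by auto
    obtain C' where C': "\<And>n. norm (inverse (qfin (b * x) n)) \<le> C'"
      using qinf_inverse_bounded[of "b * x"] Cons.prems by auto
    have "norm (inverse (qfin (b * x) n)) * norm (inverse (qfins L' x n)) \<le> C' * C" for n
      using C[of n] C'[of n] order_trans[OF norm_ge_zero C'[of 0]] by (intro mult_mono) auto
    then show ?case by (auto simp: qfins_def norm_mult norm_inverse)
  qed (auto simp: qfins_def)
  then obtain C where C: "\<And>n. norm (inverse (qfins L' x n)) \<le> C" by auto
  have "\<exists>R. \<forall>b\<in>set L. norm (b * x) \<le> R"
    by (rule exI[of _ "\<Sum>b\<in>set L. norm (b * x)"]) (auto intro: member_le_sum)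
  then obtain R where R: "\<And>b. b \<in> set L \<Longrightarrow> norm (b * x) \<le> R" by auto
  show ?thesis
  proof (rule summable_comparison_test'[where N = 0 and g = "\<lambda>n. emaj R ^ length L * C * norm q ^ n"])
    show "summable (\<lambda>n. emaj R ^ length L * C * norm q ^ n)"
      using q_lt1 by (intro summable_mult summable_geometric) auto
    fix n :: nat
    have "norm (norm (q ^ n * qfins L x n / qfins L' x n)) = norm (qfins L x n) * norm (inverse (qfins L' x n)) * norm q ^ n"
      by (simp add: norm_mult norm_divide norm_power norm_inverse field_simps)
    also have "\<dots> \<le> emaj R ^ length L * C * norm q ^ n"
      by (intro mult_right_mono mult_mono qfins_upper R C zero_le_power less_imp_le[OF emaj_pos]) auto
    finally show "norm (norm (q ^ n * qfins L x n / qfins L' x n)) \<le> emaj R ^ length L * C * norm q ^ n" .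
  qed
qed

text \<open>Let \<open>H\<close> have simple poles at the points \<open>b q\<^sup>-\<^sup>n\<close> (\<open>b \<in> Ou\<close>) and \<open>c q\<^sup>n\<close> (\<open>c \<in> In\<close>) only. The two
  functional equations say that \<open>H\<close> is, up to a factor regular at infinity (at zero), a quotient \<open>\<Theta>\<close>
  of theta functions with \<open>\<Theta> (w / q) = q \<Theta> w\<close>. They give both the decay of \<open>H\<close> and all residues in
  terms of those at the base points.\<close>

theorem bilateral_residue_sum:
  fixes Ou In :: "complex set" and N H D Ro Ri :: "complex \<Rightarrow> complex" and bs gs cs ds :: "complex list"
  assumes fin: "finite Ou" "finite In" and disj: "Ou \<inter> In = {}" and nz: "0 \<notin> Ou \<union> In"
    and indep: "\<And>x y k. x \<in> Ou \<union> In \<Longrightarrow> y \<in> Ou \<union> In \<Longrightarrow> x \<noteq> y \<Longrightarrow> x \<noteq> y * q powi (k::int)"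
    and N: "N holomorphic_on - {0}"
    and D: "\<And>w. D w = (\<Prod>b\<in>Ou. qinf (w / b)) * (\<Prod>c\<in>In. qinf (c / w))"
    and H: "\<And>w. H w = N w / D w"
    and outer: "\<And>w. w \<noteq> 0 \<Longrightarrow> D w \<noteq> 0 \<Longrightarrow> (\<Prod>b\<leftarrow>bs. 1 - b / w) \<noteq> 0 \<Longrightarrow>
       D (w / q) \<noteq> 0 \<and> H (w / q) * (\<Prod>b\<leftarrow>bs. 1 - b / w) = q * H w * (\<Prod>g\<leftarrow>gs. 1 - g / w)"
    and inner: "\<And>w. w \<noteq> 0 \<Longrightarrow> D w \<noteq> 0 \<Longrightarrow> (\<Prod>b\<leftarrow>cs. 1 - b * w) \<noteq> 0 \<Longrightarrow>
       D (w * q) \<noteq> 0 \<and> H (w * q) * (\<Prod>b\<leftarrow>cs. 1 - b * w) = q * H w * (\<Prod>g\<leftarrow>ds. 1 - g * w)"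
    and Ro: "\<And>b. b \<in> Ou \<Longrightarrow> ((\<lambda>w. H w * ((w - b) / w)) \<longlongrightarrow> Ro b) (at b)"
    and Ri: "\<And>c. c \<in> In \<Longrightarrow> ((\<lambda>w. H w * ((w - c) / w)) \<longlongrightarrow> Ri c) (at c)"
    and bs: "\<And>b x. b \<in> Ou \<Longrightarrow> x \<in> set bs \<Longrightarrow> qinf (x * (1 / b)) \<noteq> 0"
    and cs: "\<And>c x. c \<in> In \<Longrightarrow> x \<in> set cs \<Longrightarrow> qinf (x * c) \<noteq> 0"
  shows "(\<Sum>b\<in>Ou. Ro b * (\<Sum>n. q ^ n * qfins gs (1 / b) n / qfins bs (1 / b) n))
    + (\<Sum>c\<in>In. Ri c * (\<Sum>n. q ^ n * qfins ds c n / qfins cs c n)) = 0"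
proof -
  define fo where "fo b n = b / q ^ n" for b :: complex and n :: nat
  define fi where "fi c n = c * q ^ n" for c :: complex and n :: nat
  define P where "P = (\<Union>b\<in>Ou. range (fo b)) \<union> (\<Union>c\<in>In. range (fi c))"
  have P0: "0 \<notin> P" using nz q_nz by (auto simp: P_def fo_def fi_def)
  have q0: "norm q > 0" using q_nz by simp
  have D0: "D w = 0 \<longleftrightarrow> w \<in> P" if w: "w \<noteq> 0" for w
  proof -
    have "qinf (w / b) = 0 \<longleftrightarrow> w \<in> range (fo b)" if "b \<in> Ou" for b
      using that nz q_nz by (auto simp: qinf_eq_0_iff fo_def field_simps image_iff)
    moreover have "qinf (c / w) = 0 \<longleftrightarrow> w \<in> range (fi c)" for c
      using w by (auto simp: qinf_eq_0_iff fi_def field_simps image_iff)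
    ultimately show ?thesis unfolding D P_def using fin by auto
  qed
  \<comment> \<open>Iterating the functional equation collects q^n, which becomes the power in the
    residue series as well as the decay rate of H.\<close>
  have outer_n: "D (w / q ^ n) \<noteq> 0 \<and> H (w / q ^ n) * qfins bs (1 / w) n = q ^ n * H w * qfins gs (1 / w) n"
    if "w \<noteq> 0" "D w \<noteq> 0" "qfins bs (1 / w) n \<noteq> 0" for w n
    using that
  proof (induction n)
    case (Suc n)
    have e: "1 - b * (1 / w) * q ^ n = 1 - b / (w / q ^ n)" for b by simp
    have qs: "qfins bs (1 / w) (Suc n) = qfins bs (1 / w) n * (\<Prod>b\<leftarrow>bs. 1 - b / (w / q ^ n))"
      "qfins gs (1 / w) (Suc n) = qfins gs (1 / w) n * (\<Prod>b\<leftarrow>gs. 1 - b / (w / q ^ n))"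
      unfolding qfins_Suc e by (rule refl)+
    have nzs: "qfins bs (1 / w) n \<noteq> 0" "(\<Prod>b\<leftarrow>bs. 1 - b / (w / q ^ n)) \<noteq> 0" using Suc.prems(3) unfolding qs by auto
    have IH: "D (w / q ^ n) \<noteq> 0" "H (w / q ^ n) * qfins bs (1 / w) n = q ^ n * H w * qfins gs (1 / w) n"
      using Suc.IH Suc.prems nzs by auto
    have "w / q ^ n \<noteq> 0" using Suc.prems q_nz by simp
    from outer[OF this IH(1) nzs(2)] have st: "D (w / q ^ n / q) \<noteq> 0"
      "H (w / q ^ n / q) * (\<Prod>b\<leftarrow>bs. 1 - b / (w / q ^ n)) = q * H (w / q ^ n) * (\<Prod>g\<leftarrow>gs. 1 - g / (w / q ^ n))" by auto
    have e2: "w / q ^ Suc n = w / q ^ n / q" by simp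
    have "H (w / q ^ Suc n) * qfins bs (1 / w) (Suc n) = q * (H (w / q ^ n) * qfins bs (1 / w) n) * (\<Prod>g\<leftarrow>gs. 1 - g / (w / q ^ n))"
      unfolding qs e2 using st(2) by (simp only: mult_ac)
    also have "\<dots> = q ^ Suc n * H w * qfins gs (1 / w) (Suc n)" unfolding IH qs by (simp add: mult_ac)
    finally show ?case using st(1) unfolding e2 by (simp only: simp_thms)
  qed simp
  have inner_n: "D (w * q ^ n) \<noteq> 0 \<and> H (w * q ^ n) * qfins cs w n = q ^ n * H w * qfins ds w n"
    if "w \<noteq> 0" "D w \<noteq> 0" "qfins cs w n \<noteq> 0" for w n
    using that
  proof (induction n)
    case (Suc n)
    have e: "1 - b * w * q ^ n = 1 - b * (w * q ^ n)" for b by simp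
    have qs: "qfins cs w (Suc n) = qfins cs w n * (\<Prod>b\<leftarrow>cs. 1 - b * (w * q ^ n))"
      "qfins ds w (Suc n) = qfins ds w n * (\<Prod>b\<leftarrow>ds. 1 - b * (w * q ^ n))"
      unfolding qfins_Suc e by (rule refl)+
    have nzs: "qfins cs w n \<noteq> 0" "(\<Prod>b\<leftarrow>cs. 1 - b * (w * q ^ n)) \<noteq> 0" using Suc.prems(3) unfolding qs by auto
    have IH: "D (w * q ^ n) \<noteq> 0" "H (w * q ^ n) * qfins cs w n = q ^ n * H w * qfins ds w n"
      using Suc.IH Suc.prems nzs by auto
    have "w * q ^ n \<noteq> 0" using Suc.prems q_nz by simp
    from inner[OF this IH(1) nzs(2)] have st: "D (w * q ^ n * q) \<noteq> 0"
      "H (w * q ^ n * q) * (\<Prod>b\<leftarrow>cs. 1 - b * (w * q ^ n)) = q * H (w * q ^ n) * (\<Prod>g\<leftarrow>ds. 1 - g * (w * q ^ n))" by auto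
    have e2: "w * q ^ Suc n = w * q ^ n * q" by simp
    have "H (w * q ^ Suc n) * qfins cs w (Suc n) = q * (H (w * q ^ n) * qfins cs w n) * (\<Prod>g\<leftarrow>ds. 1 - g * (w * q ^ n))"
      unfolding qs e2 using st(2) by (simp only: mult_ac)
    also have "\<dots> = q ^ Suc n * H w * qfins ds w (Suc n)" unfolding IH qs by (simp add: mult_ac)
    finally show ?case using st(1) unfolding e2 by (simp only: simp_thms)
  qed simp
  have finP: "finite {p \<in> P. r \<le> norm p \<and> norm p \<le> R}" if r: "0 < r" for r R
  proof -
    have "{p \<in> P. r \<le> norm p \<and> norm p \<le> R} \<subseteq> (\<Union>b\<in>Ou. {p \<in> range (fo b). norm p \<le> R}) \<union> (\<Union>c\<in>In. {p \<in> range (fi c). r \<le> norm p})"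
      by (auto simp: P_def)
    moreover have "finite ((\<Union>b\<in>Ou. {p \<in> range (fo b). norm p \<le> R}) \<union> (\<Union>c\<in>In. {p \<in> range (fi c). r \<le> norm p}))"
      unfolding fo_def fi_def using fin nz r
      by (intro finite_UnI finite_UN_I finite_geometric_below finite_geometric_above) auto
    ultimately show ?thesis by (rule finite_subset)
  qed
  have evD: "eventually (\<lambda>w. w \<noteq> 0 \<and> D w \<noteq> 0) (at p)" if p: "p \<noteq> 0" for p
  proof -
    define X where "X = {x \<in> P. norm p / 2 \<le> norm x \<and> norm x \<le> 2 * norm p}"
    have "finite X" unfolding X_def using p by (intro finP) auto
    then have "open ({x. norm p / 2 < norm x \<and> norm x < 2 * norm p} - (X - {p}))"
      by (intro open_Diff finite_imp_closed finite_Diff open_Collect_conj open_Collect_less continuous_intros)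
    moreover have "p \<in> {x. norm p / 2 < norm x \<and> norm x < 2 * norm p} - (X - {p})" using p by auto
    ultimately have "eventually (\<lambda>w. w \<in> {x. norm p / 2 < norm x \<and> norm x < 2 * norm p} - (X - {p})) (nhds p)"
      by (rule eventually_nhds_in_open)
    then show ?thesis unfolding eventually_at_filter
    proof eventually_elim
      case (elim w)
      then have "w \<noteq> 0" using p by auto
      then show ?case using D0[of w] elim by (auto simp: X_def)
    qed
  qed
  define F where "F w = H w / w" for w
  \<comment> \<open>Taking the residue as a limit makes it a function of the pole alone, not of its
    representation as a member of a progression.\<close>
  define c where "c p = Lim (at p) (\<lambda>w. F w * (w - p))" for p
  have lim_o: "((\<lambda>w. F w * (w - fo b n)) \<longlongrightarrow> Ro b * (q ^ n * qfins gs (1 / b) n / qfins bs (1 / b) n)) (at (fo b n))"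
    if b: "b \<in> Ou" for b n
  proof -
    have b0: "b \<noteq> 0" using b nz by auto
    have qb: "qfins bs (1 / b) n \<noteq> 0"
      unfolding qfins_eq_0_iff using bs[OF b] qfin_nz_if_qinf_nz by blast
    have "((\<lambda>w. q ^ n * qfins gs (1 / w) n / qfins bs (1 / w) n * (H w * ((w - b) / w))) \<longlongrightarrow>
       q ^ n * qfins gs (1 / b) n / qfins bs (1 / b) n * Ro b) (at b)"
      by (intro tendsto_intros qfins_tendsto Ro b qb b0)
    moreover have "eventually (\<lambda>w. q ^ n * qfins gs (1 / w) n / qfins bs (1 / w) n * (H w * ((w - b) / w))
        = F (w / q ^ n) * (w / q ^ n - b / q ^ n)) (at b)"
    proof -
      have "eventually (\<lambda>w. qfins bs (1 / w) n \<noteq> 0) (at b)"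
        by (rule tendsto_imp_eventually_ne[OF _ qb]) (intro qfins_tendsto tendsto_intros b0)
      with evD[OF b0] show ?thesis
      proof eventually_elim
        case (elim w)
        then have "H (w / q ^ n) = q ^ n * H w * qfins gs (1 / w) n / qfins bs (1 / w) n"
          using outer_n[of w n] by (simp add: eq_divide_eq)
        then show ?case using q_nz elim by (simp add: F_def diff_divide_distrib[symmetric])
      qed
    qed
    ultimately have "((\<lambda>w. F (w / q ^ n) * (w / q ^ n - b / q ^ n)) \<longlongrightarrow> q ^ n * qfins gs (1 / b) n / qfins bs (1 / b) n * Ro b) (at b)"
      by (rule Lim_transform_eventually)
    \<comment> \<open>The substitution w -> w q^n carries the limit at the base point b over to the
      pole b / q^n.\<close>
    moreover have "filterlim (\<lambda>w. w * q ^ n) (at b) (at (fo b n))"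
    proof -
      have "((\<lambda>w. w * q ^ n) \<longlongrightarrow> fo b n * q ^ n) (at (fo b n))" by (intro tendsto_intros)
      then have "((\<lambda>w. w * q ^ n) \<longlongrightarrow> b) (at (fo b n))" using q_nz by (simp add: fo_def)
      moreover have "eventually (\<lambda>w. w * q ^ n \<noteq> b) (at (fo b n))"
        using q_nz by (auto simp: eventually_at_filter fo_def field_simps)
      ultimately show ?thesis by (simp add: filterlim_at)
    qed
    ultimately have "((\<lambda>w. F (w * q ^ n / q ^ n) * (w * q ^ n / q ^ n - b / q ^ n)) \<longlongrightarrow> q ^ n * qfins gs (1 / b) n / qfins bs (1 / b) n * Ro b) (at (fo b n))"
      by (rule filterlim_compose)
    then show ?thesis using q_nz by (simp add: fo_def mult_ac)
  qed
  have lim_i: "((\<lambda>w. F w * (w - fi b n)) \<longlongrightarrow> Ri b * (q ^ n * qfins ds b n / qfins cs b n)) (at (fi b n))"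
    if b: "b \<in> In" for b n
  proof -
    have b0: "b \<noteq> 0" using b nz by auto
    have qb: "qfins cs b n \<noteq> 0"
      unfolding qfins_eq_0_iff using cs[OF b] qfin_nz_if_qinf_nz by blast
    have "((\<lambda>w. q ^ n * qfins ds w n / qfins cs w n * (H w * ((w - b) / w))) \<longlongrightarrow>
       q ^ n * qfins ds b n / qfins cs b n * Ri b) (at b)"
      by (intro tendsto_intros qfins_tendsto Ri b qb b0)
    moreover have "eventually (\<lambda>w. q ^ n * qfins ds w n / qfins cs w n * (H w * ((w - b) / w))
        = F (w * q ^ n) * (w * q ^ n - b * q ^ n)) (at b)"
    proof -
      have "eventually (\<lambda>w. qfins cs w n \<noteq> 0) (at b)"
        by (rule tendsto_imp_eventually_ne[OF _ qb]) (intro qfins_tendsto tendsto_intros b0)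
      with evD[OF b0] show ?thesis
      proof eventually_elim
        case (elim w)
        then have "H (w * q ^ n) = q ^ n * H w * qfins ds w n / qfins cs w n"
          using inner_n[of w n] by (simp add: eq_divide_eq)
        then show ?case using q_nz elim by (simp add: F_def left_diff_distrib[symmetric])
      qed
    qed
    ultimately have "((\<lambda>w. F (w * q ^ n) * (w * q ^ n - b * q ^ n)) \<longlongrightarrow> q ^ n * qfins ds b n / qfins cs b n * Ri b) (at b)"
      by (rule Lim_transform_eventually)
    moreover have "filterlim (\<lambda>w. w / q ^ n) (at b) (at (fi b n))"
    proof -
      have "((\<lambda>w. w / q ^ n) \<longlongrightarrow> fi b n / q ^ n) (at (fi b n))" using q_nz by (intro tendsto_intros) auto
      then have "((\<lambda>w. w / q ^ n) \<longlongrightarrow> b) (at (fi b n))" using q_nz by (simp add: fi_def)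
      moreover have "eventually (\<lambda>w. w / q ^ n \<noteq> b) (at (fi b n))"
        using q_nz by (auto simp: eventually_at_filter fi_def field_simps)
      ultimately show ?thesis by (simp add: filterlim_at)
    qed
    ultimately have "((\<lambda>w. F (w / q ^ n * q ^ n) * (w / q ^ n * q ^ n - b * q ^ n)) \<longlongrightarrow> q ^ n * qfins ds b n / qfins cs b n * Ri b) (at (fi b n))"
      by (rule filterlim_compose)
    then show ?thesis using q_nz by (simp add: fi_def mult_ac)
  qed
  have c_o: "c (fo b n) = Ro b * (q ^ n * qfins gs (1 / b) n / qfins bs (1 / b) n)" if "b \<in> Ou" for b n
    unfolding c_def using lim_o[OF that] by (intro tendsto_Lim) auto
  have c_i: "c (fi b n) = Ri b * (q ^ n * qfins ds b n / qfins cs b n)" if "b \<in> In" for b n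
    unfolding c_def using lim_i[OF that] by (intro tendsto_Lim) auto
  have lim: "((\<lambda>w. F w * (w - p)) \<longlongrightarrow> c p) (at p)" if "p \<in> P" for p
    using that unfolding P_def
  proof (elim UnE UN_E)
    fix b assume b: "b \<in> Ou" "p \<in> range (fo b)"
    then obtain n where "p = fo b n" by auto
    then show ?thesis using lim_o[OF b(1), of n] c_o[OF b(1), of n] by simp
  next
    fix b assume b: "b \<in> In" "p \<in> range (fi b)"
    then obtain n where "p = fi b n" by auto
    then show ?thesis using lim_i[OF b(1), of n] c_i[OF b(1), of n] by simp
  qed
  have powi_fo: "fo b n = b * q powi (- int n)" and powi_fi: "fi b n = b * q powi (int n)" for b n
    by (simp_all add: fo_def fi_def power_int_minus divide_inverse)
  have cross: "b * q powi k \<noteq> b' * q powi k'" if "b \<in> Ou \<union> In" "b' \<in> Ou \<union> In" "b \<noteq> b'" for b b' and k k' :: int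
  proof
    assume "b * q powi k = b' * q powi k'"
    then have "b = b' * q powi (k' - k)" using q_nz by (simp add: power_int_diff field_simps)
    then show False using indep[OF that] by blast
  qed
  have hs_o: "(c has_sum Ro b * (\<Sum>n. q ^ n * qfins gs (1 / b) n / qfins bs (1 / b) n)) (range (fo b))" if b: "b \<in> Ou" for b
  proof -
    have b0: "b \<noteq> 0" using b nz by auto
    have inj: "inj (fo b)"
    proof (rule injI)
      fix m n assume "fo b m = fo b n"
      then have "norm q ^ m = norm q ^ n" using b0 q_nz by (simp add: fo_def) (metis norm_power)
      then show "m = n" using q_lt1 q0 by (metis power_inject_exp' less_irrefl norm_one power_strict_decreasing nat_neq_iff)
    qed
    have "((\<lambda>n. q ^ n * qfins gs (1 / b) n / qfins bs (1 / b) n) has_sum (\<Sum>n. q ^ n * qfins gs (1 / b) n / qfins bs (1 / b) n)) UNIV"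
      by (intro norm_summable_imp_has_sum qfins_quot_summable bs b summable_sums summable_norm_cancel[OF qfins_quot_summable])
    from has_sum_cmult_right[OF this, of "Ro b"] have "((c \<circ> fo b) has_sum Ro b * (\<Sum>n. q ^ n * qfins gs (1 / b) n / qfins bs (1 / b) n)) UNIV"
      by (simp add: o_def c_o[OF b])
    then show ?thesis using has_sum_reindex[OF inj, of c] by simp
  qed
  have hs_i: "(c has_sum Ri b * (\<Sum>n. q ^ n * qfins ds b n / qfins cs b n)) (range (fi b))" if b: "b \<in> In" for b
  proof -
    have b0: "b \<noteq> 0" using b nz by auto
    have inj: "inj (fi b)"
    proof (rule injI)
      fix m n assume "fi b m = fi b n"
      then have "norm q ^ m = norm q ^ n" using b0 q_nz by (simp add: fi_def) (metis norm_power)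
      then show "m = n" using q_lt1 q0 by (metis power_inject_exp' less_irrefl norm_one power_strict_decreasing nat_neq_iff)
    qed
    have "((\<lambda>n. q ^ n * qfins ds b n / qfins cs b n) has_sum (\<Sum>n. q ^ n * qfins ds b n / qfins cs b n)) UNIV"
      by (intro norm_summable_imp_has_sum qfins_quot_summable cs b summable_sums summable_norm_cancel[OF qfins_quot_summable])
    from has_sum_cmult_right[OF this, of "Ri b"] have "((c \<circ> fi b) has_sum Ri b * (\<Sum>n. q ^ n * qfins ds b n / qfins cs b n)) UNIV"
      by (simp add: o_def c_i[OF b])
    then show ?thesis using has_sum_reindex[OF inj, of c] by simp
  qed
  have hs1: "(c has_sum (\<Sum>b\<in>Ou. Ro b * (\<Sum>n. q ^ n * qfins gs (1 / b) n / qfins bs (1 / b) n))) (\<Union>b\<in>Ou. range (fo b))"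
  proof (rule has_sum_finite_UN[OF fin(1) hs_o])
    fix i j assume "i \<in> Ou" "j \<in> Ou" "i \<noteq> j"
    then have "fo i m \<noteq> fo j n" for m n unfolding powi_fo by (intro cross) auto
    then show "range (fo i) \<inter> range (fo j) = {}" by auto
  qed
  have hs2: "(c has_sum (\<Sum>b\<in>In. Ri b * (\<Sum>n. q ^ n * qfins ds b n / qfins cs b n))) (\<Union>b\<in>In. range (fi b))"
  proof (rule has_sum_finite_UN[OF fin(2) hs_i])
    fix i j assume "i \<in> In" "j \<in> In" "i \<noteq> j"
    then have "fi i m \<noteq> fi j n" for m n unfolding powi_fi by (intro cross) auto
    then show "range (fi i) \<inter> range (fi j) = {}" by auto
  qed
  have dj: "(\<Union>b\<in>Ou. range (fo b)) \<inter> (\<Union>b\<in>In. range (fi b)) = {}"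
  proof -
    have "fo b n \<noteq> fi b' n'" if "b \<in> Ou" "b' \<in> In" for b b' n n'
      unfolding powi_fo powi_fi using that disj by (intro cross) auto
    then show ?thesis by auto
  qed
  have hs: "(c has_sum (\<Sum>b\<in>Ou. Ro b * (\<Sum>n. q ^ n * qfins gs (1 / b) n / qfins bs (1 / b) n))
    + (\<Sum>c\<in>In. Ri c * (\<Sum>n. q ^ n * qfins ds c n / qfins cs c n))) P"
    unfolding P_def by (rule has_sum_Un_disjoint[OF hs1 hs2 dj])
  \<comment> \<open>A radius is bad if multiplying or dividing it by some power of |q| gives the
    modulus of a pole. There are only countably many, so good radii exist in every interval.\<close>
  define bad where "bad = (\<Union>n. (\<lambda>p. norm p * norm q ^ n) ` P) \<union> (\<Union>n. (\<lambda>p. norm p / norm q ^ n) ` P)"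
  have "countable P" unfolding P_def
    by (intro countable_Un countable_UN countable_image countable_finite[OF fin(1)] countable_finite[OF fin(2)]) auto
  then have cb: "countable bad" unfolding bad_def by (intro countable_Un countable_UN countable_image) auto
  obtain Rb where Rb: "Rb > 0" "\<And>x. x \<in> set bs \<Longrightarrow> norm x \<le> Rb" "\<And>x. x \<in> set cs \<Longrightarrow> norm x \<le> Rb"
  proof (rule that[of "1 + (\<Sum>x\<in>set bs \<union> set cs. norm x)"])
    show "0 < 1 + (\<Sum>x\<in>set bs \<union> set cs. norm x)" by (intro add_pos_nonneg sum_nonneg) auto
    have "norm x \<le> (\<Sum>x\<in>set bs \<union> set cs. norm x)" if "x \<in> set bs \<union> set cs" for x
      by (rule member_le_sum[OF that]) auto
    then show "norm x \<le> 1 + (\<Sum>x\<in>set bs \<union> set cs. norm x)" if "x \<in> set bs" for x using that by fastforce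
    show "norm x \<le> 1 + (\<Sum>x\<in>set bs \<union> set cs. norm x)" if "x \<in> set cs" for x
      using that \<open>\<And>x. x \<in> set bs \<union> set cs \<Longrightarrow> norm x \<le> (\<Sum>x\<in>set bs \<union> set cs. norm x)\<close> by fastforce
  qed
  \<comment> \<open>R > 2 Rb and r < 1 / (2 Rb) force the arguments b / w and b w on the two
    starting circles into the disc of radius 1 / 2, as \<open>qfins_lower\<close> requires.\<close>
  obtain R where R: "R > max 1 (2 * Rb)" "R \<notin> bad" using countable_avoid_above[OF cb] by blast
  have "min 1 (1 / (2 * Rb)) > 0" using Rb by simp
  then obtain r where r: "r > 0" "r < min 1 (1 / (2 * Rb))" "r \<notin> bad" using countable_avoid_below[OF cb] by blast
  have bound: "\<exists>K. \<forall>w. norm w = \<rho> \<longrightarrow> norm (H w) \<le> K" if \<rho>: "\<rho> > 0" "\<rho> \<notin> bad" for \<rho>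
  proof -
    have nD: "w \<noteq> 0 \<and> D w \<noteq> 0" if "norm w = \<rho>" for w
    proof -
      have "w \<noteq> 0" using that \<rho> by auto
      moreover have "w \<notin> P"
      proof
        assume "w \<in> P"
        then have "norm w * norm q ^ 0 \<in> bad" unfolding bad_def by blast
        then show False using that \<rho> by simp
      qed
      ultimately show ?thesis using D0 by auto
    qed
    have "continuous_on (sphere 0 \<rho>) H" unfolding H
    proof (intro continuous_intros)
      show "continuous_on (sphere 0 \<rho>) N"
        using N \<rho> by (intro holomorphic_on_imp_continuous_on holomorphic_on_subset[OF N]) auto
      show "continuous_on (sphere 0 \<rho>) D" unfolding D using nD nz by (intro continuous_intros) auto
    qed (use nD in auto)
    then have "bounded (H ` sphere 0 \<rho>)" by (intro compact_imp_bounded compact_continuous_image) auto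
    then obtain K where K: "\<forall>y\<in>H ` sphere 0 \<rho>. norm y \<le> K" unfolding bounded_iff by blast
    have "norm (H w) \<le> K" if "norm w = \<rho>" for w
    proof -
      have "H w \<in> H ` sphere 0 \<rho>" using that by (intro imageI) simp
      then show ?thesis using K by blast
    qed
    then show ?thesis by blast
  qed
  have noP: "w \<notin> P" if "norm w = \<rho> * norm q ^ n \<or> norm w = \<rho> / norm q ^ n" "\<rho> \<notin> bad" for w \<rho> n
  proof
    assume wP: "w \<in> P"
    from that(1) have "\<rho> = norm w / norm q ^ n \<or> \<rho> = norm w * norm q ^ n" using q0 by auto
    then show False using that(2) wP unfolding bad_def by blast
  qed
  obtain KR where KR: "\<And>w. norm w = R \<Longrightarrow> norm (H w) \<le> KR" using bound[of R] R by auto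
  obtain Kr where Kr: "\<And>w. norm w = r \<Longrightarrow> norm (H w) \<le> Kr" using bound[of r] r by auto
  obtain cb where cb: "cb > 0" "\<And>x n. (\<forall>b\<in>set bs. norm (b * x) \<le> 1 / 2) \<Longrightarrow> cb \<le> norm (qfins bs x n)"
    using qfins_lower[of bs] by blast
  obtain cc where cc: "cc > 0" "\<And>x n. (\<forall>b\<in>set cs. norm (b * x) \<le> 1 / 2) \<Longrightarrow> cc \<le> norm (qfins cs x n)"
    using qfins_lower[of cs] by blast
  have "\<exists>G\<ge>0. \<forall>L\<in>{gs, ds}. \<forall>x n. norm x \<le> 1 \<longrightarrow> norm (qfins L x n) \<le> G"
  proof -
    define S where "S L = (\<Sum>b\<in>set L. norm b)" for L :: "complex list"
    have u: "norm (qfins L x n) \<le> emaj (S L) ^ length L" if "norm x \<le> 1" for L x n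
    proof (rule qfins_upper)
      fix b assume "b \<in> set L"
      then have "norm b \<le> S L" unfolding S_def by (intro member_le_sum) auto
      moreover have "norm (b * x) \<le> norm b" using that by (simp add: norm_mult mult_left_le)
      ultimately show "norm (b * x) \<le> S L" by simp
    qed
    have e: "0 \<le> emaj (S L) ^ length L" for L by (intro zero_le_power less_imp_le[OF emaj_pos])
    have "norm (qfins L x n) \<le> emaj (S gs) ^ length gs + emaj (S ds) ^ length ds" if "norm x \<le> 1" "L \<in> {gs, ds}" for L x n
      using u[OF that(1), of L n] that(2) e[of gs] e[of ds] by auto
    then show ?thesis using e[of gs] e[of ds] by (intro exI[of _ "emaj (S gs) ^ length gs + emaj (S ds) ^ length ds"]) auto
  qed
  then obtain G where G: "G \<ge> 0" "\<And>x n. norm x \<le> 1 \<Longrightarrow> norm (qfins gs x n) \<le> G" "\<And>x n. norm x \<le> 1 \<Longrightarrow> norm (qfins ds x n) \<le> G"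
    by auto
  define K where "K = \<bar>KR\<bar> * G / cb + \<bar>Kr\<bar> * G / cc"
  have decay: "norm (F w) * norm w \<le> K * norm q ^ n" if w: "norm w = r * norm q ^ n \<or> norm w = R / norm q ^ n" for w n
  proof -
    have w0: "w \<noteq> 0" using w r(1) R(1) q0 by auto
    have FH: "norm (F w) * norm w = norm (H w)" using w0 by (simp add: F_def norm_divide)
    have pos: "0 \<le> \<bar>KR\<bar> * G / cb * norm q ^ n" "0 \<le> \<bar>Kr\<bar> * G / cc * norm q ^ n"
      using G(1) cb(1) cc(1) by (auto intro!: mult_nonneg_nonneg divide_nonneg_nonneg)
    from w show ?thesis
    proof
      assume w: "norm w = R / norm q ^ n"
      define v where "v = w * q ^ n"
      have v: "norm v = R" using w q0 by (simp add: v_def norm_mult norm_power)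
      have v0: "v \<noteq> 0" using v R(1) by auto
      have nb: "\<forall>b\<in>set bs. norm (b * (1 / v)) \<le> 1 / 2"
      proof
        fix b assume "b \<in> set bs"
        then have "norm b \<le> R / 2" using Rb(2)[of b] R(1) by auto
        then show "norm (b * (1 / v)) \<le> 1 / 2" using v R(1) by (simp add: norm_divide divide_le_eq)
      qed
      have lb: "cb \<le> norm (qfins bs (1 / v) n)" using nb by (rule cb(2))
      then have nzb: "qfins bs (1 / v) n \<noteq> 0" using cb(1) by auto
      have "D v \<noteq> 0" using D0[OF v0] noP[of v R 0] v R(2) by auto
      from outer_n[OF v0 this nzb] have "H (v / q ^ n) = q ^ n * H v * qfins gs (1 / v) n / qfins bs (1 / v) n"
        using nzb by (simp add: eq_divide_eq)
      moreover have "v / q ^ n = w" using q_nz by (simp add: v_def)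
      ultimately have "norm (H w) = norm (H v) * norm (qfins gs (1 / v) n) / norm (qfins bs (1 / v) n) * norm q ^ n"
        by (simp add: norm_mult norm_divide norm_power)
      also have "\<dots> \<le> \<bar>KR\<bar> * G / cb * norm q ^ n"
      proof (intro mult_right_mono frac_le mult_mono lb cb(1))
        show "norm (H v) \<le> \<bar>KR\<bar>" using KR[OF v] by linarith
        show "norm (qfins gs (1 / v) n) \<le> G" using v R(1) by (intro G) (simp add: norm_divide)
      qed (use G in auto)
      finally show ?thesis unfolding FH K_def using pos by (simp add: distrib_right)
    next
      assume w: "norm w = r * norm q ^ n"
      define v where "v = w / q ^ n"
      have v: "norm v = r" using w q0 by (simp add: v_def norm_divide norm_power)
      have v0: "v \<noteq> 0" using v r(1) by auto
      have nb: "\<forall>b\<in>set cs. norm (b * v) \<le> 1 / 2"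
      proof
        fix b assume "b \<in> set cs"
        then have "norm b * r \<le> Rb * (1 / (2 * Rb))" using Rb(1) Rb(3)[of b] r by (intro mult_mono) auto
        then show "norm (b * v) \<le> 1 / 2" using v Rb(1) by (simp add: norm_mult)
      qed
      have lb: "cc \<le> norm (qfins cs v n)" using nb by (rule cc(2))
      then have nzb: "qfins cs v n \<noteq> 0" using cc(1) by auto
      have "D v \<noteq> 0" using D0[OF v0] noP[of v r 0] v r(3) by auto
      from inner_n[OF v0 this nzb] have "H (v * q ^ n) = q ^ n * H v * qfins ds v n / qfins cs v n"
        using nzb by (simp add: eq_divide_eq)
      moreover have "v * q ^ n = w" using q_nz by (simp add: v_def)
      ultimately have "norm (H w) = norm (H v) * norm (qfins ds v n) / norm (qfins cs v n) * norm q ^ n"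
        by (simp add: norm_mult norm_divide norm_power)
      also have "\<dots> \<le> \<bar>Kr\<bar> * G / cc * norm q ^ n"
      proof (intro mult_right_mono frac_le mult_mono lb cc(1))
        show "norm (H v) \<le> \<bar>Kr\<bar>" using Kr[OF v] by linarith
        show "norm (qfins ds v n) \<le> G" using v r by (intro G) auto
      qed (use G in auto)
      finally show ?thesis unfolding FH K_def using pos by (simp add: distrib_right)
    qed
  qed
  have "infsum c P = 0"
  proof (rule residue_sum_zero[where F = F and rr = "\<lambda>n. r * norm q ^ n" and RR = "\<lambda>n. R / norm q ^ n" and M = "\<lambda>n. K * norm q ^ n"])
    have hD: "D holomorphic_on - {0}" unfolding D using nz by (intro holomorphic_intros) auto
    show "F holomorphic_on - {0} - P"
      unfolding F_def H using D0
      by (intro holomorphic_intros holomorphic_on_subset[OF N] holomorphic_on_subset[OF hD]) auto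
    have qn: "(\<lambda>n. norm q ^ n) \<longlonglongrightarrow> 0" using q_lt1 by (intro LIMSEQ_power_zero) auto
    show "(\<lambda>n. r * norm q ^ n) \<longlonglongrightarrow> 0" "(\<lambda>n. K * norm q ^ n) \<longlonglongrightarrow> 0"
      using tendsto_mult_left[OF qn, of r] tendsto_mult_left[OF qn, of K] by simp_all
    show "filterlim (\<lambda>n. R / norm q ^ n) at_top sequentially"
      using filterlim_tendsto_pos_mult_at_top[OF tendsto_const[of R] _ filterlim_inverse_at_top[OF qn]] R(1) q0
      by (simp add: divide_inverse)
    show "norm p \<noteq> r * norm q ^ n \<and> norm p \<noteq> R / norm q ^ n" if "p \<in> P" for n p
      using noP[of p r n] noP[of p R n] that r(3) R(2) by auto
    show "0 < r * norm q ^ n" for n using r(1) q0 by simp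
    show "c summable_on P" using hs by (auto simp: summable_on_def)
  qed (use P0 finP lim decay in auto)
  then show ?thesis using hs by (simp add: infsumI)
qed

text \<open>At a base point the vanishing factor leaves behind (q), which is common to all residues
  and cancels. The zeros of (w / b) and (c / w) have residues of opposite sign, hence the inner sum
  appears on the other side.\<close>

theorem bilateral_sum:
  fixes Ou In :: "complex set" and N H D :: "complex \<Rightarrow> complex" and bs gs cs ds :: "complex list"
  assumes fin: "finite Ou" "finite In" and disj: "Ou \<inter> In = {}" and nz: "0 \<notin> Ou \<union> In"
    and indep: "\<And>x y k. x \<in> Ou \<union> In \<Longrightarrow> y \<in> Ou \<union> In \<Longrightarrow> x \<noteq> y \<Longrightarrow> x \<noteq> y * q powi (k::int)"
    and N: "N holomorphic_on - {0}"
    and D: "\<And>w. D w = (\<Prod>b\<in>Ou. qinf (w / b)) * (\<Prod>c\<in>In. qinf (c / w))"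
    and H: "\<And>w. H w = N w / D w"
    and outer: "\<And>w. w \<noteq> 0 \<Longrightarrow> D w \<noteq> 0 \<Longrightarrow> (\<Prod>b\<leftarrow>bs. 1 - b / w) \<noteq> 0 \<Longrightarrow>
       D (w / q) \<noteq> 0 \<and> H (w / q) * (\<Prod>b\<leftarrow>bs. 1 - b / w) = q * H w * (\<Prod>g\<leftarrow>gs. 1 - g / w)"
    and inner: "\<And>w. w \<noteq> 0 \<Longrightarrow> D w \<noteq> 0 \<Longrightarrow> (\<Prod>b\<leftarrow>cs. 1 - b * w) \<noteq> 0 \<Longrightarrow>
       D (w * q) \<noteq> 0 \<and> H (w * q) * (\<Prod>b\<leftarrow>cs. 1 - b * w) = q * H w * (\<Prod>g\<leftarrow>ds. 1 - g * w)"
    and bs: "\<And>b x. b \<in> Ou \<Longrightarrow> x \<in> set bs \<Longrightarrow> qinf (x * (1 / b)) \<noteq> 0"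
    and cs: "\<And>c x. c \<in> In \<Longrightarrow> x \<in> set cs \<Longrightarrow> qinf (x * c) \<noteq> 0"
  shows "(\<Sum>b\<in>Ou. N b / ((\<Prod>b'\<in>Ou - {b}. qinf (b / b')) * (\<Prod>c\<in>In. qinf (c / b)))
        * (\<Sum>n. q ^ n * qfins gs (1 / b) n / qfins bs (1 / b) n))
    = (\<Sum>c\<in>In. N c / ((\<Prod>b\<in>Ou. qinf (c / b)) * (\<Prod>c'\<in>In - {c}. qinf (c' / c)))
        * (\<Sum>n. q ^ n * qfins ds c n / qfins cs c n))"
proof -
  have ratio_nz: "qinf (x / y) \<noteq> 0" if "x \<in> Ou \<union> In" "y \<in> Ou \<union> In" "x \<noteq> y" for x y
  proof
    assume "qinf (x / y) = 0"
    then obtain j where "x / y * q ^ j = 1" by (auto simp: qinf_eq_0_iff)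
    then have "x = y * q powi (- int j)" using q_nz by (auto simp: power_int_minus field_simps)
    then show False using indep[OF that] by blast
  qed
  have cN: "(N \<longlongrightarrow> N p) (at p)" if "p \<noteq> 0" for p
  proof -
    have "continuous_on (- {0}) N" using N by (rule holomorphic_on_imp_continuous_on)
    then have "isCont N p" using that by (auto simp: continuous_on_eq_continuous_at open_Compl)
    then show ?thesis by (simp add: isCont_def)
  qed
  have q0: "qrem 0 1 = qinf q" by (simp add: qrem_def)
  have Ro: "((\<lambda>w. H w * ((w - b) / w)) \<longlongrightarrow> - (N b / ((\<Prod>b'\<in>Ou - {b}. qinf (b / b')) * (\<Prod>c\<in>In. qinf (c / b)))) / qinf q) (at b)"
    if b: "b \<in> Ou" for b
  proof -
    have b0: "b \<noteq> 0" using b nz by auto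
    have X0: "(\<Prod>b'\<in>Ou - {b}. qinf (b / b')) * (\<Prod>c\<in>In. qinf (c / b)) \<noteq> 0"
      using fin b disj ratio_nz by (auto simp: prod_zero_iff)
    have "((\<lambda>w. (w - b) / qinf (1 / b * w)) \<longlongrightarrow> - b / qrem 0 (1 / b * b)) (at b)"
      using b0 by (intro simple_zero_limit) simp
    then have l: "((\<lambda>w. (w - b) / qinf (w / b)) \<longlongrightarrow> - b / qinf q) (at b)" using b0 q0 by simp
    have "((\<lambda>w. N w / ((\<Prod>b'\<in>Ou - {b}. qinf (w / b')) * (\<Prod>c\<in>In. qinf (c / w))) * (1 / w) * ((w - b) / qinf (w / b)))
      \<longlongrightarrow> N b / ((\<Prod>b'\<in>Ou - {b}. qinf (b / b')) * (\<Prod>c\<in>In. qinf (c / b))) * (1 / b) * (- b / qinf q)) (at b)"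
      using nz by (intro tendsto_mult tendsto_divide cN l X0 tendsto_intros b0) auto
    moreover have "H w * ((w - b) / w) = N w / ((\<Prod>b'\<in>Ou - {b}. qinf (w / b')) * (\<Prod>c\<in>In. qinf (c / w))) * (1 / w) * ((w - b) / qinf (w / b))" for w
      unfolding H D prod.remove[OF fin(1) b] by (simp add: mult_ac)
    ultimately show ?thesis using b0 by simp
  qed
  have Ri: "((\<lambda>w. H w * ((w - c) / w)) \<longlongrightarrow> N c / ((\<Prod>b\<in>Ou. qinf (c / b)) * (\<Prod>c'\<in>In - {c}. qinf (c' / c))) / qinf q) (at c)"
    if c: "c \<in> In" for c
  proof -
    have c0: "c \<noteq> 0" using c nz by auto
    have X0: "(\<Prod>b\<in>Ou. qinf (c / b)) * (\<Prod>c'\<in>In - {c}. qinf (c' / c)) \<noteq> 0"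
      using fin c disj ratio_nz by (auto simp: prod_zero_iff)
    have "((\<lambda>w. (w - c) / qinf (c / w)) \<longlongrightarrow> c / qrem 0 (c / c)) (at c)"
      using c0 by (intro simple_zero_limit') simp_all
    then have l: "((\<lambda>w. (w - c) / qinf (c / w)) \<longlongrightarrow> c / qinf q) (at c)" using c0 q0 by simp
    have "((\<lambda>w. N w / ((\<Prod>b\<in>Ou. qinf (w / b)) * (\<Prod>c'\<in>In - {c}. qinf (c' / w))) * (1 / w) * ((w - c) / qinf (c / w)))
      \<longlongrightarrow> N c / ((\<Prod>b\<in>Ou. qinf (c / b)) * (\<Prod>c'\<in>In - {c}. qinf (c' / c))) * (1 / c) * (c / qinf q)) (at c)"
      using nz by (intro tendsto_mult tendsto_divide cN l X0 tendsto_intros c0) auto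
    moreover have "H w * ((w - c) / w) = N w / ((\<Prod>b\<in>Ou. qinf (w / b)) * (\<Prod>c'\<in>In - {c}. qinf (c' / w))) * (1 / w) * ((w - c) / qinf (c / w))" for w
      unfolding H D prod.remove[OF fin(2) c] by (simp add: mult_ac)
    ultimately show ?thesis using c0 by simp
  qed
  note R = bilateral_residue_sum[OF fin disj nz indep N D H outer inner Ro Ri bs cs]
  have "(\<Sum>b\<in>Ou. - (N b / ((\<Prod>b'\<in>Ou - {b}. qinf (b / b')) * (\<Prod>c\<in>In. qinf (c / b)))) / qinf q
        * (\<Sum>n. q ^ n * qfins gs (1 / b) n / qfins bs (1 / b) n))
    + (\<Sum>c\<in>In. N c / ((\<Prod>b\<in>Ou. qinf (c / b)) * (\<Prod>c'\<in>In - {c}. qinf (c' / c))) / qinf q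
        * (\<Sum>n. q ^ n * qfins ds c n / qfins cs c n)) = 0"
    by (rule R)
  then have "- ((\<Sum>b\<in>Ou. N b / ((\<Prod>b'\<in>Ou - {b}. qinf (b / b')) * (\<Prod>c\<in>In. qinf (c / b)))
        * (\<Sum>n. q ^ n * qfins gs (1 / b) n / qfins bs (1 / b) n)) / qinf q)
    + (\<Sum>c\<in>In. N c / ((\<Prod>b\<in>Ou. qinf (c / b)) * (\<Prod>c'\<in>In - {c}. qinf (c' / c)))
        * (\<Sum>n. q ^ n * qfins ds c n / qfins cs c n)) / qinf q = 0"
    by (simp add: sum_divide_distrib sum_negf)
  then show ?thesis by (simp add: field_simps)
qed

text \<open>Independence modulo powers of q, stated without division: the bilateral geometric
  progressions through x and y do not meet.\<close>

definition ndep :: "complex \<Rightarrow> complex \<Rightarrow> bool" where "ndep x y \<longleftrightarrow> (\<forall>k::int. x \<noteq> y * q powi k)"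

lemma ndep_sym: "ndep x y \<Longrightarrow> ndep y x"
  unfolding ndep_def
proof (intro allI notI)
  fix k :: int assume a: "\<forall>k::int. x \<noteq> y * q powi k" "y = x * q powi k"
  then have "x = y * q powi (- k)" using q_nz by (simp add: power_int_minus)
  with a(1) show False by blast
qed

text \<open>Squaring doubles the exponent in a relation x = y q^k. One condition on squares thus
  excludes the relations with y and with - y at once.\<close>

lemma ndep_square: "ndep (x\<^sup>2) (y\<^sup>2) \<Longrightarrow> ndep x y"
  unfolding ndep_def
proof (intro allI notI)
  fix k :: int assume a: "\<forall>k::int. x\<^sup>2 \<noteq> y\<^sup>2 * q powi k" "x = y * q powi k"
  have "x\<^sup>2 = y\<^sup>2 * (q powi k * q powi k)" unfolding a(2) by (simp add: power2_eq_square mult_ac)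
  also have "q powi k * q powi k = q powi (k + k)" by (simp only: power_int_add[OF disjI1[OF q_nz]])
  finally have "x\<^sup>2 = y\<^sup>2 * q powi (k + k)" .
  with a(1) show False by blast
qed

lemma ndep_scale: "c \<noteq> 0 \<Longrightarrow> ndep (c * x) (c * y) \<Longrightarrow> ndep x y"
  unfolding ndep_def by (auto simp: mult.assoc)

lemma ndep_q: "ndep x y \<Longrightarrow> ndep x (y * q powi j)"
  unfolding ndep_def using q_nz by (simp add: mult.assoc flip: power_int_add)

lemma ndep_neq: "ndep x y \<Longrightarrow> x \<noteq> y"
  unfolding ndep_def by (metis mult.right_neutral power_int_0_right)


end

section \<open>Independence of the base points and the kernel\<close>

context qsqrt
begin

lemma ndep_qinf: "ndep x 1 \<Longrightarrow> qinf x \<noteq> 0"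
  unfolding ndep_def by (intro qfin_nz_powi(3)) auto

lemma ndep_qinf_ratio: "y \<noteq> 0 \<Longrightarrow> ndep x y \<Longrightarrow> qinf (q * x * (1 / y)) \<noteq> 0"
proof (rule ndep_qinf)
  assume "y \<noteq> 0" "ndep x y"
  then have "ndep (x / y) 1" by (intro ndep_scale[of y "x / y" 1]) simp_all
  then have "ndep (x / y) (1 * q powi (- 1))" by (rule ndep_q)
  then show "ndep (q * x * (1 / y)) 1"
    using q_nz by (intro ndep_scale[of "1 / q" "q * x * (1 / y)" 1]) (simp_all add: power_int_minus inverse_eq_divide)
qed

lemma ndep_norm: "norm q < norm w \<Longrightarrow> norm w < 1 \<Longrightarrow> ndep w 1"
  unfolding ndep_def
proof (intro allI notI)
  fix k :: int assume w: "norm q < norm w" "norm w < 1" "w = 1 * q powi k"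
  have "1 < 1 / norm q" using q_lt1 q_nz by simp
  with w have "w = 1" by (intro qpowi_near_1[of w k]) auto
  with w show False by simp
qed

text \<open>The modulus of s lies strictly between |q| and 1, so neither s nor - s is a power of q;
  and - 1 is none because 1 is the only power in the annulus around the unit circle.\<close>

lemma ndep_roots: "ndep 1 (- 1)" "ndep 1 (- 1 / s)" "ndep (- 1) (- 1 / s)"
proof -
  have s1: "norm s < 1" "norm q < norm s"
  proof -
    have "norm s ^ 2 < 1" using q_lt1 s2 by (metis norm_power)
    then show "norm s < 1" by (simp add: power_less_one_iff)
    then show "norm q < norm s" using s_nz by (simp add: ss[symmetric] norm_mult)
  qed
  show "ndep 1 (- 1)" unfolding ndep_def
  proof (intro allI notI)
    fix k :: int assume "1 = - 1 * q powi k"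
    then have e: "- 1 = q powi k" by (simp add: minus_equation_iff)
    have n: "norm q < norm (- 1 :: complex)" "norm (- 1 :: complex) < 1 / norm q" using q_lt1 q_nz by simp_all
    show False using qpowi_near_1[OF e n] by simp
  qed
  have "ndep (s * (- 1)) 1" "ndep (s * 1) 1" using s1 by (intro ndep_norm; simp)+
  then show "ndep 1 (- 1 / s)" "ndep (- 1) (- 1 / s)"
    using s_nz ndep_scale[of "- s" 1 "- 1 / s"] ndep_scale[of "- s" "- 1" "- 1 / s"] by simp_all
qed

text \<open>Consecutive factors pair up: 1 - A^2 q^(2 k) and 1 - A^2 q^(2 k + 1) are differences of
  squares, the second one by q = s^2.\<close>

lemma qfin_square: "qfin (A\<^sup>2) (2 * k) = qfin A k * qfin (- A) k * (qfin (s * A) k * qfin (- (s * A)) k)"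
proof (induction k)
  case (Suc k)
  have e: "2 * Suc k = Suc (Suc (2 * k))" by simp
  have f: "(1 - A\<^sup>2 * q ^ (2 * k)) * (1 - A\<^sup>2 * q ^ Suc (2 * k))
     = (1 - A * q ^ k) * (1 - (- A) * q ^ k) * ((1 - s * A * q ^ k) * (1 - (- (s * A)) * q ^ k))"
  proof -
    have "q ^ (2 * k) = q ^ k * q ^ k" by (simp add: mult_2 power_add)
    moreover have "(1 - s * A * q ^ k) * (1 - (- (s * A)) * q ^ k) = 1 - s * s * A * A * q ^ k * q ^ k" by (simp add: algebra_simps)
    ultimately show ?thesis by (simp add: ss ssx power2_eq_square algebra_simps)
  qed
  have "qfin (A\<^sup>2) (2 * Suc k) = qfin (A\<^sup>2) (2 * k) * ((1 - A\<^sup>2 * q ^ (2 * k)) * (1 - A\<^sup>2 * q ^ Suc (2 * k)))"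
    unfolding e qfin_Suc by (simp only: mult.assoc)
  then show ?case unfolding Suc f qfin_Suc by (simp only: mult_ac)
qed simp

lemma qinf_square: "qinf (A\<^sup>2) = qinf A * qinf (- A) * (qinf (s * A) * qinf (- (s * A)))"
proof -
  have "(\<lambda>k. qfin (A\<^sup>2) (2 * k)) \<longlonglongrightarrow> qinf (A\<^sup>2)"
    using LIMSEQ_subseq_LIMSEQ[OF qfin_LIMSEQ, of "\<lambda>k. 2 * k"] by (simp add: o_def strict_mono_def)
  moreover have "(\<lambda>k. qfin (A\<^sup>2) (2 * k)) \<longlonglongrightarrow> qinf A * qinf (- A) * (qinf (s * A) * qinf (- (s * A)))"
    unfolding qfin_square by (intro tendsto_intros qfin_LIMSEQ)
  ultimately show ?thesis by (rule LIMSEQ_unique)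
qed

text \<open>The denominator list consists of q times the five outer base points and is left
  unsimplified to show this. At x = 1 / y, for a base point y, the entry belonging to y contributes
  (q)_n.\<close>

definition outer_series :: "complex \<Rightarrow> complex \<Rightarrow> complex \<Rightarrow> complex \<Rightarrow> complex" where
  "outer_series A Z B x = (\<Sum>n. q ^ n * qfins [s, A, Z, q / A, q / Z] x n / qfins [q * (1 / B), q * B, q * 1, q * (- 1), q * (- 1 / s)] x n)"

definition inner_series :: "complex \<Rightarrow> complex \<Rightarrow> complex \<Rightarrow> complex \<Rightarrow> complex" where
  "inner_series A Z B x = (\<Sum>n. q ^ n * qfins [B, 1 / B, - s, 1, - 1] x n / qfins [s, q / A, q / Z, A, Z] x n)"

text \<open>Numerator and denominator of the kernel whose residues give the theorem. In the usual form the
  kernel has \<open>(s w)\<^sub>\<infinity>\<^sup>2 / (w\<^sup>2)\<^sub>\<infinity>\<close>; here a factor \<open>(s w)\<^sub>\<infinity>\<close> is cancelled.\<close>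

definition knum :: "complex \<Rightarrow> complex \<Rightarrow> complex \<Rightarrow> complex \<Rightarrow> complex" where
  "knum h A Z w = theta (h * A / w) * theta (h * w / Z) * (qinf (s * w) * qinf (A * w) * qinf (Z * w))"

definition kden :: "complex \<Rightarrow> complex \<Rightarrow> complex \<Rightarrow> complex \<Rightarrow> complex" where
  "kden A Z B w = qinf (B * w) * qinf (w / B) * qinf w * qinf (- w) * qinf (- (s * w)) * (qinf (A / w) * qinf (Z / w))"

lemma qinf_div_q: "qinf (x / q) = (1 - x / q) * qinf x"
  using qinf_split1[of "x / q"] q_nz by simp

text \<open>The two thetas together contribute w^2 / (q A Z), in which h has cancelled. Pulling the
  leading monomial out of every new linear factor gives - m in the numerator and - m / q in the
  denominator, so exactly one q is left.\<close>

lemma kernel_outer_step: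
  assumes nz: "A \<noteq> 0" "Z \<noteq> 0" "B \<noteq> 0" "h \<noteq> 0" "w \<noteq> 0" and D: "kden A Z B w \<noteq> 0"
    and b: "(\<Prod>b\<leftarrow>[q * (1 / B), q * B, q * 1, q * (- 1), q * (- 1 / s)]. 1 - b / w) \<noteq> 0"
  shows "kden A Z B (w / q) \<noteq> 0"
    and "knum h A Z (w / q) / kden A Z B (w / q) * (\<Prod>b\<leftarrow>[q * (1 / B), q * B, q * 1, q * (- 1), q * (- 1 / s)]. 1 - b / w)
      = q * (knum h A Z w / kden A Z B w) * (\<Prod>g\<leftarrow>[s, A, Z, q / A, q / Z]. 1 - g / w)"
proof -
  define b1 b2 b3 b4 b5 where bdef: "b1 = 1 - q * (1 / B) / w" "b2 = 1 - q * B / w" "b3 = 1 - q * 1 / w" "b4 = 1 - q * (- 1) / w" "b5 = 1 - q * (- 1 / s) / w"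
  define g1 g2 g3 where gdef: "g1 = 1 - s / w" "g2 = 1 - q / A / w" "g3 = 1 - q / Z / w"
  define m where "m = s * w ^ 5 / q ^ 4"
  \<comment> \<open>What the denominators at w and at w / q have in common; the remaining 1 - A / w
    and 1 - Z / w become the entries A and Z of the numerator list.\<close>
  define K where "K = qinf (B * w) * qinf (w / B) * qinf w * qinf (- w) * qinf (- (s * w)) * (qinf (q * A / w) * qinf (q * Z / w))"
  have m: "m \<noteq> 0" using nz q_nz s_nz by (simp add: m_def)
  have bs: "(\<Prod>b\<leftarrow>[q * (1 / B), q * B, q * 1, q * (- 1), q * (- 1 / s)]. 1 - b / w) = b1 * b2 * b3 * b4 * b5"
    unfolding bdef by (simp add: mult.assoc)
  have gs: "(\<Prod>g\<leftarrow>[s, A, Z, q / A, q / Z]. 1 - g / w) = g1 * (1 - A / w) * (1 - Z / w) * g2 * g3"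
    unfolding gdef by (simp add: mult.assoc)
  have bnz: "b1 * b2 * b3 * b4 * b5 \<noteq> 0" using b unfolding bs .
  have f: "1 - B * w / q = - (B * w / q) * b1" "1 - w / B / q = - (w / B / q) * b2" "1 - w / q = - (w / q) * b3"
    "1 - - w / q = (w / q) * b4" "1 - - (s * w) / q = (s * w / q) * b5"
    unfolding bdef using nz q_nz s_nz by (simp_all add: field_simps)
  have fg: "1 - s * w / q = - (s * w / q) * g1" "1 - A * w / q = - (A * w / q) * g2" "1 - Z * w / q = - (Z * w / q) * g3"
    unfolding gdef using nz q_nz s_nz by (simp_all add: field_simps ss ssx)
  have aw: "qinf (A / w) = (1 - A / w) * qinf (q * A / w)" "qinf (Z / w) = (1 - Z / w) * qinf (q * Z / w)"
    using qinf_split1[of "A / w"] qinf_split1[of "Z / w"] by (simp_all add: mult.commute)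
  have D0: "kden A Z B w = K * ((1 - A / w) * (1 - Z / w))"
    unfolding kden_def K_def aw by (simp only: mult_ac)
  have D1: "kden A Z B (w / q) = - (m / q) * (b1 * b2 * b3 * b4 * b5) * K"
  proof -
    have "kden A Z B (w / q) = qinf (B * w / q) * qinf (w / B / q) * qinf (w / q) * qinf (- w / q) * qinf (- (s * w) / q) * (qinf (q * A / w) * qinf (q * Z / w))"
      unfolding kden_def using q_nz by (simp add: mult_ac)
    also have "\<dots> = - (m / q) * (b1 * b2 * b3 * b4 * b5) * K"
      unfolding qinf_div_q f K_def m_def using nz q_nz by (simp add: eval_nat_numeral field_simps)
    finally show ?thesis .
  qed
  have N1: "knum h A Z (w / q) = - m * (g1 * g2 * g3) * knum h A Z w"
  proof -
    have t1: "theta (h * A / (w / q)) = - theta (h * A / w) * (w / (h * A))"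
      using theta_shift[of "h * A / w"] nz by (simp add: field_simps)
    have t2: "theta (h * (w / q) / Z) = - theta (h * w / Z) * (h * w / (q * Z))"
      using theta_shift'[of "h * w / Z"] nz q_nz by (simp add: field_simps)
    have "knum h A Z (w / q) = (theta (h * A / w) * theta (h * w / Z) * (w / (h * A) * (h * w / (q * Z)))) * (qinf (s * w / q) * qinf (A * w / q) * qinf (Z * w / q))"
      unfolding knum_def t1 t2 by (simp add: mult_ac)
    also have "\<dots> = - m * (g1 * g2 * g3) * knum h A Z w"
      unfolding qinf_div_q fg knum_def m_def using nz q_nz by (simp add: eval_nat_numeral field_simps)
    finally show ?thesis .
  qed
  have KAZ: "K \<noteq> 0" "1 - A / w \<noteq> 0" "1 - Z / w \<noteq> 0" using D unfolding D0 by auto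
  show "kden A Z B (w / q) \<noteq> 0" unfolding D1 using m bnz KAZ q_nz by simp
  have cancel: "q * (n / K) * (g1 * g2 * g3) = q * (n / (K * (X * Y))) * (g1 * X * Y * g2 * g3)"
    if "K \<noteq> 0" "X \<noteq> 0" "Y \<noteq> 0" for n X Y K
    using that by (simp add: field_simps)
  have "knum h A Z (w / q) / kden A Z B (w / q) * (b1 * b2 * b3 * b4 * b5) = q * (knum h A Z w / K) * (g1 * g2 * g3)"
    unfolding D1 N1 using m bnz q_nz by (simp add: divide_simps)
  also have "\<dots> = q * (knum h A Z w / kden A Z B w) * (g1 * (1 - A / w) * (1 - Z / w) * g2 * g3)"
    unfolding D0 using KAZ by (intro cancel)
  finally show "knum h A Z (w / q) / kden A Z B (w / q) * (\<Prod>b\<leftarrow>[q * (1 / B), q * B, q * 1, q * (- 1), q * (- 1 / s)]. 1 - b / w)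
      = q * (knum h A Z w / kden A Z B w) * (\<Prod>g\<leftarrow>[s, A, Z, q / A, q / Z]. 1 - g / w)" unfolding bs gs .
qed

text \<open>In this direction the thetas contribute A Z / (q w^2), again without h.\<close>

lemma kernel_inner_step:
  assumes nz: "A \<noteq> 0" "Z \<noteq> 0" "B \<noteq> 0" "h \<noteq> 0" "w \<noteq> 0" and D: "kden A Z B w \<noteq> 0"
    and b: "(\<Prod>b\<leftarrow>[s, q / A, q / Z, A, Z]. 1 - b * w) \<noteq> 0"
  shows "kden A Z B (w * q) \<noteq> 0"
    and "knum h A Z (w * q) / kden A Z B (w * q) * (\<Prod>b\<leftarrow>[s, q / A, q / Z, A, Z]. 1 - b * w)
      = q * (knum h A Z w / kden A Z B w) * (\<Prod>g\<leftarrow>[B, 1 / B, - s, 1, - 1]. 1 - g * w)"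
proof -
  define c1 c2 c3 c4 c5 where cdef: "c1 = 1 - s * w" "c2 = 1 - q / A * w" "c3 = 1 - q / Z * w" "c4 = 1 - A * w" "c5 = 1 - Z * w"
  define d where "d = (1 - B * w) * (1 - w / B) * (1 - w) * (1 - - w) * (1 - - (s * w))"
  define K where "K = qinf (B * w * q) * qinf (w / B * q) * qinf (w * q) * qinf (- w * q) * qinf (- (s * w) * q) * (qinf (A / w) * qinf (Z / w))"
  define M where "M = theta (h * A / w) * theta (h * w / Z) * (qinf (s * w * q) * qinf (A * w * q) * qinf (Z * w * q))"
  have cs: "(\<Prod>b\<leftarrow>[s, q / A, q / Z, A, Z]. 1 - b * w) = c1 * c2 * c3 * c4 * c5"
    unfolding cdef by (simp add: mult.assoc)
  have ds: "(\<Prod>g\<leftarrow>[B, 1 / B, - s, 1, - 1]. 1 - g * w) = d" unfolding d_def by (simp add: mult_ac)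
  have cnz: "c1 * c2 * c3 * c4 * c5 \<noteq> 0" using b unfolding cs .
  have D0: "kden A Z B w = d * K"
    unfolding kden_def d_def K_def
    by (subst qinf_split1[of "B * w"], subst qinf_split1[of "w / B"], subst qinf_split1[of w], subst qinf_split1[of "- w"], subst qinf_split1[of "- (s * w)"])
       (simp only: mult_ac)
  have f: "1 - A / w / q = - (A / (w * q)) * c2" "1 - Z / w / q = - (Z / (w * q)) * c3"
    unfolding cdef using nz q_nz by (simp_all add: field_simps)
  have D1: "kden A Z B (w * q) = A * Z / (w * q)\<^sup>2 * (c2 * c3) * K"
  proof -
    have "kden A Z B (w * q) = qinf (B * w * q) * qinf (w / B * q) * qinf (w * q) * qinf (- w * q) * qinf (- (s * w) * q) * (qinf (A / w / q) * qinf (Z / w / q))"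
      unfolding kden_def by (simp add: mult_ac)
    also have "\<dots> = A * Z / (w * q)\<^sup>2 * (c2 * c3) * K"
      unfolding qinf_div_q f K_def by (simp add: power2_eq_square mult_ac)
    finally show ?thesis .
  qed
  have N0: "knum h A Z w = (c1 * c4 * c5) * M"
    unfolding knum_def M_def cdef
    by (subst qinf_split1[of "s * w"], subst qinf_split1[of "A * w"], subst qinf_split1[of "Z * w"]) (simp only: mult_ac)
  have N1: "knum h A Z (w * q) = A * Z / (q * w\<^sup>2) * M"
  proof -
    have t1: "theta (h * A / (w * q)) = - theta (h * A / w) * (h * A / (w * q))"
      using theta_shift'[of "h * A / w"] nz q_nz by (simp add: field_simps)
    have t2: "theta (h * (w * q) / Z) = - theta (h * w / Z) * (Z / (h * w))"
      using theta_shift[of "h * w / Z"] nz by (simp add: field_simps)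
    show ?thesis unfolding knum_def t1 t2 M_def using nz by (simp add: power2_eq_square mult_ac)
  qed
  have nz': "K \<noteq> 0" "d \<noteq> 0" using D unfolding D0 by auto
  show "kden A Z B (w * q) \<noteq> 0" unfolding D1 using nz q_nz nz' cnz by simp
  have "knum h A Z (w * q) / kden A Z B (w * q) * (c1 * c2 * c3 * c4 * c5) = q * (c1 * c4 * c5 * M / K)"
    unfolding D1 N1 using cnz nz q_nz nz' by (simp add: divide_simps power2_eq_square)
  also have "\<dots> = q * (knum h A Z w / kden A Z B w) * d"
    unfolding D0 N0 using nz' by (simp add: divide_simps)
  finally show "knum h A Z (w * q) / kden A Z B (w * q) * (\<Prod>b\<leftarrow>[s, q / A, q / Z, A, Z]. 1 - b * w)
      = q * (knum h A Z w / kden A Z B w) * (\<Prod>g\<leftarrow>[B, 1 / B, - s, 1, - 1]. 1 - g * w)" unfolding cs ds .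
qed

text \<open>Splitting (A^2)_(2k) supplies the parameters 1, - 1 and - s of the residue series at w =
  A; the fourth factor, (s A)_k, cancels one of the two that come from the squared tail of (s
  A).\<close>

lemma clausen_part_inner:
  assumes sA: "qinf (s * A) \<noteq> 0"
    and that: "A \<noteq> 0" "qinf (A\<^sup>2) \<noteq> 0" "qinf (A * Z) \<noteq> 0" "qinf (q * A / Z) \<noteq> 0"
  shows "clausen_part A Z B = qinf (Z * B) * qinf (Z / B) * (qinf (s * A) ^ 2 * qinf (A * Z) / qinf (Z / A)) * inner_series A Z B A"
proof -
  have nzk: "qfin (s * A) k \<noteq> 0" "qfin (A * Z) k \<noteq> 0" for k using sA that qfin_nz_if_qinf_nz by auto
  have t: "qfin (A * B) k * qfin (A / B) k * clausen_term A Z k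
     = qinf (s * A) ^ 2 * qinf (A * Z) / qinf (Z / A) * (q ^ k * qfins [B, 1 / B, - s, 1, - 1] A k / qfins [s, q / A, q / Z, A, Z] A k)" for k
  proof -
    have e1: "qinf (s * A) = qfin (s * A) k * qinf (s * A * q ^ k)" "qinf (A * Z) = qfin (A * Z) k * qinf (A * Z * q ^ k)"
      by (rule qinf_split)+
    have e2: "qfins [B, 1 / B, - s, 1, - 1] A k = qfin (A * B) k * qfin (A / B) k * (qfin (- (s * A)) k * qfin A k * qfin (- A) k)"
      "qfins [s, q / A, q / Z, A, Z] A k = qfin (s * A) k * qfin q k * qfin (q * A / Z) k * qfin (A\<^sup>2) k * qfin (A * Z) k"
      using that(1) by (simp_all add: qfins_def mult_ac power2_eq_square)
    have gen: "X * Y * ((u\<^sup>2 * w * (p1 * p2 * (v * v')) / (Q * A2)) * (qk / (r * t)))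
       = (v * u)\<^sup>2 * (x * w) / r * (qk * (X * Y * (v' * p1 * p2)) / (v * Q * t * A2 * x))"
      if "v \<noteq> 0" "x \<noteq> 0" for X Y u w p1 p2 v v' Q A2 qk r t x :: complex
    proof -
      have c: "c * P / r * (R / (c * S)) = P * R / (r * S)" if "c \<noteq> 0" for c P R S
        using that by simp
      have "(v * u)\<^sup>2 * (x * w) / r * (qk * (X * Y * (v' * p1 * p2)) / (v * Q * t * A2 * x))
          = (v * x) * (v * u\<^sup>2 * w) / r * (qk * (X * Y * (v' * p1 * p2)) / ((v * x) * (Q * t * A2)))"
        by (simp only: power2_eq_square mult_ac)
      also have "\<dots> = v * u\<^sup>2 * w * (qk * (X * Y * (v' * p1 * p2))) / (r * (Q * t * A2))"
        using that by (intro c) simp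
      finally show ?thesis by (simp only: times_divide_eq_left times_divide_eq_right divide_divide_eq_left mult_ac)
    qed
    show ?thesis
      unfolding clausen_term_def qfin_square e2 unfolding e1 using nzk[of k] by (intro gen)
  qed
  have "summable (\<lambda>k. norm (q ^ k * qfins [B, 1 / B, - s, 1, - 1] A k / qfins [s, q / A, q / Z, A, Z] A k))"
    using that sA by (intro qfins_quot_summable) (auto simp: power2_eq_square mult_ac)
  then have "summable (\<lambda>k. q ^ k * qfins [B, 1 / B, - s, 1, - 1] A k / qfins [s, q / A, q / Z, A, Z] A k)"
    by (rule summable_norm_cancel)
  then show ?thesis
    unfolding clausen_part_def t inner_series_def by (subst suminf_mult) (simp_all add: mult_ac)
qed

end

section \<open>The five-term expansion\<close>

lemma sum_five:
  fixes F :: "'a \<Rightarrow> complex"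
  assumes "distinct [x1, x2, x3, x4, x5]"
  shows "(\<Sum>b\<in>{x1, x2, x3, x4, x5}. F b) = F x1 + F x2 + F x3 + F x4 + F x5"
  using assms by simp

lemma prod_five_diff:
  fixes g :: "'a \<Rightarrow> complex"
  assumes "distinct [x1, x2, x3, x4, x5]"
  shows "(\<Prod>b\<in>{x1, x2, x3, x4, x5} - {x1}. g b) = g x2 * g x3 * g x4 * g x5"
    and "(\<Prod>b\<in>{x1, x2, x3, x4, x5} - {x2}. g b) = g x1 * g x3 * g x4 * g x5"
    and "(\<Prod>b\<in>{x1, x2, x3, x4, x5} - {x3}. g b) = g x1 * g x2 * g x4 * g x5"
    and "(\<Prod>b\<in>{x1, x2, x3, x4, x5} - {x4}. g b) = g x1 * g x2 * g x3 * g x5"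
    and "(\<Prod>b\<in>{x1, x2, x3, x4, x5} - {x5}. g b) = g x1 * g x2 * g x3 * g x4"
    and "(\<Prod>b\<in>{x1, x2, x3, x4, x5}. g b) = g x1 * g x2 * g x3 * g x4 * g x5"
proof -
  have "x2 \<noteq> x1" "x3 \<noteq> x1" "x4 \<noteq> x1" "x5 \<noteq> x1" "x3 \<noteq> x2" "x4 \<noteq> x2" "x5 \<noteq> x2" "x4 \<noteq> x3" "x5 \<noteq> x3" "x5 \<noteq> x4"
    using assms by auto
  note n = this this[symmetric]
  show "(\<Prod>b\<in>{x1, x2, x3, x4, x5} - {x1}. g b) = g x2 * g x3 * g x4 * g x5"
    and "(\<Prod>b\<in>{x1, x2, x3, x4, x5} - {x2}. g b) = g x1 * g x3 * g x4 * g x5"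
    and "(\<Prod>b\<in>{x1, x2, x3, x4, x5} - {x3}. g b) = g x1 * g x2 * g x4 * g x5"
    and "(\<Prod>b\<in>{x1, x2, x3, x4, x5} - {x4}. g b) = g x1 * g x2 * g x3 * g x5"
    and "(\<Prod>b\<in>{x1, x2, x3, x4, x5} - {x5}. g b) = g x1 * g x2 * g x3 * g x4"
    and "(\<Prod>b\<in>{x1, x2, x3, x4, x5}. g b) = g x1 * g x2 * g x3 * g x4 * g x5"
    by (simp_all add: n insert_Diff_if mult.assoc)
qed

context qsqrt
begin

text \<open>The points 1, - 1 and - 1 / s have squares 1, 1 and 1 / q, so every relation between
  them and B or 1 / B would make B^2 a power of q.\<close>

lemma ndep_outer:
  assumes B: "B \<noteq> 0" and B2: "ndep (B\<^sup>2) 1"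
  shows "ndep (1 / B) B" "ndep (1 / B) 1" "ndep (1 / B) (- 1)" "ndep (1 / B) (- 1 / s)"
    "ndep B 1" "ndep B (- 1)" "ndep B (- 1 / s)"
proof -
  have qs: "(- 1 / s)\<^sup>2 = 1 * q powi (- 1)" by (simp add: power_divide s2 power_int_minus inverse_eq_divide)
  have e: "ndep (B\<^sup>2) (1 * q powi (- 1))" by (rule ndep_q[OF B2])
  show "ndep (1 / B) B"
    using ndep_scale[OF B, of "1 / B" B] ndep_sym[OF B2] B by (simp add: power2_eq_square)
  show b1: "ndep B 1" using ndep_square[of B 1] B2 by simp
  show b2: "ndep B (- 1)" using ndep_square[of B "- 1"] B2 by simp
  show "ndep B (- 1 / s)" using ndep_square[of B "- 1 / s"] e unfolding qs .
  show "ndep (1 / B) 1" using ndep_scale[OF B, of "1 / B" 1] ndep_sym[OF b1] B by simp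
  have "- B \<noteq> 0" using B by simp
  from ndep_scale[OF this, of "1 / B" "- 1"] ndep_sym[OF b2] B
  show "ndep (1 / B) (- 1)" by simp
  have "ndep (B\<^sup>2) ((- s)\<^sup>2)" using ndep_q[OF B2, of 1] by (simp add: s2)
  then have "ndep B (- s)" by (rule ndep_square)
  then have "ndep (- s) B" by (rule ndep_sym)
  moreover have "- (s * B) \<noteq> 0" using B s_nz by simp
  ultimately show "ndep (1 / B) (- 1 / s)"
    using ndep_scale[of "- (s * B)" "1 / B" "- 1 / s"] B s_nz by simp
qed

lemma ndep_unit_roots:
  assumes A2: "ndep (A\<^sup>2) 1"
  shows "ndep A 1" "ndep A (- 1)" "ndep A (- 1 / s)"
proof -
  have qs: "(- 1 / s)\<^sup>2 = 1 * q powi (- 1)" by (simp add: power_divide s2 power_int_minus inverse_eq_divide)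
  show "ndep A 1" using ndep_square[of A 1] A2 by simp
  show "ndep A (- 1)" using ndep_square[of A "- 1"] A2 by simp
  show "ndep A (- 1 / s)" using ndep_square[of A "- 1 / s"] ndep_q[OF A2, of "- 1"] unfolding qs .
qed

text \<open>The argument is q y' / y for two base points: it is q if they coincide, and no power of
  q otherwise.\<close>

lemma outer_series_denominator:
  assumes B: "B \<noteq> 0" and B2: "ndep (B\<^sup>2) 1"
    and y: "y \<in> {1 / B, B, 1, - 1, - 1 / s}"
    and x: "x \<in> set [q * (1 / B), q * B, q * 1, q * (- 1), q * (- 1 / s)]"
  shows "qinf (x * (1 / y)) \<noteq> 0"
proof -
  have "x \<in> (\<lambda>y. q * y) ` {1 / B, B, 1, - 1, - 1 / s}" using x by simp
  then obtain y' where y': "y' \<in> {1 / B, B, 1, - 1, - 1 / s}" "x = q * y'" by blast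
  have y0: "y \<noteq> 0" using y B s_nz by auto
  note nd = ndep_outer[OF B B2] ndep_roots
  have "y' = y \<or> ndep y' y" using y y'(1) nd nd[THEN ndep_sym] by (elim insertE emptyE) simp_all
  then show ?thesis
    using ndep_qinf_ratio[OF y0, of y'] y'(2) y0 by auto
qed

text \<open>The fractions are left unsimplified so that the five summands are literally the contributions
  of the base points \<open>1 / B\<close>, \<open>B\<close>, \<open>1\<close>, \<open>- 1\<close>, \<open>- 1 / s\<close>.\<close>

definition outer_sum :: "complex \<Rightarrow> complex \<Rightarrow> complex \<Rightarrow> complex \<Rightarrow> complex" where
  "outer_sum h A Z B =
    theta (h * A / (1 / B)) * theta (h * (1 / B) / Z) * (qinf (A / B) ^ 2 * qinf (Z / B) ^ 2)
      * (qinf (s * (1 / B)) / (qinf (1 / B / B) * qinf (1 / B / 1) * qinf (1 / B / (- 1)) * qinf (1 / B / (- 1 / s)))) * outer_series A Z B (1 / (1 / B))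
  + theta (h * A / B) * theta (h * B / Z) * (qinf (A * B) ^ 2 * qinf (Z * B) ^ 2)
      * (qinf (s * B) / (qinf (B / (1 / B)) * qinf (B / 1) * qinf (B / (- 1)) * qinf (B / (- 1 / s)))) * outer_series A Z B (1 / B)
  + theta (h * A / 1) * theta (h * 1 / Z) * (qinf (A * B) * qinf (A / B) * (qinf (Z * B) * qinf (Z / B)))
      * (qinf (s * 1) / (qinf (1 / (1 / B)) * qinf (1 / B) * qinf (1 / (- 1)) * qinf (1 / (- 1 / s)))) * outer_series A Z B (1 / 1)
  + theta (h * A / (- 1)) * theta (h * (- 1) / Z) * (qinf (A * B) * qinf (A / B) * (qinf (Z * B) * qinf (Z / B)))
      * (qinf (s * (- 1)) / (qinf (- 1 / (1 / B)) * qinf (- 1 / B) * qinf (- 1 / 1) * qinf (- 1 / (- 1 / s)))) * outer_series A Z B (1 / (- 1))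
  + theta (h * A / (- 1 / s)) * theta (h * (- 1 / s) / Z) * ((1 + A / s) * (1 + Z / s) * (qinf (A * B) * qinf (A / B) * (qinf (Z * B) * qinf (Z / B))))
      * (qinf (s * (- 1 / s)) / (qinf (- 1 / s / (1 / B)) * qinf (- 1 / s / B) * qinf (- 1 / s / 1) * qinf (- 1 / s / (- 1)))) * outer_series A Z B (1 / (- 1 / s))"

text \<open>The bound |s| < |A| places A^2 in the annulus |q| < |A^2| < 1, which makes A independent
  of 1, - 1 and - 1 / s; the same holds for Z. It also implies |q| < |A|, as the q-Clausen formula
  requires.\<close>

theorem clausen_outer_generic:
  assumes A: "norm s < norm A" "norm A < 1" and Z: "norm s < norm Z" "norm Z < 1" and h: "h \<noteq> 0"
    and B: "B \<noteq> 0" and B2: "ndep (B\<^sup>2) 1"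
    and ZA: "ndep Z A" and AB: "ndep (A * B) 1" "ndep (A / B) 1" and ZB: "ndep (Z * B) 1" "ndep (Z / B) 1"
  shows "theta h * theta (h * A / Z) * ghat A Z B ^ 2 = outer_sum h A Z B"
proof -
  have s1: "norm s < 1" using A by linarith
  have qs: "norm q = norm s * norm s" by (simp add: ss[symmetric] norm_mult)
  have qls: "norm q \<le> norm s" unfolding qs using s1 by (simp add: mult_left_le)
  have A0: "A \<noteq> 0" and Z0: "Z \<noteq> 0" using A(1) Z(1) by auto
  have sq: "ndep (X\<^sup>2) 1" if "norm s < norm X" "norm X < 1" for X
  proof (rule ndep_norm)
    have "norm s * norm s < norm X * norm X" using that(1) by (intro mult_strict_mono) auto
    then show "norm q < norm (X\<^sup>2)" by (simp add: qs norm_power power2_eq_square norm_mult)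
    show "norm (X\<^sup>2) < 1" using that(2) by (simp add: norm_power power_less_one_iff)
  qed
  note A2 = sq[OF A] and Z2 = sq[OF Z]
  have AB': "ndep A (1 / B)" "ndep A B" "ndep Z (1 / B)" "ndep Z B"
    using ndep_scale[OF B, of A "1 / B"] ndep_scale[of "1 / B" A B] ndep_scale[OF B, of Z "1 / B"] ndep_scale[of "1 / B" Z B]
      AB ZB B by (simp_all add: mult.commute)
  note nd = ndep_outer[OF B B2] ndep_roots ndep_unit_roots[OF A2] ndep_unit_roots[OF Z2] AB' ZA
  note neq = nd[THEN ndep_neq]
  define Ou where "Ou = {1 / B, B, 1, - 1, - 1 / s}"
  define In where "In = {A, Z}"
  have dist: "distinct [1 / B, B, 1, - 1, - 1 / s]" using neq by simp
  have nz: "0 \<notin> Ou \<union> In" using B s_nz A0 Z0 by (auto simp: Ou_def In_def)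
  have disj: "Ou \<inter> In = {}" using neq by (auto simp: Ou_def In_def)
  have indep: "x \<noteq> y * q powi k" if "x \<in> Ou \<union> In" "y \<in> Ou \<union> In" "x \<noteq> y" for x y and k :: int
  proof -
    have "x = y \<or> ndep x y"
      using that(1,2) nd nd[THEN ndep_sym] unfolding Ou_def In_def by (elim UnE insertE emptyE) simp_all
    then show ?thesis using that(3) by (auto simp: ndep_def)
  qed
  have prodO: "(\<Prod>b\<in>Ou. qinf (w / b)) = qinf (B * w) * qinf (w / B) * qinf w * qinf (- w) * qinf (- (s * w))" for w
    unfolding Ou_def prod_five_diff(6)[OF dist] by (simp add: mult.commute)
  have AZ: "A \<noteq> Z" using neq by auto
  have kden: "kden A Z B w = (\<Prod>b\<in>Ou. qinf (w / b)) * (\<Prod>c\<in>In. qinf (c / w))" for w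
    unfolding prodO kden_def In_def using AZ by simp
  have hol: "knum h A Z holomorphic_on - {0}"
    unfolding knum_def using h A0 Z0 by (intro holomorphic_intros) auto
  have cs: "qinf (x * c) \<noteq> 0" if "c \<in> In" "x \<in> set [s, q / A, q / Z, A, Z]" for c x
  proof -
    have *: "qinf (s * X) \<noteq> 0" "qinf (X * Y) \<noteq> 0" if "norm X < 1" "norm Y < 1" for X Y
    proof -
      show "qinf (s * X) \<noteq> 0" using that by (intro sA_small)
      have "norm X * norm Y \<le> 1 * norm Y" using that by (intro mult_right_mono) auto
      then have "norm (X * Y) < 1" unfolding norm_mult using that(2) by linarith
      then show "qinf (X * Y) \<noteq> 0" by (rule qinf_neq_0)
    qed
    have r: "qinf (q / A * Z) \<noteq> 0" "qinf (q / Z * A) \<noteq> 0" "qinf (q / A * A) \<noteq> 0" "qinf (q / Z * Z) \<noteq> 0"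
      using ndep_qinf_ratio[OF A0 ZA] ndep_qinf_ratio[OF Z0 ndep_sym[OF ZA]] A0 Z0 by (simp_all add: mult_ac)
    show ?thesis using that r *[OF A(2) A(2)] *[OF A(2) Z(2)] *[OF Z(2) Z(2)] *[OF Z(2) A(2)]
      unfolding In_def by (auto simp: mult_ac)
  qed
  have bil: "(\<Sum>b\<in>Ou. knum h A Z b / ((\<Prod>b'\<in>Ou - {b}. qinf (b / b')) * (\<Prod>c\<in>In. qinf (c / b)))
        * outer_series A Z B (1 / b))
    = (\<Sum>c\<in>In. knum h A Z c / ((\<Prod>b\<in>Ou. qinf (c / b)) * (\<Prod>c'\<in>In - {c}. qinf (c' / c)))
        * inner_series A Z B c)"
    unfolding outer_series_def inner_series_def
  proof (rule bilateral_sum[where D = "kden A Z B" and H = "\<lambda>w. knum h A Z w / kden A Z B w", OF _ _ disj nz indep hol kden refl])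
    show "finite Ou" "finite In" by (simp_all add: Ou_def In_def)
    fix w :: complex assume w: "w \<noteq> 0" and D: "kden A Z B w \<noteq> 0"
    show "kden A Z B (w / q) \<noteq> 0 \<and> knum h A Z (w / q) / kden A Z B (w / q) * (\<Prod>b\<leftarrow>[q * (1 / B), q * B, q * 1, q * (- 1), q * (- 1 / s)]. 1 - b / w)
      = q * (knum h A Z w / kden A Z B w) * (\<Prod>g\<leftarrow>[s, A, Z, q / A, q / Z]. 1 - g / w)"
      if b: "(\<Prod>b\<leftarrow>[q * (1 / B), q * B, q * 1, q * (- 1), q * (- 1 / s)]. 1 - b / w) \<noteq> 0"
      using kernel_outer_step[OF A0 Z0 B h w D b] by blast
    show "kden A Z B (w * q) \<noteq> 0 \<and> knum h A Z (w * q) / kden A Z B (w * q) * (\<Prod>b\<leftarrow>[s, q / A, q / Z, A, Z]. 1 - b * w)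
      = q * (knum h A Z w / kden A Z B w) * (\<Prod>g\<leftarrow>[B, 1 / B, - s, 1, - 1]. 1 - g * w)"
      if b: "(\<Prod>b\<leftarrow>[s, q / A, q / Z, A, Z]. 1 - b * w) \<noteq> 0"
      using kernel_inner_step[OF A0 Z0 B h w D b] by blast
  next
    show "qinf (x * (1 / b)) \<noteq> 0" if "b \<in> Ou" "x \<in> set [q * (1 / B), q * B, q * 1, q * (- 1), q * (- 1 / s)]" for b x
      using outer_series_denominator[OF B B2 _ that(2)] that(1) unfolding Ou_def by blast
  qed (assumption | erule (1) cs)+
  \<comment> \<open>Multiplication by Q clears the denominator factors that contain B together with
    A or Z. The prefactors in the outer sum are then free of denominators that could vanish for
    special A or Z, as the continuation needs.\<close>
  define Q where "Q = qinf (A * B) * qinf (A / B) * (qinf (Z * B) * qinf (Z / B))"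
  have nzB: "qinf (A * B) \<noteq> 0" "qinf (A / B) \<noteq> 0" "qinf (Z * B) \<noteq> 0" "qinf (Z / B) \<noteq> 0"
    by (rule ndep_qinf[OF AB(1)] ndep_qinf[OF AB(2)] ndep_qinf[OF ZB(1)] ndep_qinf[OF ZB(2)])+
  have small: "qinf X \<noteq> 0" "qinf (- X) \<noteq> 0" "qinf (s * X) \<noteq> 0" "qinf (- (s * X)) \<noteq> 0" if "norm X < 1" for X
    using that sA_small[of X] sA_small[of "- X"] qinf_neq_0[of X] qinf_neq_0[of "- X"] by simp_all
  have inner1: "Q * (theta h * theta (h * A / Z) * (qinf (s * X) * qinf (X\<^sup>2) * qinf (X * Y)) / ((\<Prod>b\<in>Ou. qinf (X / b)) * qinf (Y / X)) * inner_series X Y B X)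
      = theta h * theta (h * A / Z) * clausen_part X Y B"
    if X: "X \<noteq> 0" "norm X < 1" "qinf (X * B) \<noteq> 0" "qinf (X / B) \<noteq> 0" and Y: "Y \<noteq> 0" "norm Y < 1" and XY: "ndep X Y"
      and Q: "Q = qinf (X * B) * qinf (X / B) * (qinf (Y * B) * qinf (Y / B))" for X Y
  proof -
    have "norm X * norm Y \<le> 1 * norm Y" using X Y by (intro mult_right_mono) auto
    then have "norm (X * Y) < 1" unfolding norm_mult using Y(2) by linarith
    then have xy: "qinf (X * Y) \<noteq> 0" by (rule qinf_neq_0)
    have cp: "clausen_part X Y B = qinf (Y * B) * qinf (Y / B) * (qinf (s * X) ^ 2 * qinf (X * Y) / qinf (Y / X)) * inner_series X Y B X"
      using ndep_qinf_ratio[OF Y(1) XY] by (intro clausen_part_inner small(3) X xy qinf_sq_nz) (simp add: mult_ac)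
    show ?thesis unfolding cp prodO Q qinf_square using small[OF X(2)] X
      by (simp add: power2_eq_square mult.commute[of B])
  qed
  have commute: "inner_series A Z B Z = inner_series Z A B Z"
    unfolding inner_series_def by (simp add: qfins_def mult_ac)
  have kA: "knum h A Z A = theta h * theta (h * A / Z) * (qinf (s * A) * qinf (A\<^sup>2) * qinf (A * Z))"
    and kZ: "knum h A Z Z = theta h * theta (h * A / Z) * (qinf (s * Z) * qinf (Z\<^sup>2) * qinf (Z * A))"
    unfolding knum_def using A0 Z0 by (simp_all add: power2_eq_square mult_ac)
  have rhs: "Q * (\<Sum>c\<in>In. knum h A Z c / ((\<Prod>b\<in>Ou. qinf (c / b)) * (\<Prod>c'\<in>In - {c}. qinf (c' / c)))
        * inner_series A Z B c) = theta h * theta (h * A / Z) * ghat A Z B ^ 2"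
  proof -
    have cl: "ghat A Z B ^ 2 = clausen_part A Z B + clausen_part Z A B"
    proof (rule nonterminating_clausen[OF _ A(2) _ Z(2) _ B])
      show "norm q < norm A" "norm q < norm Z" using qls A Z by auto
      show "Z / A \<noteq> q powi k" for k :: int using ZA A0 by (auto simp: ndep_def field_simps)
    qed
    have i2: "Q * (knum h A Z Z / ((\<Prod>b\<in>Ou. qinf (Z / b)) * qinf (A / Z)) * inner_series A Z B Z)
      = theta h * theta (h * A / Z) * clausen_part Z A B"
      unfolding kZ commute by (rule inner1[OF Z0 Z(2) nzB(3,4) A0 A(2) ZA]) (simp add: Q_def mult_ac)
    have "Q * (\<Sum>c\<in>In. knum h A Z c / ((\<Prod>b\<in>Ou. qinf (c / b)) * (\<Prod>c'\<in>In - {c}. qinf (c' / c))) * inner_series A Z B c)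
      = Q * (knum h A Z A / ((\<Prod>b\<in>Ou. qinf (A / b)) * qinf (Z / A)) * inner_series A Z B A)
       + Q * (knum h A Z Z / ((\<Prod>b\<in>Ou. qinf (Z / b)) * qinf (A / Z)) * inner_series A Z B Z)"
      unfolding In_def using AZ by (simp add: insert_Diff_if distrib_left)
    also have "\<dots> = theta h * theta (h * A / Z) * ghat A Z B ^ 2"
      unfolding i2 cl kA using inner1[OF A0 A(2) nzB(1,2) Z0 Z(2) ndep_sym[OF ZA] Q_def] by (simp add: distrib_left)
    finally show ?thesis .
  qed
  have lhs: "Q * (\<Sum>b\<in>Ou. knum h A Z b / ((\<Prod>b'\<in>Ou - {b}. qinf (b / b')) * (\<Prod>c\<in>In. qinf (c / b)))
        * outer_series A Z B (1 / b)) = outer_sum h A Z B"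
  proof -
    have g1: "x * u * (y * v) * (t * (k * u * v) / (d * (x * y)) * \<Phi>) = t * (u\<^sup>2 * v\<^sup>2) * (k / d) * \<Phi>"
      if "x \<noteq> 0" "y \<noteq> 0" for x u y v t k d \<Phi> :: complex
    proof -
      have "x * u * (y * v) * (t * (k * u * v) / (d * (x * y)) * \<Phi>) = (x * y) * (u * v * t * k * u * v * \<Phi>) / ((x * y) * d)"
        by (simp only: times_divide_eq_left times_divide_eq_right mult_ac)
      also have "\<dots> = (u * v * t * k * u * v * \<Phi>) / d" using that by simp
      finally show ?thesis by (simp add: power2_eq_square mult_ac)
    qed
    have g3: "c * (t * (k * (e * u) * (f * v)) / (d * (u * v)) * \<Phi>) = t * (e * f * c) * (k / d) * \<Phi>"
      if "u \<noteq> 0" "v \<noteq> 0" for c u v t k d e f \<Phi> :: complex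
    proof -
      have "c * (t * (k * (e * u) * (f * v)) / (d * (u * v)) * \<Phi>) = (u * v) * (c * e * f * t * k * \<Phi>) / ((u * v) * d)"
        by (simp only: times_divide_eq_left times_divide_eq_right mult_ac)
      also have "\<dots> = (c * e * f * t * k * \<Phi>) / d" using that by simp
      finally show ?thesis by (simp add: mult_ac)
    qed
    note smallA = small[OF A(2)] and smallZ = small[OF Z(2)]
    have In2: "(\<Prod>c\<in>In. qinf (c / b)) = qinf (A / b) * qinf (Z / b)" for b
      unfolding In_def using AZ by simp
    have t1: "Q * (knum h A Z (1 / B) / (d * (qinf (A / (1 / B)) * qinf (Z / (1 / B)))) * \<Phi>)
      = theta (h * A / (1 / B)) * theta (h * (1 / B) / Z) * (qinf (A / B) ^ 2 * qinf (Z / B) ^ 2) * (qinf (s * (1 / B)) / d) * \<Phi>" for d \<Phi>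
    proof -
      have e: "A * (1 / B) = A / B" "Z * (1 / B) = Z / B" "A / (1 / B) = A * B" "Z / (1 / B) = Z * B" by simp_all
      show ?thesis unfolding knum_def Q_def e(1,2) e(3)[THEN arg_cong[of _ _ qinf]] e(4)[THEN arg_cong[of _ _ qinf]]
        using nzB(1,3) by (intro g1)
    qed
    have t2: "Q * (knum h A Z B / (d * (qinf (A / B) * qinf (Z / B))) * \<Phi>)
      = theta (h * A / B) * theta (h * B / Z) * (qinf (A * B) ^ 2 * qinf (Z * B) ^ 2) * (qinf (s * B) / d) * \<Phi>" for d \<Phi>
    proof -
      have Q': "Q = qinf (A / B) * qinf (A * B) * (qinf (Z / B) * qinf (Z * B))" by (simp add: Q_def mult_ac)
      show ?thesis unfolding knum_def Q' using nzB(2,4) by (intro g1)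
    qed
    have t3: "Q * (knum h A Z 1 / (d * (qinf (A / 1) * qinf (Z / 1))) * \<Phi>)
      = theta (h * A / 1) * theta (h * 1 / Z) * Q * (qinf (s * 1) / d) * \<Phi>" for d \<Phi>
      using g3[OF smallA(1) smallZ(1), of Q "theta (h * A / 1) * theta (h * 1 / Z)" "qinf (s * 1)" 1 1 d \<Phi>]
      by (simp add: knum_def)
    have t4: "Q * (knum h A Z (- 1) / (d * (qinf (A / (- 1)) * qinf (Z / (- 1)))) * \<Phi>)
      = theta (h * A / (- 1)) * theta (h * (- 1) / Z) * Q * (qinf (s * (- 1)) / d) * \<Phi>" for d \<Phi>
      using g3[OF smallA(2) smallZ(2), of Q "theta (h * A / (- 1)) * theta (h * (- 1) / Z)" "qinf (s * (- 1))" 1 1 d \<Phi>]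
      by (simp add: knum_def)
    have t5: "Q * (knum h A Z (- 1 / s) / (d * (qinf (A / (- 1 / s)) * qinf (Z / (- 1 / s)))) * \<Phi>)
      = theta (h * A / (- 1 / s)) * theta (h * (- 1 / s) / Z) * ((1 + A / s) * (1 + Z / s) * Q) * (qinf (s * (- 1 / s)) / d) * \<Phi>" for d \<Phi>
    proof -
      \<comment> \<open>At w = - 1 / s the factorials (X w) and (X / w) start one step apart, whence
        the extra factors 1 + A / s and 1 + Z / s.\<close>
      have e1: "qinf (X * (- 1 / s)) = (1 + X / s) * qinf (- (s * X))" for X
      proof -
        have "X * (- 1 / s) * q = - (s * X)" using s_nz by (simp add: ss[symmetric])
        then show ?thesis using qinf_split1[of "X * (- 1 / s)"] by simp
      qed
      have e2: "X / (- 1 / s) = - (s * X)" for X by (simp add: mult.commute)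
      show ?thesis unfolding knum_def e1 e2[THEN arg_cong[of _ _ qinf]]
        using g3[OF smallA(4) smallZ(4)] .
    qed
    have dl: "Q * (u + v + w + x + y) = Q * u + Q * v + Q * w + Q * x + Q * y" for u v w x y
      by (simp only: distrib_left)
    show ?thesis
      unfolding Ou_def sum_five[OF dist] prod_five_diff(1-5)[OF dist] In2 dl t1 t2 t3 t4 t5
      unfolding outer_sum_def Q_def by (rule refl)
  qed
  show ?thesis using bil lhs rhs by simp
qed

section \<open>Continuation in A and Z\<close>

lemma ghat_holomorphic_A: "(\<lambda>A. ghat A Z B) holomorphic_on UNIV"
  unfolding ghat_def
proof (rule holomorphic_suminf)
  obtain C where C: "\<And>A Z B k. norm (qfin (A * B) k * qfin (A / B) k * (- (s * Z)) ^ k * q ^ tri k / qfin q k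
     * qinf (s * A * q ^ k) * qinf (A * Z * q ^ k))
    \<le> C * (emaj (norm (A * B)) * emaj (norm (A / B)) * emaj (norm (s * A)) * emaj (norm (A * Z)) * (norm q ^ tri k * norm (s * Z) ^ k))"
    using ghat_term_bound by blast
  fix K :: "complex set" assume K: "compact K" "K \<subseteq> UNIV"
  have "bounded K" using K by (simp add: compact_imp_bounded)
  then obtain R where R: "\<And>A. A \<in> K \<Longrightarrow> norm A \<le> R" by (auto simp: bounded_iff)
  have C0: "C \<ge> 0"
    using order_trans[OF norm_ge_zero C[of 0 0 0 0]] by (simp add: zero_le_mult_iff less_imp_le)
       (metis emaj_pos less_le_not_le mult_pos_pos)
  let ?M = "\<lambda>k. C * (emaj (R * norm B) * emaj (R / norm B) * emaj (norm s * R) * emaj (R * norm Z) * (norm q ^ tri k * norm (s * Z) ^ k))"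
  show "\<exists>M. summable M \<and> (\<forall>k. \<forall>A\<in>K. norm (qfin (A * B) k * qfin (A / B) k * (- (s * Z)) ^ k * q ^ tri k / qfin q k
     * qinf (s * A * q ^ k) * qinf (A * Z * q ^ k)) \<le> M k)"
  proof (intro exI[of _ ?M] conjI allI ballI)
    show "summable ?M" by (intro summable_mult qpow_tri_summable) auto
    fix k A assume A: "A \<in> K"
    have R': "norm (A * B) \<le> R * norm B" "norm (A / B) \<le> R / norm B" "norm (s * A) \<le> norm s * R" "norm (A * Z) \<le> R * norm Z"
      using R[OF A] by (auto simp: norm_mult norm_divide intro: mult_right_mono mult_left_mono divide_right_mono)
    show "norm (qfin (A * B) k * qfin (A / B) k * (- (s * Z)) ^ k * q ^ tri k / qfin q k
     * qinf (s * A * q ^ k) * qinf (A * Z * q ^ k)) \<le> ?M k"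
      by (rule order_trans[OF C], intro mult_left_mono mult_right_mono mult_mono emaj_mono R' C0)
         (auto intro: less_imp_le)
  qed
qed (auto intro!: holomorphic_intros)

text \<open>Only two factors of each term depend on A, and they are bounded on compact sets
  uniformly in n; the rest is absolutely summable.\<close>

lemma outer_series_holomorphic_A:
  assumes "\<And>y. y \<in> set [q * (1 / B), q * B, q * 1, q * (- 1), q * (- 1 / s)] \<Longrightarrow> qinf (y * x) \<noteq> 0"
  shows "(\<lambda>A. outer_series A Z B x) holomorphic_on - {0}"
proof -
  define c where "c n = q ^ n * qfins [s, Z, q / Z] x n / qfins [q * (1 / B), q * B, q * 1, q * (- 1), q * (- 1 / s)] x n" for n
  have c: "summable (\<lambda>n. norm (c n))" unfolding c_def using assms by (intro qfins_quot_summable)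
  have "(\<lambda>A. \<Sum>n. qfin (A * x) n * qfin (q / A * x) n * c n) holomorphic_on - {0}"
  proof (rule holomorphic_suminf)
    fix K :: "complex set" assume K: "compact K" "K \<subseteq> - {0}"
    have "compact ((\<lambda>A. A * x) ` K)" "compact ((\<lambda>A. q / A * x) ` K)"
      using K by (auto intro!: compact_continuous_image continuous_intros)
    then obtain R1 R2 where R: "\<And>A. A \<in> K \<Longrightarrow> norm (A * x) \<le> R1" "\<And>A. A \<in> K \<Longrightarrow> norm (q / A * x) \<le> R2"
      by (metis bounded_iff compact_imp_bounded imageI)
    show "\<exists>M. summable M \<and> (\<forall>n. \<forall>A\<in>K. norm (qfin (A * x) n * qfin (q / A * x) n * c n) \<le> M n)"
    proof (intro exI conjI allI ballI)
      show "summable (\<lambda>n. emaj R1 * emaj R2 * norm (c n))" by (intro summable_mult c)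
      fix n A assume A: "A \<in> K"
      have "norm (qfin (A * x) n) \<le> emaj R1" "norm (qfin (q / A * x) n) \<le> emaj R2"
        using norm_qfin_le emaj_mono R[OF A] by (meson order_trans)+
      then show "norm (qfin (A * x) n * qfin (q / A * x) n * c n) \<le> emaj R1 * emaj R2 * norm (c n)"
        unfolding norm_mult by (intro mult_mono) (auto intro!: mult_nonneg_nonneg less_imp_le[OF emaj_pos])
    qed
  qed (auto intro!: holomorphic_intros)
  also have "(\<lambda>A. \<Sum>n. qfin (A * x) n * qfin (q / A * x) n * c n) = (\<lambda>A. outer_series A Z B x)"
    by (simp add: outer_series_def c_def qfins_def mult_ac)
  finally show ?thesis .
qed

lemma outer_series_commute: "outer_series A Z B x = outer_series Z A B x"
  unfolding outer_series_def by (simp add: qfins_def mult_ac)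

lemma outer_series_holomorphic:
  assumes B: "B \<noteq> 0" and B2: "ndep (B\<^sup>2) 1" and y: "y \<in> {1 / B, B, 1, - 1, - 1 / s}"
  shows "(\<lambda>A. outer_series A Z B (1 / y)) holomorphic_on - {0}" "(\<lambda>Z. outer_series A Z B (1 / y)) holomorphic_on - {0}"
proof -
  show "(\<lambda>A. outer_series A Z B (1 / y)) holomorphic_on - {0}" for Z
    using outer_series_denominator[OF B B2 y] by (intro outer_series_holomorphic_A)
  from this[of A] show "(\<lambda>Z. outer_series A Z B (1 / y)) holomorphic_on - {0}"
    by (simp only: outer_series_commute[of A])
qed

lemma outer_sum_holomorphic_A:
  assumes "B \<noteq> 0" "ndep (B\<^sup>2) 1" "h \<noteq> 0" "Z \<noteq> 0"
  shows "(\<lambda>A. outer_sum h A Z B) holomorphic_on - {0}"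
proof -
  note os = outer_series_holomorphic(1)[OF assms(1,2)]
  show ?thesis unfolding outer_sum_def
    by (intro holomorphic_on_add holomorphic_on_mult os holomorphic_intros) (use assms s_nz in auto)
qed

lemma outer_sum_holomorphic_Z:
  assumes "B \<noteq> 0" "ndep (B\<^sup>2) 1" "h \<noteq> 0" "A \<noteq> 0"
  shows "(\<lambda>Z. outer_sum h A Z B) holomorphic_on - {0}"
proof -
  note os = outer_series_holomorphic(2)[OF assms(1,2)]
  show ?thesis unfolding outer_sum_def
    by (intro holomorphic_on_add holomorphic_on_mult os holomorphic_intros) (use assms s_nz in auto)
qed

lemma countable_not_ndep: "countable {A. \<not> ndep Z A}" "B \<noteq> 0 \<Longrightarrow> countable {A. \<not> ndep (A * B) 1}" "B \<noteq> 0 \<Longrightarrow> countable {A. \<not> ndep (A / B) 1}"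
proof -
  have "{A. \<not> ndep Z A} \<subseteq> range (\<lambda>k::int. Z * q powi (- k))"
  proof
    fix A assume "A \<in> {A. \<not> ndep Z A}"
    then obtain k where "Z = A * q powi k" by (auto simp: ndep_def)
    then have "A = Z * q powi (- k)" using q_nz by (simp add: power_int_minus)
    then show "A \<in> range (\<lambda>k::int. Z * q powi (- k))" by blast
  qed
  then show "countable {A. \<not> ndep Z A}" by (rule countable_subset) simp
next
  assume B: "B \<noteq> 0"
  have "{A. \<not> ndep (A * B) 1} \<subseteq> range (\<lambda>k::int. q powi k / B)"
    using B by (auto simp: ndep_def field_simps image_iff)
  then show "countable {A. \<not> ndep (A * B) 1}" by (rule countable_subset) simp
  have "{A. \<not> ndep (A / B) 1} \<subseteq> range (\<lambda>k::int. q powi k * B)"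
    using B by (auto simp: ndep_def field_simps image_iff)
  then show "countable {A. \<not> ndep (A / B) 1}" by (rule countable_subset) simp
qed

text \<open>Balls are uncountable, so a non-empty open set keeps accumulation points inside itself
  when a countable set is removed, and the identity theorem applies.\<close>

lemma analytic_continuation_off_countable:
  fixes f :: "complex \<Rightarrow> complex"
  assumes f: "f holomorphic_on - {0}" and Om: "open Om" "Om \<noteq> {}" "Om \<subseteq> - {0}" and C: "countable C"
    and z: "\<And>w. w \<in> Om - C \<Longrightarrow> f w = 0" and w: "w \<noteq> 0"
  shows "f w = 0"
proof -
  obtain \<xi> where xi: "\<xi> \<in> Om" using Om(2) by auto
  have "\<xi> islimpt (Om - C)"
    unfolding islimpt_def
  proof (intro allI impI)
    fix T assume T: "\<xi> \<in> T" "open T"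
    have "open (T \<inter> Om)" "\<xi> \<in> T \<inter> Om" using T Om xi by auto
    then obtain e where e: "e > 0" "ball \<xi> e \<subseteq> T \<inter> Om" by (meson open_contains_ball)
    have "uncountable (ball \<xi> e)" using e(1) by (rule uncountable_ball)
    then have "\<not> ball \<xi> e \<subseteq> insert \<xi> C" by (metis C countable_insert countable_subset)
    then show "\<exists>y\<in>Om - C. y \<in> T \<and> y \<noteq> \<xi>" using e(2) by blast
  qed
  moreover have "connected (- {0 :: complex})" by (rule connected_punctured_universe) simp
  ultimately show ?thesis
    using analytic_continuation[OF f, of "Om - C" \<xi> w] xi Om(3) w z by blast
qed

text \<open>The exceptional values of A depend on Z, since Z / A must be no power of q. Hence A is
  continued first, for fixed generic Z, and then Z, for arbitrary A.\<close>

theorem clausen_outer: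
  assumes A: "A \<noteq> 0" and Z: "Z \<noteq> 0" and h: "h \<noteq> 0" and B: "B \<noteq> 0" and B2: "ndep (B\<^sup>2) 1"
  shows "theta h * theta (h * A / Z) * ghat A Z B ^ 2 = outer_sum h A Z B"
proof -
  define Om where "Om = {w :: complex. norm s < norm w \<and> norm w < 1}"
  have Om: "open Om" unfolding Om_def by (intro open_Collect_conj open_Collect_less continuous_intros)
  have "norm s ^ 2 < 1" using q_lt1 s2 by (metis norm_power)
  then have s1: "norm s < 1" by (simp add: power_less_one_iff)
  then obtain r where "norm s < r" "r < 1" using dense by blast
  then have "r \<ge> 0" "norm s < r" "r < 1" using norm_ge_zero[of s] by linarith+
  then have "complex_of_real r \<in> Om" by (simp add: Om_def)
  then have Om_ne: "Om \<noteq> {}" by auto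
  have Om0: "Om \<subseteq> - {0}" using s_nz by (auto simp: Om_def)
  have step1: "theta h * theta (h * A / Z) * ghat A Z B ^ 2 - outer_sum h A Z B = 0"
    if Z: "Z \<in> Om - ({A. \<not> ndep (A * B) 1} \<union> {A. \<not> ndep (A / B) 1})" and A: "A \<noteq> 0" for A Z
  proof -
    have Z0: "Z \<noteq> 0" using Z Om0 by auto
    show ?thesis
    proof (rule analytic_continuation_off_countable[where f = "\<lambda>A. theta h * theta (h * A / Z) * ghat A Z B ^ 2 - outer_sum h A Z B",
        OF _ Om Om_ne Om0 _ _ A])
      show "(\<lambda>A. theta h * theta (h * A / Z) * ghat A Z B ^ 2 - outer_sum h A Z B) holomorphic_on - {0}"
        using Z0 h by (intro holomorphic_intros outer_sum_holomorphic_A B B2 holomorphic_on_subset[OF ghat_holomorphic_A]) auto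
      show "countable ({A. \<not> ndep Z A} \<union> ({A. \<not> ndep (A * B) 1} \<union> {A. \<not> ndep (A / B) 1}))"
        by (intro countable_Un countable_not_ndep B)
      fix A assume "A \<in> Om - ({A. \<not> ndep Z A} \<union> ({A. \<not> ndep (A * B) 1} \<union> {A. \<not> ndep (A / B) 1}))"
      then show "theta h * theta (h * A / Z) * ghat A Z B ^ 2 - outer_sum h A Z B = 0"
        using clausen_outer_generic[of A Z h B] Z h B B2 by (auto simp: Om_def)
    qed
  qed
  have "theta h * theta (h * A / Z) * ghat A Z B ^ 2 - outer_sum h A Z B = 0"
  proof (rule analytic_continuation_off_countable[where f = "\<lambda>Z. theta h * theta (h * A / Z) * ghat A Z B ^ 2 - outer_sum h A Z B",
        OF _ Om Om_ne Om0 _ _ Z])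
    show "(\<lambda>Z. theta h * theta (h * A / Z) * ghat A Z B ^ 2 - outer_sum h A Z B) holomorphic_on - {0}"
      using A h by (intro holomorphic_intros outer_sum_holomorphic_Z B B2 holomorphic_on_subset[OF ghat_holomorphic_Z]) auto
    show "countable ({A. \<not> ndep (A * B) 1} \<union> {A. \<not> ndep (A / B) 1})"
      by (intro countable_Un countable_not_ndep B)
  qed (rule step1[OF _ A])
  then show ?thesis by simp
qed

end

section \<open>Translation to the notation of the theorem\<close>

context qdisc
begin

lemma qpoch_eq: "qpoch as q k = (\<Prod>a\<leftarrow>as. qfin a k)"
  by (simp add: qpoch_def qfin_def)

lemma qpoch_inf_eq: "qpoch_inf as q = (\<Prod>a\<leftarrow>as. qinf a)"
  by (simp add: qpoch_inf_def qinf_def)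

lemma qtheta_eq: "qtheta xs q = (\<Prod>x\<leftarrow>xs. theta x)"
  by (simp add: qtheta_def qpoch_inf_eq theta_def)

text \<open>Multisets absorb the order in which the parameters are listed, including the place at
  which the implicit denominator parameter q occurs.\<close>

lemma qphi_eq_qfins:
  assumes "mset as = mset (map (\<lambda>g. g * x) gs)" "mset (q # bs) = mset (map (\<lambda>g. g * x) ds)"
  shows "qphi as bs q q = (\<Sum>n. q ^ n * qfins gs x n / qfins ds x n)"
proof -
  have "qpoch as' q n = qfins gs' x n" if "mset as' = mset (map (\<lambda>g. g * x) gs')" for as' gs' n
  proof -
    have "qpoch as' q n = prod_mset (image_mset (\<lambda>a. qfin a n) (mset as'))"
      by (simp add: qpoch_eq prod_mset_prod_list flip: mset_map)
    also have "\<dots> = qfins gs' x n"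
      unfolding that by (simp add: qfins_def prod_mset_prod_list o_def flip: mset_map)
    finally show ?thesis .
  qed
  then show ?thesis using assms by (simp add: qphi_def mult.commute)
qed

end

theorem theorem8p4:
  fixes q z a b h s :: complex
  assumes nonzero: "q \<noteq> 0" "z \<noteq> 0" "a \<noteq> 0" "b \<noteq> 0" "h \<noteq> 0"
    and norms: "norm q < 1" "norm z < 1"
    and sqrt_q: "s ^ 2 = q"
    and theta_denominator: "qtheta [h, h * (q * a / (b ^ 2 * z))] q \<noteq> 0"
    and poch_denominators:
      "qpoch_inf [q * a / b, q * a / b, q / b ^ 2, q / b ^ 2] q \<noteq> 0"
      "qpoch_inf [z, z, b ^ 2 / q, b ^ 2 / q, q * a / b, q * a / b] q \<noteq> 0"
      "qpoch_inf [- 1, - s, z, q * a / b, q * a / b, b / s, s / b] q \<noteq> 0"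
      "qpoch_inf [- 1, s, z, q * a / b, q * a / b, - (b / s), - (s / b)] q \<noteq> 0"
      "qpoch_inf [z, - (b * z), 1 / s, - (1 / s), q * a / b, q * a / b, - (q * a / b),
         - (1 / b), - (b / q)] q \<noteq> 0"
    and lower_parameters:
      "admissible_lower [q * a / b] q"
      "admissible_lower [b ^ 2, b * s, - (b * s), - b] q"
      "admissible_lower [q ^ 2 / b ^ 2, s ^ 3 / b, - (s ^ 3 / b), - (q / b)] q"
      "admissible_lower [- q, - s, b * s, s ^ 3 / b] q"
      "admissible_lower [- q, s, - (b * s), - (s ^ 3 / b)] q"
      "admissible_lower [- (q * b), s ^ 3, - (s ^ 3), - (q ^ 2 / b)] q"
  shows "(qphi [a, b] [q * a / b] q z) ^ 2 =
    1 / qtheta [h, h * (q * a / (b ^ 2 * z))] q *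
    ( qtheta [h * a, h * (q / (b ^ 2 * z))] q
        * qpoch_inf [q / b, q / b, q * a / b ^ 2, q * a / b ^ 2] q
        / qpoch_inf [q * a / b, q * a / b, q / b ^ 2, q / b ^ 2] q
        * qphi [a, b, b ^ 2 / a, b ^ 2 * z / q, q / z]
               [b ^ 2, b * s, - (b * s), - b] q q
    + qtheta [h * (q * a / b ^ 2), h / z] q
        * qpoch_inf [a, a, b, b, b ^ 2 * z / q, b ^ 2 * z / q] q
        / qpoch_inf [z, z, b ^ 2 / q, b ^ 2 / q, q * a / b, q * a / b] q
        * qphi [q / a, q / b, q * a / b ^ 2, z, q ^ 2 / (b ^ 2 * z)]
               [q ^ 2 / b ^ 2, s ^ 3 / b, - (s ^ 3 / b), - (q / b)] q q
    + qtheta [h * (a * s / b), h * (s / (b * z))] q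
        * qpoch_inf [s, a, q * a / b ^ 2, b ^ 2 * z / q] q
        / qpoch_inf [- 1, - s, z, q * a / b, q * a / b, b / s, s / b] q
        * qphi [s, a * s / b, b * s / a, b * z / s, s ^ 3 / (b * z)]
               [- q, - s, b * s, s ^ 3 / b] q q
    + qtheta [- (h * (a * s / b)), - (h * (s / (b * z)))] q
        * qpoch_inf [- s, a, q * a / b ^ 2, b ^ 2 * z / q] q
        / qpoch_inf [- 1, s, z, q * a / b, q * a / b, - (b / s), - (s / b)] q
        * qphi [- s, - (a * s / b), - (b * s / a), - (b * z / s), - (s ^ 3 / (b * z))]
               [- q, s, - (b * s), - (s ^ 3 / b)] q q
    + qtheta [- (h * (q * a / b)), - (h / (b * z))] q
        * qpoch_inf [- 1, a, - (a / b), q * a / b ^ 2, - (b * z / q), b ^ 2 * z / q] q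
        / qpoch_inf [z, - (b * z), 1 / s, - (1 / s), q * a / b, q * a / b, - (q * a / b),
            - (1 / b), - (b / q)] q
        * qphi [- q, - (b * z), - (q * a / b), - (q * b / a), - (q ^ 2 / (b * z))]
               [- (q * b), s ^ 3, - (s ^ 3), - (q ^ 2 / b)] q q )"
proof -
  interpret qsqrt q s by unfold_locales (use nonzero norms sqrt_q in auto)
  \<comment> \<open>The inverse substitution is a = A B, b = s B, z = Z / B, under which the
    exchange of A and Z and the inversion of B become visible symmetries.\<close>
  define A B Z where "A = a * s / b" and "B = b / s" and "Z = b * z / s"
  note AB_defs = A_def B_def Z_def
  have q: "q = s * s" by (simp add: ss)
  have nz: "A \<noteq> 0" "B \<noteq> 0" "Z \<noteq> 0" using nonzero s_nz by (simp_all add: AB_defs)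
  note fs = field_simps q AB_defs power2_eq_square power3_eq_cube
  have par: "q * a / b = s * A" "q / b\<^sup>2 = (1 / B)\<^sup>2" "b\<^sup>2 / q = B\<^sup>2" "b / s = B" "s / b = 1 / B" "q * a / b\<^sup>2 = A / B"
    "b\<^sup>2 * z / q = Z * B" "b * z = s * Z" "q / b = s * (1 / B)" "b * s = q * B" "a * s / b = A"
    using nonzero s_nz by (simp_all add: fs)
  have ab: "a = A * B" "b = s * B" "z = Z / B" using nonzero s_nz by (simp_all add: AB_defs)
  have hAZ: "h * (q * a / (b ^ 2 * z)) = h * A / Z" using nonzero s_nz by (simp add: fs)
  then have th: "theta h * theta (h * A / Z) \<noteq> 0" using theta_denominator by (simp add: qtheta_eq)
  have nzs: "qinf (s * A) \<noteq> 0" "qinf ((1 / B)\<^sup>2) \<noteq> 0" "qinf (B\<^sup>2) \<noteq> 0" "qinf z \<noteq> 0" "qinf (- (s * A)) \<noteq> 0" "qinf (- (s * Z)) \<noteq> 0"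
    using poch_denominators by (simp_all add: qpoch_inf_eq par)
  \<comment> \<open>B^2 = b^2 / q: the non-negative powers of q are excluded by the denominator (q /
    b^2), the negative ones by (b^2 / q).\<close>
  have B2: "ndep (B\<^sup>2) 1"
    unfolding ndep_def
  proof (intro allI notI)
    fix k :: int assume k: "B\<^sup>2 = 1 * q powi k"
    show False
    proof (cases "k \<ge> 0")
      case True
      then have "(1 / B)\<^sup>2 * q ^ nat k = 1" using k q_nz by (simp add: power_divide power_int_def)
      then show False using nzs(2) qinf_eq_0_iff by blast
    next
      case False
      then have "B\<^sup>2 * q ^ nat (- k) = 1" using k q_nz by (simp add: power_int_def flip: power_mult_distrib)
      then show False using nzs(3) qinf_eq_0_iff by blast
    qed
  qed
  have \<phi>: "qphi [a, b] [q * a / b] q z = ghat A Z B / (qinf (s * A) * qinf z)"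
    using ghat_2phi1[OF nz(1,2) nzs(1), of Z] norms(2) nzs(1,4)
    by (simp add: qphi_def qpoch_eq par ab(1)[symmetric] ab(2)[symmetric] ab(3)[symmetric])
  \<comment> \<open>The five series of the theorem are this one function at x = B, 1 / B, 1, - 1 and
    - s, with the parameters listed in varying order.\<close>
  have os: "qphi as bs q q = outer_series A Z B x"
    if "as = map (\<lambda>g. g * x) [n1, n2, n3, n4, n5]" "{#n1, n2, n3, n4, n5#} = {#s, A, Z, q / A, q / Z#}"
      "q # bs = map (\<lambda>g. g * x) [d1, d2, d3, d4, d5]" "{#d1, d2, d3, d4, d5#} = {#q / B, q * B, q, - q, - s#}"
    for as bs x n1 n2 n3 n4 n5 d1 d2 d3 d4 d5
  proof -
    have "q * (- 1 / s) = - s" using s_nz by (simp add: q)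
    then have "{#d1, d2, d3, d4, d5#} = mset [q * (1 / B), q * B, q * 1, q * (- 1), q * (- 1 / s)]" using that(4) by simp
    moreover have "{#n1, n2, n3, n4, n5#} = mset [s, A, Z, q / A, q / Z]" using that(2) by simp
    ultimately show ?thesis unfolding outer_series_def that(1)
      by (intro qphi_eq_qfins) (simp_all only: that(3) mset_map mset.simps)
  qed
  have \<Phi>1: "qphi [a, b, b ^ 2 / a, b ^ 2 * z / q, q / z] [b ^ 2, b * s, - (b * s), - b] q q = outer_series A Z B B"
    by (rule os[of _ _ A s "q / A" Z "q / Z" _ "q / B" "q * B" q "- q" "- s"]) (use nonzero s_nz in \<open>simp_all add: fs\<close>)
  have \<Phi>2: "qphi [q / a, q / b, q * a / b ^ 2, z, q ^ 2 / (b ^ 2 * z)] [q ^ 2 / b ^ 2, s ^ 3 / b, - (s ^ 3 / b), - (q / b)] q q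
      = outer_series A Z B (1 / B)"
    by (rule os[of _ _ "q / A" s A Z "q / Z" _ "q * B" "q / B" q "- q" "- s"]) (use nonzero s_nz in \<open>simp_all add: fs\<close>)
  have \<Phi>3: "qphi [s, a * s / b, b * s / a, b * z / s, s ^ 3 / (b * z)] [- q, - s, b * s, s ^ 3 / b] q q = outer_series A Z B 1"
    by (rule os[of _ _ s A "q / A" Z "q / Z" _ q "- q" "- s" "q * B" "q / B"]) (use nonzero s_nz in \<open>simp_all add: fs\<close>)
  have \<Phi>4: "qphi [- s, - (a * s / b), - (b * s / a), - (b * z / s), - (s ^ 3 / (b * z))] [- q, s, - (b * s), - (s ^ 3 / b)] q q
      = outer_series A Z B (- 1)"
    by (rule os[of _ _ s A "q / A" Z "q / Z" _ "- q" q "- s" "q * B" "q / B"]) (use nonzero s_nz in \<open>simp_all add: fs\<close>)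
  have \<Phi>5: "qphi [- q, - (b * z), - (q * a / b), - (q * b / a), - (q ^ 2 / (b * z))] [- (q * b), s ^ 3, - (s ^ 3), - (q ^ 2 / b)] q q
      = outer_series A Z B (- s)"
    by (rule os[of _ _ s Z A "q / A" "q / Z" _ "- s" "q * B" "- q" q "q / B"]) (use nonzero s_nz in \<open>simp_all add: fs\<close>)
  \<comment> \<open>The square of the factor between \<open>ghat\<close> and the 2phi1 series, by
    which each of the five terms is divided.\<close>
  define K where "K = (qinf (s * A) * qinf z)\<^sup>2"
  have K: "K \<noteq> 0" using nzs by (simp add: K_def)
  have x1: "1 / (1 / B) = B" "1 / (1 :: complex) = 1" "1 / (- 1 :: complex) = - 1" "1 / (- 1 / s) = - s" "Z / B = z" "A * B = a" "s * B = b"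
    using ab by simp_all
  have args: "h * A / (1 / B) = h * a" "h * (1 / B) / Z = h * (q / (b\<^sup>2 * z))" "h * A / B = h * (q * a / b\<^sup>2)" "h * B / Z = h / z"
    "h * A / 1 = h * (a * s / b)" "h * 1 / Z = h * (s / (b * z))" "h * A / (- 1) = - (h * (a * s / b))" "h * (- 1) / Z = - (h * (s / (b * z)))"
    "h * A / (- 1 / s) = - (h * (q * a / b))" "h * (- 1 / s) / Z = - (h / (b * z))"
    using nonzero s_nz by (simp_all add: fs)
  have qi: "qinf (1 / B / B) = qinf ((1 / B)\<^sup>2)" "qinf (1 / B / 1) = qinf (1 / B)" "qinf (1 / B / (- 1)) = qinf (- (1 / B))"
      "qinf (1 / B / (- 1 / s)) = qinf (- (s * (1 / B)))"
      "qinf (B / (1 / B)) = qinf (B\<^sup>2)" "qinf (B / 1) = qinf B" "qinf (B / (- 1)) = qinf (- B)" "qinf (B / (- 1 / s)) = qinf (- b)"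
      "qinf (- 1 / (1 / B)) = qinf (- B)" "qinf (- 1 / B) = qinf (- (1 / B))" "qinf (- 1 / 1) = qinf (- 1)" "qinf (- 1 / (- 1 / s)) = qinf s"
      "qinf (- 1 / s / (1 / B)) = qinf (- (b / q))" "qinf (- 1 / s / B) = qinf (- (1 / b))" "qinf (- 1 / s / 1) = qinf (- (1 / s))"
      "qinf (- 1 / s / (- 1)) = qinf (1 / s)" "qinf (s * 1) = qinf s" "qinf (s * (- 1)) = qinf (- s)" "qinf (s * (- 1 / s)) = qinf (- 1)"
      "qinf (Z * B) = qinf (b\<^sup>2 * z / q)"
    by (intro arg_cong[of _ _ qinf]; use nonzero s_nz in \<open>simp add: fs\<close>)+
  \<comment> \<open>\<Phi> stands for the series, so only infinite products have to be matched. By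
    \<open>qinf_square\<close> the product of (1 / B), (- 1 / B) and (- s / B) is (1 / B^2) / (s /
    B), which explains the repeated factors in the first term of the theorem.\<close>
  have T1: "theta (h * A / (1 / B)) * theta (h * (1 / B) / Z) * (qinf (A / B) ^ 2 * qinf (Z / B) ^ 2)
      * (qinf (s * (1 / B)) / (qinf (1 / B / B) * qinf (1 / B / 1) * qinf (1 / B / (- 1)) * qinf (1 / B / (- 1 / s)))) * \<Phi> / K
    = qtheta [h * a, h * (q / (b ^ 2 * z))] q
        * qpoch_inf [q / b, q / b, q * a / b ^ 2, q * a / b ^ 2] q
        / qpoch_inf [q * a / b, q * a / b, q / b ^ 2, q / b ^ 2] q * \<Phi>" for \<Phi>
  proof -
    have *: "t * u * (x\<^sup>2 * y\<^sup>2) * (k / (e * v * w * l)) * \<Phi> / (p * y)\<^sup>2 = t * u * (k * (k * (x * x))) / (p * (p * (e * e))) * \<Phi>"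
      if "y \<noteq> 0" "e \<noteq> 0" "p \<noteq> 0" "e = v * w * (k * l)" for t u x y k e v w l p
    proof -
      have "v \<noteq> 0" "w \<noteq> 0" "k \<noteq> 0" "l \<noteq> 0" using that by auto
      with that(1,3) show ?thesis unfolding that(4) by (simp add: power2_eq_square divide_simps)
    qed
    show ?thesis unfolding args x1 qi K_def qtheta_eq qpoch_inf_eq par list.map prod_list.Cons prod_list.Nil mult_1_right
      by (rule *[OF nzs(4,2,1) qinf_square])
  qed
  have T2: "theta (h * A / B) * theta (h * B / Z) * (qinf (A * B) ^ 2 * qinf (Z * B) ^ 2)
      * (qinf (s * B) / (qinf (B / (1 / B)) * qinf (B / 1) * qinf (B / (- 1)) * qinf (B / (- 1 / s)))) * \<Phi> / K
    = qtheta [h * (q * a / b ^ 2), h / z] q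
        * qpoch_inf [a, a, b, b, b ^ 2 * z / q, b ^ 2 * z / q] q
        / qpoch_inf [z, z, b ^ 2 / q, b ^ 2 / q, q * a / b, q * a / b] q * \<Phi>" for \<Phi>
  proof -
    have *: "t * u * (x\<^sup>2 * y\<^sup>2) * (k / (e * v * w * l)) * \<Phi> / (p * r)\<^sup>2
      = t * u * (x * (x * (k * (k * (y * y))))) / (r * (r * (e * (e * (p * p))))) * \<Phi>"
      if "r \<noteq> 0" "e \<noteq> 0" "p \<noteq> 0" "e = v * w * (k * l)" for t u x y k e v w l p r
    proof -
      have "v \<noteq> 0" "w \<noteq> 0" "k \<noteq> 0" "l \<noteq> 0" using that by auto
      with that(1,3) show ?thesis unfolding that(4) by (simp add: power2_eq_square divide_simps)
    qed
    have "qinf (B\<^sup>2) = qinf B * qinf (- B) * (qinf b * qinf (- b))" using qinf_square[of B] x1 by simp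
    from *[OF nzs(4,3,1) this]
    show ?thesis unfolding args x1 qi K_def qtheta_eq qpoch_inf_eq by (simp add: par(1-7))
  qed
  have *: "t * u * (x * x' * (y * r)) * (k / (d1 * d2 * d3 * d4)) * \<Phi> / (p * r)\<^sup>2
      = t * u * (k * (x * (x' * y))) / (d3 * (d4 * (r * (p * (p * (d1 * d2)))))) * \<Phi>"
      if "r \<noteq> 0" for t u x x' y k d1 d2 d3 d4 p r \<Phi> :: complex
    using that by (simp add: power2_eq_square divide_simps)
  have T3: "theta (h * A / 1) * theta (h * 1 / Z) * (qinf (A * B) * qinf (A / B) * (qinf (Z * B) * qinf (Z / B)))
      * (qinf (s * 1) / (qinf (1 / (1 / B)) * qinf (1 / B) * qinf (1 / (- 1)) * qinf (1 / (- 1 / s)))) * \<Phi> / K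
    = qtheta [h * (a * s / b), h * (s / (b * z))] q
        * qpoch_inf [s, a, q * a / b ^ 2, b ^ 2 * z / q] q
        / qpoch_inf [- 1, - s, z, q * a / b, q * a / b, b / s, s / b] q * \<Phi>" for \<Phi>
    using *[OF nzs(4), of "theta (h * (a * s / b))" "theta (h * (s / (b * z)))" "qinf a" "qinf (A / B)" "qinf (b\<^sup>2 * z / q)" "qinf s"
        "qinf B" "qinf (1 / B)" "qinf (- 1)" "qinf (- s)" \<Phi> "qinf (s * A)"]
    unfolding args x1 qi K_def qtheta_eq qpoch_inf_eq by (simp add: par(1-7))
  have T4: "theta (h * A / (- 1)) * theta (h * (- 1) / Z) * (qinf (A * B) * qinf (A / B) * (qinf (Z * B) * qinf (Z / B)))
      * (qinf (s * (- 1)) / (qinf (- 1 / (1 / B)) * qinf (- 1 / B) * qinf (- 1 / 1) * qinf (- 1 / (- 1 / s)))) * \<Phi> / K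
    = qtheta [- (h * (a * s / b)), - (h * (s / (b * z)))] q
        * qpoch_inf [- s, a, q * a / b ^ 2, b ^ 2 * z / q] q
        / qpoch_inf [- 1, s, z, q * a / b, q * a / b, - (b / s), - (s / b)] q * \<Phi>" for \<Phi>
    using *[OF nzs(4), of "theta (- (h * (a * s / b)))" "theta (- (h * (s / (b * z))))" "qinf a" "qinf (A / B)" "qinf (b\<^sup>2 * z / q)" "qinf (- s)"
        "qinf (- B)" "qinf (- (1 / B))" "qinf (- 1)" "qinf s" \<Phi> "qinf (s * A)"]
    unfolding args x1 qi K_def qtheta_eq qpoch_inf_eq by (simp add: par(1-7))
  have T5: "theta (h * A / (- 1 / s)) * theta (h * (- 1 / s) / Z)
      * ((1 + A / s) * (1 + Z / s) * (qinf (A * B) * qinf (A / B) * (qinf (Z * B) * qinf (Z / B))))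
      * (qinf (s * (- 1 / s)) / (qinf (- 1 / s / (1 / B)) * qinf (- 1 / s / B) * qinf (- 1 / s / 1) * qinf (- 1 / s / (- 1)))) * \<Phi> / K
    = qtheta [- (h * (q * a / b)), - (h / (b * z))] q
        * qpoch_inf [- 1, a, - (a / b), q * a / b ^ 2, - (b * z / q), b ^ 2 * z / q] q
        / qpoch_inf [z, - (b * z), 1 / s, - (1 / s), q * a / b, q * a / b, - (q * a / b),
            - (1 / b), - (b / q)] q * \<Phi>" for \<Phi>
  proof -
    \<comment> \<open>The factors m = (- s A) and n = (- s Z) are inserted above and below: they
      complete 1 + A / s and 1 + Z / s to (- a / b) and (- b z / q).\<close>
    have *: "t * u * (f * g * (x * x' * (y * r))) * (k / (d1 * d2 * d3 * d4)) * \<Phi> / (p * r)\<^sup>2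
      = t * u * (k * (x * (f * m * (x' * (g * n * y))))) / (r * (n * (d4 * (d3 * (p * (p * (m * (d2 * d1)))))))) * \<Phi>"
      if "r \<noteq> 0" "m \<noteq> 0" "n \<noteq> 0" for t u f g x x' y k d1 d2 d3 d4 p r m n
      using that by (simp add: power2_eq_square divide_simps)
    have e: "qinf (- (X / s)) = (1 + X / s) * qinf (- (s * X))" for X
    proof -
      have "- (X / s) * q = - (s * X)" using s_nz by (simp add: q)
      then show ?thesis using qinf_split1[of "- (X / s)"] by simp
    qed
    have e': "qinf (- (a / b)) = (1 + A / s) * qinf (- (s * A))" "qinf (- (s * Z / q)) = (1 + Z / s) * qinf (- (s * Z))"
    proof -
      have "a / b = A / s" "s * Z / q = Z / s" using nonzero s_nz by (simp_all add: fs)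
      then show "qinf (- (a / b)) = (1 + A / s) * qinf (- (s * A))" "qinf (- (s * Z / q)) = (1 + Z / s) * qinf (- (s * Z))"
        using e by simp_all
    qed
    show ?thesis
      unfolding args x1 qi K_def qtheta_eq qpoch_inf_eq list.map prod_list.Cons prod_list.Nil mult_1_right e' par(1,6,8)
      by (rule *[OF nzs(4-6)])
  qed
  have "theta h * theta (h * A / Z) * ghat A Z B ^ 2 = outer_sum h A Z B"
    using nz nonzero(5) B2 by (intro clausen_outer)
  then have "ghat A Z B ^ 2 = 1 / (theta h * theta (h * A / Z)) * outer_sum h A Z B"
    using th by (simp add: divide_simps mult.commute)
  then have "(qphi [a, b] [q * a / b] q z) ^ 2 = 1 / (theta h * theta (h * A / Z)) * (outer_sum h A Z B / K)"
    unfolding \<phi> power_divide K_def by simp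
  also have "theta h * theta (h * A / Z) = qtheta [h, h * (q * a / (b ^ 2 * z))] q"
    using hAZ by (simp add: qtheta_eq)
  finally show ?thesis
    unfolding outer_sum_def add_divide_distrib T1 T2 T3 T4 T5 unfolding \<Phi>1 \<Phi>2 \<Phi>3 \<Phi>4 \<Phi>5 x1(1-4) .
qed

end
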